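(* Let $\mathbb{K}$ be a field of characteristic two and let $G$ be an undirected connected multigraph (possibly with loops) with vertices $v_1,\dots,v_n$, $n\ge 3$. Let $e$ be an edge of $G$ between $v_1$ and $v_2$ that is not a bridge. Let $\psi_1:\mathrm{CTopp}_{G/e}\to \mathrm{CTopp}_G\otimes_R R_e$ and $\phi_1:\mathrm{CTopp}_G\otimes_R R_e\to \mathrm{CTopp}_{G\setminus e}\otimes_R R_e$ be the $R_e$-module maps defined in the context, and denote also by $\psi_1$ the injective map induced on $\mathrm{CTopp}_{G/e}/\ker(\psi_1)$. Then $$0\to \mathrm{CTopp}_{G/e}/\ker(\psi_1)\xrightarrow{\ \psi_1\ }\mathrm{CTopp}_G\otimes_R R_e\xrightarrow{\ \phi_1\ }\mathrm{CTopp}_{G\setminus e}\otimes_R R_e\to 0$$ is a short exact sequence of graded $R_e$-modules.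
   Context: Graph conventions. Loops are ignored when speaking of orientations, sinks, sources, outdegrees and Laplacians: an acyclic orientation of a multigraph is an orientation of its non-loop edges without directed cycles (so parallel edges are directed the same way). Let $m_e\ge 1$ be the number of edges between $v_1$ and $v_2$. $G/e$ is obtained by merging $v_1,v_2$ into a vertex $v_{1,2}$, the other $m_e-1$ edges between $v_1$ and $v_2$ becoming loops at $v_{1,2}$. $G\setminus e$ is obtained by deleting only the edge $e$, retaining the other $m_e-1$ edges parallel to it. For adjacent distinct vertices $u,w$ of a graph $H$, $H/(u,w)$ is the graph obtained by contracting all edges between $u$ and $w$. Equivalence of acyclic orientations. Acyclic orientations $\mathcal{A}_1,\mathcal{A}_2$ of a connected multigraph $H$ are equivalent if the divisors $D_{\mathcal{A}_k}=\sum_v(\mathrm{outdeg}_{\mathcal{A}_k}(v)-1)(v)$ are linearly equivalent, i.e. differ by an element of the Laplacian lattice $L_H$ (the integer row span of the Laplacian matrix of $H$). $[\mathcal{A}]$ denotes the equivalence class of $\mathcal{A}$. Rings. $R=\mathbb{K}[x_1,\dots,x_n]$ and $R_e=\mathbb{K}[x_{1,2},x_3,\dots,x_n]$ are standard graded; $R_e\cong R/\langle x_1-x_2\rangle$ is an $R$-module via $x_1,x_2\mapsto x_{1,2}$, $x_i\mapsto x_i$ for $i\ge 3$. Toppling critical module. Let $H$ be a connected multigraph with $n_H$ vertices and $\ell_H$ loops, and let $S$ be the polynomial ring over $\mathbb{K}$ with one variable per vertex. The toppling ideal is $I_H=\langle \mathbf{x}^{\mathbf u}-\mathbf{x}^{\mathbf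 v}:\ \mathbf u,\mathbf v\in\mathbb{Z}_{\ge0}^{n_H},\ \mathbf u-\mathbf v\in L_H\rangle\subseteq S$. $S/I_H$ is Cohen–Macaulay of dimension one, and the toppling critical module is $\mathrm{CTopp}_H:=\omega_{S/I_H}(\ell_H)$, the graded canonical module $\omega_{S/I_H}\cong\mathrm{Ext}_S^{n_H-1}(S/I_H,S(-n_H))$ twisted by the number of loops, where $M(i)_j=M_{i+j}$. It is a module over $R$ for $H=G$ and $H=G\setminus e$, and over $R_e$ for $H=G/e$. Free presentation (characteristic two). $\mathrm{CTopp}_H$ has a minimal generating set in bijection with the equivalence classes $[\mathcal{A}]$ of acyclic orientations of $H$ (the standard generators, also denoted $[\mathcal{A}]$). Its relations are generated by the relations $x_u^{m_{u,w}}[\mathcal{B}_{(u,w)^+}]+x_w^{m_{u,w}}[\mathcal{B}_{(u,w)^-}]=0$, one for each pair of adjacent vertices $u\ne w$ of $H$, joined by $m_{u,w}$ edges, and each equivalence class of acyclic orientations $\mathcal{B}$ of $H/(u,w)$; here $\mathcal{B}_{(u,w)^+}$ (resp. $\mathcal{B}_{(u,w)^-}$) is the acyclic orientation of $H$ extending $\mathcal{B}$ with all edges between $u$ and $w$ having source $u$ (resp. $w$). (The relation does not depend on the representative $\mathcal{B}$.) $\mathrm{CTopp}_G\otimes_R R_e$ and $\mathrm{CTopp}_{G\setminus e}\otimes_R R_e$ have the induced presentations over $R_e$ (substitute $x_{1,2}$ for $x_1,x_2$). Maps. $\psi_1([\mathcal{A}])=x_{1,2}^{m_e-1}[\mathcal{A}_{e^+}]+x_{1,2}^{m_e-1}[\mathcal{A}_{e^-}]$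 for an acyclic orientation $\mathcal{A}$ of $G/e$, where $\mathcal{A}_{e^+}$ (resp. $\mathcal{A}_{e^-}$) is the acyclic orientation of $G$ extending $\mathcal{A}$ with all edges between $v_1$ and $v_2$ having source $v_1$ (resp. $v_2$). $\phi_1([\mathcal{A}'])=[\mathcal{A}'\setminus e]$ for an acyclic orientation $\mathcal{A}'$ of $G$, where $\mathcal{A}'\setminus e$ is the orientation of $G\setminus e$ obtained by deleting $e$. These assignments are independent of representatives and extend to well-defined $R_e$-module homomorphisms.
   Formalization: With the stated gradings ψ_1 raises degree by m_e−1 and φ_1 by 1, so the maps are not degree-preserving; the formal statement makes them so by twisting the left module by −(m_e−1) and the right module by 1. The underlying modules, maps and exactness are unchanged. *)

theory Defs
  imports "HOL-Algebra.Ideal" "HOL-Algebra.Module" "HOL-Algebra.Generated_Groups"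
    "HOL-Library.Poly_Mapping"
begin

section \<open>Multigraphs\<close>

text \<open>Undirected multigraphs, loops and parallel edges allowed: an edge is a name, and
  \<open>ends\<close> gives its set of endpoints, a singleton exactly when the edge is a loop.\<close>

record ('v, 'e) mgraph =
  verts :: "'v set"
  edges :: "'e set"
  ends :: "'e \<Rightarrow> 'v set"

definition multigraph :: "('v, 'e) mgraph \<Rightarrow> bool" where
  "multigraph G \<longleftrightarrow> finite (verts G) \<and> finite (edges G) \<and>
     (\<forall>f\<in>edges G. ends G f \<subseteq> verts G \<and> card (ends G f) \<in> {1, 2})"

definition connected_mgraph :: "('v, 'e) mgraph \<Rightarrow> bool" where
  "connected_mgraph G \<longleftrightarrow> verts G \<noteq> {} \<and>
     (\<forall>u\<in>verts G. \<forall>w\<in>verts G. (u, w) \<in> {(x, y). \<exists>f\<in>edges G. ends G f = {x, y}}\<^sup>*)"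

definition loop_edges :: "('v, 'e) mgraph \<Rightarrow> 'e set" where
  "loop_edges G = {f \<in> edges G. card (ends G f) = 1}"

definition nonloop_edges :: "('v, 'e) mgraph \<Rightarrow> 'e set" where
  "nonloop_edges G = {f \<in> edges G. card (ends G f) = 2}"

definition edges_between :: "('v, 'e) mgraph \<Rightarrow> 'v \<Rightarrow> 'v \<Rightarrow> 'e set" where
  "edges_between G u w = {f \<in> edges G. ends G f = {u, w}}"

definition delete_edge :: "('v, 'e) mgraph \<Rightarrow> 'e \<Rightarrow> ('v, 'e) mgraph" where
  "delete_edge G e = G\<lparr>edges := edges G - {e}\<rparr>"

text \<open>Meaningful for a connected \<open>G\<close>.\<close>

definition bridge :: "('v, 'e) mgraph \<Rightarrow> 'e \<Rightarrow> bool" where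
  "bridge G e \<longleftrightarrow> e \<in> edges G \<and> \<not> connected_mgraph (delete_edge G e)"

text \<open>Merging \<open>u\<close> and \<open>w\<close>: the old name \<open>u\<close> is reused for the merged vertex.\<close>

definition merge :: "'v \<Rightarrow> 'v \<Rightarrow> 'v \<Rightarrow> 'v" where
  "merge u w x = (if x = w then u else x)"

text \<open>\<open>contract_edge G e u w\<close> is \<open>G/e\<close> for an edge \<open>e\<close> between \<open>u\<close> and \<open>w\<close>; the edges parallel
  to \<open>e\<close> become loops.  \<open>contract_pair G u w\<close> is \<open>G/(u,w)\<close>; all edges between \<open>u\<close> and \<open>w\<close>
  disappear.\<close>

definition contract_edge :: "('v, 'e) mgraph \<Rightarrow> 'e \<Rightarrow> 'v \<Rightarrow> 'v \<Rightarrow> ('v, 'e) mgraph" where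
  "contract_edge G e u w =
     \<lparr>verts = merge u w ` verts G, edges = edges G - {e}, ends = (\<lambda>f. merge u w ` ends G f)\<rparr>"

definition contract_pair :: "('v, 'e) mgraph \<Rightarrow> 'v \<Rightarrow> 'v \<Rightarrow> ('v, 'e) mgraph" where
  "contract_pair G u w =
     \<lparr>verts = merge u w ` verts G, edges = edges G - edges_between G u w,
      ends = (\<lambda>f. merge u w ` ends G f)\<rparr>"


section \<open>Acyclic orientations and linear equivalence\<close>

text \<open>An orientation assigns to every non-loop edge its source; it is \<open>undefined\<close> on all other
  edge names, so that orientations are determined by their values on non-loop edges.\<close>

definition acyclic_orientations :: "('v, 'e) mgraph \<Rightarrow> ('e \<Rightarrow> 'v) set" where
  "acyclic_orientations G =
     {A \<in> (\<Pi>\<^sub>E f\<in>nonloop_edges G. ends G f).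
        acyclic {(A f, y) | f y. f \<in> nonloop_edges G \<and> y \<in> ends G f - {A f}}}"

definition outdeg :: "('v, 'e) mgraph \<Rightarrow> ('e \<Rightarrow> 'v) \<Rightarrow> 'v \<Rightarrow> nat" where
  "outdeg G A v = card {f \<in> nonloop_edges G. A f = v}"

definition orientation_divisor :: "('v, 'e) mgraph \<Rightarrow> ('e \<Rightarrow> 'v) \<Rightarrow> 'v \<Rightarrow> int" where
  "orientation_divisor G A v = (if v \<in> verts G then int (outdeg G A v) - 1 else 0)"

definition laplacian :: "('v, 'e) mgraph \<Rightarrow> 'v \<Rightarrow> 'v \<Rightarrow> int" where
  "laplacian G u v =
     (if u \<in> verts G \<and> v \<in> verts G
      then if u = v then int (card {f \<in> nonloop_edges G. u \<in> ends G f})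
           else - int (card (edges_between G u v))
      else 0)"

definition laplacian_lattice :: "('v, 'e) mgraph \<Rightarrow> ('v \<Rightarrow> int) set" where
  "laplacian_lattice G = {(\<lambda>v. \<Sum>u\<in>verts G. c u * laplacian G u v) | c :: 'v \<Rightarrow> int. True}"

definition orientation_class :: "('v, 'e) mgraph \<Rightarrow> ('e \<Rightarrow> 'v) \<Rightarrow> ('e \<Rightarrow> 'v) set" where
  "orientation_class G A =
     {A' \<in> acyclic_orientations G.
        (\<lambda>v. orientation_divisor G A v - orientation_divisor G A' v) \<in> laplacian_lattice G}"

definition orientation_classes :: "('v, 'e) mgraph \<Rightarrow> ('e \<Rightarrow> 'v) set set" where
  "orientation_classes G = orientation_class G ` acyclic_orientations G"

text \<open>The orientation of \<open>G\<close> extending an orientation \<open>B\<close> of \<open>G/(u,w)\<close> (or of \<open>G/e\<close>, which has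
  the same non-loop edges), in which all edges between \<open>u\<close> and \<open>w\<close> have source \<open>p\<close>.\<close>

definition extend_orientation ::
    "('v, 'e) mgraph \<Rightarrow> 'v \<Rightarrow> 'v \<Rightarrow> ('e \<Rightarrow> 'v) \<Rightarrow> 'v \<Rightarrow> 'e \<Rightarrow> 'v" where
  "extend_orientation G u w B p =
     (\<lambda>f\<in>nonloop_edges G. if ends G f = {u, w} then p
        else THE x. x \<in> ends G f \<and> merge u w x = B f)"

definition delete_orientation :: "('v, 'e) mgraph \<Rightarrow> 'e \<Rightarrow> ('e \<Rightarrow> 'v) \<Rightarrow> 'e \<Rightarrow> 'v" where
  "delete_orientation G e A = restrict A (nonloop_edges (delete_edge G e))"


section \<open>Graded modules\<close>

text \<open>A graded ring is represented by the same kind of record, with \<open>smult\<close> its own multiplication,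
  so that it is also a graded module over itself.  The fields \<open>mult\<close> and \<open>one\<close> play no role
  in a module and are left \<open>undefined\<close> in the constructions below.\<close>

record ('a, 'b) gmodule = "('a, 'b) module" +
  grade :: "int \<Rightarrow> 'b set"

definition graded_module :: "('a, 'a) gmodule \<Rightarrow> ('a, 'b) gmodule \<Rightarrow> bool" where
  "graded_module R M \<longleftrightarrow> module R M \<and>
     (\<forall>k. additive_subgroup (grade M k) M) \<and>
     (\<forall>i j. \<forall>r\<in>grade R i. \<forall>x\<in>grade M j. r \<odot>\<^bsub>M\<^esub> x \<in> grade M (i + j)) \<and>
     (\<forall>x\<in>carrier M. \<exists>!c. (\<forall>k. c k \<in> grade M k) \<and> finite {k. c k \<noteq> \<zero>\<^bsub>M\<^esub>} \<and>
        x = finsum M c {k. c k \<noteq> \<zero>\<^bsub>M\<^esub>})"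

definition twist :: "int \<Rightarrow> ('a, 'b) gmodule \<Rightarrow> ('a, 'b) gmodule" where
  "twist i M = M\<lparr>grade := (\<lambda>j. grade M (i + j))\<rparr>"

definition mod_homs ::
    "('a, 'a) gmodule \<Rightarrow> ('a, 'b) gmodule \<Rightarrow> ('a, 'c) gmodule \<Rightarrow> ('b \<Rightarrow> 'c) set" where
  "mod_homs R M N = {f. f \<in> carrier M \<rightarrow> carrier N \<and>
     (\<forall>x\<in>carrier M. \<forall>y\<in>carrier M. f (x \<oplus>\<^bsub>M\<^esub> y) = f x \<oplus>\<^bsub>N\<^esub> f y) \<and>
     (\<forall>r\<in>carrier R. \<forall>x\<in>carrier M. f (r \<odot>\<^bsub>M\<^esub> x) = r \<odot>\<^bsub>N\<^esub> f x)}"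

definition graded_homs ::
    "('a, 'a) gmodule \<Rightarrow> ('a, 'b) gmodule \<Rightarrow> ('a, 'c) gmodule \<Rightarrow> ('b \<Rightarrow> 'c) set" where
  "graded_homs R M N = {f \<in> mod_homs R M N. \<forall>k. f ` grade M k \<subseteq> grade N k}"

definition graded_iso ::
    "('a, 'a) gmodule \<Rightarrow> ('a, 'b) gmodule \<Rightarrow> ('a, 'c) gmodule \<Rightarrow> bool" where
  "graded_iso R M N \<longleftrightarrow> (\<exists>f\<in>graded_homs R M N. bij_betw f (carrier M) (carrier N))"

definition short_exact_graded ::
    "('a, 'a) gmodule \<Rightarrow> ('a, 'b) gmodule \<Rightarrow> ('b \<Rightarrow> 'c) \<Rightarrow> ('a, 'c) gmodule \<Rightarrow>
     ('c \<Rightarrow> 'd) \<Rightarrow> ('a, 'd) gmodule \<Rightarrow> bool" where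
  "short_exact_graded R M f N g P \<longleftrightarrow>
     graded_module R M \<and> graded_module R N \<and> graded_module R P \<and>
     f \<in> graded_homs R M N \<and> g \<in> graded_homs R N P \<and>
     inj_on f (carrier M) \<and> f ` carrier M = a_kernel N P g \<and> g ` carrier N = carrier P"

definition sub_gmod :: "('a, 'b) gmodule \<Rightarrow> 'b set \<Rightarrow> ('a, 'b) gmodule" where
  "sub_gmod M N = M\<lparr>carrier := N, grade := (\<lambda>k. grade M k \<inter> N)\<rparr>"

definition quot_gmod :: "('a, 'b) gmodule \<Rightarrow> 'b set \<Rightarrow> ('a, 'b set) gmodule" where
  "quot_gmod M N =
     \<lparr>carrier = a_rcosets\<^bsub>M\<^esub> N, mult = undefined, one = undefined, zero = N, add = set_add M,
      smult = (\<lambda>r X. \<Union>x\<in>X. N +>\<^bsub>M\<^esub> (r \<odot>\<^bsub>M\<^esub> x)),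
      grade = (\<lambda>k. (\<lambda>x. N +>\<^bsub>M\<^esub> x) ` grade M k)\<rparr>"

definition induced_map :: "('b \<Rightarrow> 'c) \<Rightarrow> 'b set \<Rightarrow> 'c" where
  "induced_map f = (\<lambda>X. the_elem (f ` X))"

definition submodule_generated ::
    "('a, 'a) gmodule \<Rightarrow> ('a, 'b) gmodule \<Rightarrow> 'b set \<Rightarrow> 'b set" where
  "submodule_generated R M X = \<Inter>{N. submodule N R M \<and> X \<subseteq> N}"

text \<open>The graded free module with basis indexed by the finite set \<open>I\<close>, the basis element of index
  \<open>i\<close> having degree \<open>d i\<close>, that is, the direct sum of the \<open>R(-d i)\<close>.\<close>

definition free_gmod ::
    "('a, 'a) gmodule \<Rightarrow> 'i set \<Rightarrow> ('i \<Rightarrow> int) \<Rightarrow> ('a, 'i \<Rightarrow> 'a) gmodule" where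
  "free_gmod R I d =
     \<lparr>carrier = {a. (\<forall>i\<in>I. a i \<in> carrier R) \<and> (\<forall>i. i \<notin> I \<longrightarrow> a i = \<zero>\<^bsub>R\<^esub>)},
      mult = undefined, one = undefined,
      zero = (\<lambda>_. \<zero>\<^bsub>R\<^esub>), add = (\<lambda>a b i. a i \<oplus>\<^bsub>R\<^esub> b i), smult = (\<lambda>r a i. r \<otimes>\<^bsub>R\<^esub> a i),
      grade = (\<lambda>k. {a. (\<forall>i\<in>I. a i \<in> grade R (k - d i)) \<and> (\<forall>i. i \<notin> I \<longrightarrow> a i = \<zero>\<^bsub>R\<^esub>)})\<rparr>"

text \<open>The degree \<open>k\<close> part consists of the maps raising degrees by \<open>k\<close>; for finitely generated
  \<open>M\<close> this is a grading of the whole module of homomorphisms.\<close>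

definition hom_gmod ::
    "('a, 'a) gmodule \<Rightarrow> ('a, 'b) gmodule \<Rightarrow> ('a, 'c) gmodule \<Rightarrow> ('a, 'b \<Rightarrow> 'c) gmodule" where
  "hom_gmod R M N =
     \<lparr>carrier = mod_homs R M N \<inter> extensional (carrier M),
      mult = undefined, one = undefined,
      zero = (\<lambda>x\<in>carrier M. \<zero>\<^bsub>N\<^esub>), add = (\<lambda>f g. \<lambda>x\<in>carrier M. f x \<oplus>\<^bsub>N\<^esub> g x),
      smult = (\<lambda>r f. \<lambda>x\<in>carrier M. r \<odot>\<^bsub>N\<^esub> f x),
      grade = (\<lambda>k. {f \<in> mod_homs R M N \<inter> extensional (carrier M).
                      \<forall>j. f ` grade M j \<subseteq> grade N (j + k)})\<rparr>"


section \<open>Ext modules\<close>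

text \<open>\<open>\<dots> \<rightarrow> F 1 \<rightarrow> F 0 \<rightarrow> N \<rightarrow> 0\<close> is a resolution by graded free modules of finite rank, where
  \<open>F i\<close> has rank \<open>rk i\<close> and basis degrees \<open>dg i\<close>, and \<open>d i\<close> maps \<open>F (i + 1)\<close> to \<open>F i\<close>.\<close>

definition res_term ::
    "('a, 'a) gmodule \<Rightarrow> (nat \<Rightarrow> nat) \<Rightarrow> (nat \<Rightarrow> nat \<Rightarrow> int) \<Rightarrow> nat \<Rightarrow> ('a, nat \<Rightarrow> 'a) gmodule" where
  "res_term R rk dg i = free_gmod R {..<rk i} (dg i)"

definition graded_free_resolution ::
    "('a, 'a) gmodule \<Rightarrow> ('a, 'b) gmodule \<Rightarrow> (nat \<Rightarrow> nat) \<Rightarrow> (nat \<Rightarrow> nat \<Rightarrow> int) \<Rightarrow>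
     (nat \<Rightarrow> (nat \<Rightarrow> 'a) \<Rightarrow> (nat \<Rightarrow> 'a)) \<Rightarrow> ((nat \<Rightarrow> 'a) \<Rightarrow> 'b) \<Rightarrow> bool" where
  "graded_free_resolution R N rk dg d \<epsilon> \<longleftrightarrow>
     (let F = res_term R rk dg in
       \<epsilon> \<in> graded_homs R (F 0) N \<and> \<epsilon> ` carrier (F 0) = carrier N \<and>
       (\<forall>i. d i \<in> graded_homs R (F (Suc i)) (F i)) \<and>
       d 0 ` carrier (F 1) = a_kernel (F 0) N \<epsilon> \<and>
       (\<forall>i. d (Suc i) ` carrier (F (Suc (Suc i))) = a_kernel (F (Suc i)) (F i) (d i)))"

text \<open>\<open>Ext\<^sup>p(N, Q)\<close> computed from a resolution of \<open>N\<close>: the cohomology at \<open>Hom(F p, Q)\<close> of the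
  complex \<open>Hom(F, Q)\<close>.\<close>

definition ext_gmod ::
    "('a, 'a) gmodule \<Rightarrow> (nat \<Rightarrow> nat) \<Rightarrow> (nat \<Rightarrow> nat \<Rightarrow> int) \<Rightarrow>
     (nat \<Rightarrow> (nat \<Rightarrow> 'a) \<Rightarrow> (nat \<Rightarrow> 'a)) \<Rightarrow> nat \<Rightarrow> ('a, 'c) gmodule \<Rightarrow>
     ('a, ((nat \<Rightarrow> 'a) \<Rightarrow> 'c) set) gmodule" where
  "ext_gmod R rk dg d p Q =
     (let F = res_term R rk dg;
          H = (\<lambda>i. hom_gmod R (F i) Q);
          \<delta> = (\<lambda>i f. \<lambda>x\<in>carrier (F (Suc i)). f (d i x));
          Z = a_kernel (H p) (H (Suc p)) (\<delta> p);
          B = (case p of 0 \<Rightarrow> {\<zero>\<^bsub>H 0\<^esub>} | Suc q \<Rightarrow> \<delta> q ` carrier (H q))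
      in quot_gmod (sub_gmod (H p) Z) B)"


section \<open>Extension of scalars\<close>

text \<open>Here \<open>T\<close> is both a ring (by \<open>mult\<close>) and an \<open>R\<close>-module (by \<open>smult\<close>).  The tensor product is
  the free abelian group on \<open>M \<times> T\<close> modulo the subgroup generated by the bilinearity relations;
  it is a \<open>T\<close>-module by multiplication on the second factor.\<close>

definition pretensor :: "('r, 'b) gmodule \<Rightarrow> ('r, 's) gmodule \<Rightarrow> ('s, ('b \<times> 's) \<Rightarrow>\<^sub>0 int) gmodule" where
  "pretensor M T =
     \<lparr>carrier = {z. Poly_Mapping.keys z \<subseteq> carrier M \<times> carrier T},
      mult = undefined, one = undefined, zero = 0, add = (+),
      smult = (\<lambda>s. frag_extend (\<lambda>(m, t). frag_of (m, s \<otimes>\<^bsub>T\<^esub> t))),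
      grade = (\<lambda>k. {z. Poly_Mapping.keys z \<subseteq> (\<Union>i. grade M i \<times> grade T (k - i))})\<rparr>"

definition tensor_relations ::
    "('r, 'r) gmodule \<Rightarrow> ('r, 'b) gmodule \<Rightarrow> ('r, 's) gmodule \<Rightarrow> (('b \<times> 's) \<Rightarrow>\<^sub>0 int) set" where
  "tensor_relations R M T =
     {frag_of (m \<oplus>\<^bsub>M\<^esub> m', t) - frag_of (m, t) - frag_of (m', t) | m m' t.
        m \<in> carrier M \<and> m' \<in> carrier M \<and> t \<in> carrier T} \<union>
     {frag_of (m, t \<oplus>\<^bsub>T\<^esub> t') - frag_of (m, t) - frag_of (m, t') | m t t'.
        m \<in> carrier M \<and> t \<in> carrier T \<and> t' \<in> carrier T} \<union>
     {frag_of (r \<odot>\<^bsub>M\<^esub> m, t) - frag_of (m, r \<odot>\<^bsub>T\<^esub> t) | r m t.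
        r \<in> carrier R \<and> m \<in> carrier M \<and> t \<in> carrier T}"

definition tensor_null ::
    "('r, 'r) gmodule \<Rightarrow> ('r, 'b) gmodule \<Rightarrow> ('r, 's) gmodule \<Rightarrow> (('b \<times> 's) \<Rightarrow>\<^sub>0 int) set" where
  "tensor_null R M T = generate (add_monoid (pretensor M T)) (tensor_relations R M T)"

definition tensor ::
    "('r, 'r) gmodule \<Rightarrow> ('r, 'b) gmodule \<Rightarrow> ('r, 's) gmodule \<Rightarrow>
     ('s, (('b \<times> 's) \<Rightarrow>\<^sub>0 int) set) gmodule" where
  "tensor R M T = quot_gmod (pretensor M T) (tensor_null R M T)"

definition pure_tensor ::
    "('r, 'r) gmodule \<Rightarrow> ('r, 'b) gmodule \<Rightarrow> ('r, 's) gmodule \<Rightarrow> 'b \<Rightarrow> 's \<Rightarrow>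
     (('b \<times> 's) \<Rightarrow>\<^sub>0 int) set" where
  "pure_tensor R M T m t = tensor_null R M T +>\<^bsub>pretensor M T\<^esub> frag_of (m, t)"


section \<open>Polynomial rings\<close>

text \<open>Polynomials are finitely supported maps from exponent vectors to coefficients, with the
  convolution product of \<^theory>\<open>HOL-Library.Poly_Mapping\<close>.\<close>

type_synonym ('v, 'k) mpoly = "('v \<Rightarrow>\<^sub>0 nat) \<Rightarrow>\<^sub>0 'k"

definition monomial_degree :: "('v \<Rightarrow>\<^sub>0 nat) \<Rightarrow> nat" where
  "monomial_degree u = (\<Sum>v\<in>Poly_Mapping.keys u. Poly_Mapping.lookup u v)"

definition mpolys :: "'v set \<Rightarrow> ('v, 'k::zero) mpoly set" where
  "mpolys V = {p. \<forall>u\<in>Poly_Mapping.keys p. Poly_Mapping.keys u \<subseteq> V}"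

definition polyring :: "'v set \<Rightarrow> (('v, 'k::field) mpoly, ('v, 'k) mpoly) gmodule" where
  "polyring V =
     \<lparr>carrier = mpolys V, mult = (*), one = 1, zero = 0, add = (+), smult = (*),
      grade = (\<lambda>k. {p \<in> mpolys V. \<forall>u\<in>Poly_Mapping.keys p. int (monomial_degree u) = k})\<rparr>"

definition monom :: "('v \<Rightarrow>\<^sub>0 nat) \<Rightarrow> ('v, 'k::field) mpoly" where
  "monom u = Poly_Mapping.single u 1"

definition var :: "'v \<Rightarrow> ('v, 'k::field) mpoly" where
  "var v = monom (Poly_Mapping.single v 1)"

text \<open>The substitution of \<open>x\<^bsub>\<rho> v\<^esub>\<close> for each variable \<open>x\<^bsub>v\<^esub>\<close>.\<close>

definition subst_vars :: "('v \<Rightarrow> 'w) \<Rightarrow> ('v, 'k::field) mpoly \<Rightarrow> ('w, 'k) mpoly" where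
  "subst_vars \<rho> p =
     (\<Sum>u\<in>Poly_Mapping.keys p. Poly_Mapping.single
        (\<Sum>v\<in>Poly_Mapping.keys u. Poly_Mapping.single (\<rho> v) (Poly_Mapping.lookup u v))
        (Poly_Mapping.lookup p u))"

text \<open>The polynomial ring on \<open>V\<close> with \<open>v\<close> and \<open>w\<close> merged, as an algebra over the polynomial ring
  on \<open>V\<close>.\<close>

definition merged_polyring ::
    "'v \<Rightarrow> 'v \<Rightarrow> 'v set \<Rightarrow> (('v, 'k::field) mpoly, ('v, 'k) mpoly) gmodule" where
  "merged_polyring v w V =
     (polyring (merge v w ` V))\<lparr>smult := (\<lambda>p q. subst_vars (merge v w) p * q)\<rparr>"


section \<open>The toppling critical module\<close>

definition toppling_ideal :: "('v, 'e) mgraph \<Rightarrow> ('v, 'k::field) mpoly set" where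
  "toppling_ideal H =
     Idl\<^bsub>polyring (verts H)\<^esub>
       {monom u - monom v | u v.
          Poly_Mapping.keys u \<subseteq> verts H \<and> Poly_Mapping.keys v \<subseteq> verts H \<and>
          (\<lambda>x. int (Poly_Mapping.lookup u x) - int (Poly_Mapping.lookup v x))
            \<in> laplacian_lattice H}"

text \<open>\<open>C\<close> is a copy of \<open>\<omega>(\<ell>)\<close>, where \<open>\<omega> = Ext\<^bsup>n-1\<^esup>(S/I, S(-n))\<close> is the graded canonical
  module of \<open>S/I\<close> for the toppling ideal \<open>I\<close> of \<open>H\<close>, and \<open>\<ell>\<close> is the number of loops.\<close>

definition toppling_critical_module ::
    "('v, 'e) mgraph \<Rightarrow> (('v, 'k::field) mpoly, 'c) gmodule \<Rightarrow> bool" where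
  "toppling_critical_module H C \<longleftrightarrow>
     (let S = polyring (verts H); n = card (verts H) in
       graded_module S C \<and>
       (\<exists>rk dg d \<epsilon>.
          graded_free_resolution S (quot_gmod S (toppling_ideal H)) rk dg d \<epsilon> \<and>
          graded_iso S C
            (twist (int (card (loop_edges H))) (ext_gmod S rk dg d (n - 1) (twist (- int n) S)))))"

text \<open>The relation attached to \<open>u\<close>, \<open>w\<close> and \<open>B\<close>, as an element of the free module on the
  equivalence classes of acyclic orientations.  If the two extensions of \<open>B\<close> are equivalent,
  its only coefficient is the sum of the two powers.\<close>

definition orientation_relation ::
    "('v, 'e) mgraph \<Rightarrow> 'v \<Rightarrow> 'v \<Rightarrow> ('e \<Rightarrow> 'v) \<Rightarrow> ('e \<Rightarrow> 'v) set \<Rightarrow> ('v, 'k::field) mpoly" where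
  "orientation_relation H u w B = (\<lambda>K.
     (if K = orientation_class H (extend_orientation H u w B u)
      then var u ^ card (edges_between H u w) else 0) +
     (if K = orientation_class H (extend_orientation H u w B w)
      then var w ^ card (edges_between H u w) else 0))"

definition orientation_relations ::
    "('v, 'e) mgraph \<Rightarrow> (('e \<Rightarrow> 'v) set \<Rightarrow> ('v, 'k::field) mpoly) set" where
  "orientation_relations H =
     {orientation_relation H u w B | u w B.
        u \<noteq> w \<and> edges_between H u w \<noteq> {} \<and> B \<in> acyclic_orientations (contract_pair H u w)}"

text \<open>\<open>g\<close> is a family of standard generators of the toppling critical module \<open>C\<close> in characteristic
  two: a minimal generating set in bijection with the equivalence classes of acyclic
  orientations, with relations generated by the relations above.  Generators of a graded module
  are homogeneous; here their common degree is \<open>n\<close> minus the number of all edges: the last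
  free module of the minimal resolution of \<open>S/I\<close> is generated in degree \<open>m\<close>, the number of
  non-loop edges, so that \<open>Ext\<^bsup>n-1\<^esup>(S/I, S(-n))\<close> is generated in degree \<open>n - m\<close>, and the twist
  by the number \<open>\<ell>\<close> of loops lowers this to \<open>n - m - \<ell>\<close>.\<close>

definition standard_generators ::
    "('v, 'e) mgraph \<Rightarrow> (('v, 'k::field) mpoly, 'c) gmodule \<Rightarrow> (('e \<Rightarrow> 'v) set \<Rightarrow> 'c) \<Rightarrow> bool" where
  "standard_generators H C g \<longleftrightarrow>
     (let S = polyring (verts H);
          I = orientation_classes H;
          deg = int (card (verts H)) - int (card (edges H));
          F = free_gmod S I (\<lambda>_. deg)
      in inj_on g I \<and> g ` I \<subseteq> grade C deg \<and>
         submodule_generated S C (g ` I) = carrier C \<and>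
         (\<forall>J. J \<subset> I \<longrightarrow> submodule_generated S C (g ` J) \<noteq> carrier C) \<and>
         {a \<in> carrier F. (\<Oplus>\<^bsub>C\<^esub>K\<in>I. a K \<odot>\<^bsub>C\<^esub> g K) = \<zero>\<^bsub>C\<^esub>} =
           submodule_generated S F (orientation_relations H))"


section \<open>The maps of the deletion-contraction sequence\<close>

text \<open>In all of the following, \<open>e\<close> is an edge between \<open>v\<close> and \<open>w\<close>, and \<open>v\<close> also names the merged
  vertex; so \<open>var v\<close> in the merged ring is the variable of the merged vertex.  Homomorphisms are unique on the carrier because they are
  prescribed on generators.\<close>

definition ctopp_tensor ::
    "('v, 'e) mgraph \<Rightarrow> 'v \<Rightarrow> 'v \<Rightarrow> (('v, 'k::field) mpoly, 'c) gmodule \<Rightarrow>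
     (('v, 'k) mpoly, (('c \<times> ('v, 'k) mpoly) \<Rightarrow>\<^sub>0 int) set) gmodule" where
  "ctopp_tensor H v w C = tensor (polyring (verts H)) C (merged_polyring v w (verts H))"

definition gen_tensor ::
    "('v, 'e) mgraph \<Rightarrow> 'v \<Rightarrow> 'v \<Rightarrow> (('v, 'k::field) mpoly, 'c) gmodule \<Rightarrow>
     (('e \<Rightarrow> 'v) set \<Rightarrow> 'c) \<Rightarrow> ('e \<Rightarrow> 'v) \<Rightarrow> (('c \<times> ('v, 'k) mpoly) \<Rightarrow>\<^sub>0 int) set" where
  "gen_tensor H v w C g A =
     pure_tensor (polyring (verts H)) C (merged_polyring v w (verts H))
       (g (orientation_class H A)) 1"

definition is_psi1 ::
    "('v, 'e) mgraph \<Rightarrow> 'e \<Rightarrow> 'v \<Rightarrow> 'v \<Rightarrow>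
     (('v, 'k::field) mpoly, 'a) gmodule \<Rightarrow> (('e \<Rightarrow> 'v) set \<Rightarrow> 'a) \<Rightarrow>
     (('v, 'k) mpoly, 'b) gmodule \<Rightarrow> (('e \<Rightarrow> 'v) set \<Rightarrow> 'b) \<Rightarrow>
     ('a \<Rightarrow> (('b \<times> ('v, 'k) mpoly) \<Rightarrow>\<^sub>0 int) set) \<Rightarrow> bool" where
  "is_psi1 G e v w Cc gc C g \<psi> \<longleftrightarrow>
     (let Ge = contract_edge G e v w;
          T = ctopp_tensor G v w C;
          x = var v ^ (card (edges_between G v w) - 1)
      in \<psi> \<in> mod_homs (polyring (verts Ge)) Cc T \<and>
         (\<forall>A\<in>acyclic_orientations Ge.
            \<psi> (gc (orientation_class Ge A)) =
              (x \<odot>\<^bsub>T\<^esub> gen_tensor G v w C g (extend_orientation G v w A v)) \<oplus>\<^bsub>T\<^esub>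
              (x \<odot>\<^bsub>T\<^esub> gen_tensor G v w C g (extend_orientation G v w A w))))"

definition is_phi1 ::
    "('v, 'e) mgraph \<Rightarrow> 'e \<Rightarrow> 'v \<Rightarrow> 'v \<Rightarrow>
     (('v, 'k::field) mpoly, 'b) gmodule \<Rightarrow> (('e \<Rightarrow> 'v) set \<Rightarrow> 'b) \<Rightarrow>
     (('v, 'k) mpoly, 'c) gmodule \<Rightarrow> (('e \<Rightarrow> 'v) set \<Rightarrow> 'c) \<Rightarrow>
     ((('b \<times> ('v, 'k) mpoly) \<Rightarrow>\<^sub>0 int) set \<Rightarrow> (('c \<times> ('v, 'k) mpoly) \<Rightarrow>\<^sub>0 int) set) \<Rightarrow> bool" where
  "is_phi1 G e v w C g Cd gd \<phi> \<longleftrightarrow>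
     (let Gd = delete_edge G e
      in \<phi> \<in> mod_homs (polyring (verts (contract_edge G e v w)))
                (ctopp_tensor G v w C) (ctopp_tensor Gd v w Cd) \<and>
         (\<forall>A\<in>acyclic_orientations G.
            \<phi> (gen_tensor G v w C g A) = gen_tensor Gd v w Cd gd (delete_orientation G e A)))"

end

theory Submission
  imports Defs "HOL-Algebra.Free_Abelian_Groups"
begin

text \<open>Everything is easy except \<open>ker \<phi>\<^sub>1 \<subseteq> im \<psi>\<^sub>1\<close>.  For this, a map \<open>\<chi>\<close> from
  \<open>CTopp\<^bsub>G\<setminus>e\<^esub> \<otimes> R\<^sub>e\<close> to the cokernel of \<open>\<psi>\<^sub>1\<close> is built from the presentation of
  \<open>CTopp\<^bsub>G\<setminus>e\<^esub>\<close>, sending the class of an acyclic orientation of \<open>G \<setminus> e\<close> to the class of any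
  acyclic extension to \<open>G\<close>; then \<open>\<chi> \<circ> \<phi>\<^sub>1\<close> is the projection to the cokernel.

  That \<open>\<chi>\<close> is well defined has three ingredients.  Two different extensions of one orientation exist
  only if \<open>e\<close> has no parallel edge; they are then the two extensions of an orientation of \<open>G/e\<close>, so
  that in characteristic two their generators agree modulo the image of \<open>\<psi>\<^sub>1\<close>.  Equivalent acyclic
  orientations are connected by reversals of directed cuts, and such a reversal in \<open>G \<setminus> e\<close> extends
  to one in \<open>G\<close>.  Finally the relation at \<open>u, w\<close> lifts to a relation of \<open>G\<close> by extending an acyclic
  orientation of \<open>(G \<setminus> e)/(u,w)\<close> to \<open>G/(u,w)\<close>, unless \<open>{u, w} = {v\<^sub>1, v\<^sub>2}\<close>, where it lifts to
  an element of the image of \<open>\<psi>\<^sub>1\<close>.\<close>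

section \<open>Equivalence of acyclic orientations\<close>

text \<open>The modules are handled through their presentations, so the kernel of phi_1 is
  controlled by mapping out of its target, where the presentation lists exactly what must be
  checked. The obstacle is that generators are indexed by classes modulo the Laplacian lattice,
  while extending over e is done for one orientation at a time. Cut reversals bridge the two: a
  difference of divisors is the Laplacian of an integer potential c, and reversing the cut around
  the set where c is maximal takes one unit off c there, until c vanishes and the orientations
  coincide. The degree shifts come from counting. The generators attached to a graph lie in degree
  number of vertices minus number of edges. Contraction loses one vertex and one edge, so psi_1
  raises degrees by exactly the exponent m_e - 1 of its coefficients; deletion loses one edge only,
  so phi_1 raises them by 1. The twists by -(m_e - 1) and by 1 make both maps homogeneous of degree
  zero.\<close>

definition arcs :: "('v, 'e) mgraph \<Rightarrow> ('e \<Rightarrow> 'v) \<Rightarrow> ('v \<times> 'v) set" where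
  "arcs H A = (\<Union>f\<in>nonloop_edges H. {A f} \<times> (ends H f - {A f}))"

text \<open>The condition inside \<open>orientation_class\<close>, freed from acyclicity of its
  second argument, so that it is an equivalence relation on all source functions.\<close>

definition lin_equiv :: "('v, 'e) mgraph \<Rightarrow> ('e \<Rightarrow> 'v) \<Rightarrow> ('e \<Rightarrow> 'v) \<Rightarrow> bool" where
  "lin_equiv H A A' \<longleftrightarrow>
     (\<lambda>v. orientation_divisor H A v - orientation_divisor H A' v) \<in> laplacian_lattice H"

lemma acyclic_orientations_iff:
  "A \<in> acyclic_orientations H \<longleftrightarrow>
     A \<in> (\<Pi>\<^sub>E f\<in>nonloop_edges H. ends H f) \<and> acyclic (arcs H A)"
proof -
  have "arcs H A = {(A f, y) | f y. f \<in> nonloop_edges H \<and> y \<in> ends H f - {A f}}"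
    unfolding arcs_def by blast
  then show ?thesis by (simp add: acyclic_orientations_def)
qed

lemma orientation_source: "A \<in> acyclic_orientations H \<Longrightarrow> f \<in> nonloop_edges H \<Longrightarrow> A f \<in> ends H f"
  by (auto simp: acyclic_orientations_iff PiE_def)

lemma orientation_acyclic: "A \<in> acyclic_orientations H \<Longrightarrow> acyclic (arcs H A)"
  by (simp add: acyclic_orientations_iff)

lemma orientation_eqI:
  assumes "A \<in> acyclic_orientations H" "A' \<in> acyclic_orientations H"
    and "\<And>f. f \<in> nonloop_edges H \<Longrightarrow> A f = A' f"
  shows "A = A'"
  using assms PiE_ext[of A "nonloop_edges H" "ends H" A'] by (auto simp: acyclic_orientations_iff)

lemma nonloopE:
  assumes "f \<in> nonloop_edges H" "x \<in> ends H f"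
  obtains y where "ends H f = {x, y}" "x \<noteq> y"
proof -
  obtain a b where "ends H f = {a, b}" "a \<noteq> b"
    using assms(1) by (auto simp: nonloop_edges_def card_2_iff)
  then show thesis using assms(2) that[of a] that[of b] by auto
qed

lemma finite_nonloop: "multigraph H \<Longrightarrow> finite (nonloop_edges H)"
  by (auto simp: multigraph_def nonloop_edges_def)

lemma ends_nonloop_subset: "multigraph H \<Longrightarrow> f \<in> nonloop_edges H \<Longrightarrow> ends H f \<subseteq> verts H"
  by (auto simp: multigraph_def nonloop_edges_def)

lemma edges_between_nonloop: "u \<noteq> w \<Longrightarrow> edges_between H u w = {f \<in> nonloop_edges H. ends H f = {u, w}}"
  by (auto simp: edges_between_def nonloop_edges_def)

section \<open>Divisor differences as sums over edges\<close>

lemma laplacian_lattice_diff: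
  "a \<in> laplacian_lattice H \<Longrightarrow> b \<in> laplacian_lattice H \<Longrightarrow> (\<lambda>v. a v - b v) \<in> laplacian_lattice H"
proof -
  assume "a \<in> laplacian_lattice H" "b \<in> laplacian_lattice H"
  then obtain c d where "a = (\<lambda>v. \<Sum>u\<in>verts H. c u * laplacian H u v)"
      "b = (\<lambda>v. \<Sum>u\<in>verts H. d u * laplacian H u v)"
    by (auto simp: laplacian_lattice_def)
  then have "(\<lambda>v. a v - b v) = (\<lambda>v. \<Sum>u\<in>verts H. (c u - d u) * laplacian H u v)"
    by (simp add: left_diff_distrib sum_subtractf)
  then show ?thesis
    unfolding laplacian_lattice_def by (intro CollectI exI[of _ "\<lambda>u. c u - d u"]) simp
qed

lemma laplacian_lattice_zero: "(\<lambda>v. 0) \<in> laplacian_lattice H"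
  unfolding laplacian_lattice_def by (intro CollectI exI[of _ "\<lambda>u. 0"]) simp

lemma lin_equiv_refl: "lin_equiv H A A"
  by (simp add: lin_equiv_def laplacian_lattice_zero)

lemma lin_equiv_sym: "lin_equiv H A A' \<Longrightarrow> lin_equiv H A' A"
  using laplacian_lattice_diff[OF laplacian_lattice_zero] by (fastforce simp: lin_equiv_def)

lemma lin_equiv_trans: "lin_equiv H A B \<Longrightarrow> lin_equiv H B C \<Longrightarrow> lin_equiv H A C"
proof -
  assume a: "lin_equiv H A B" "lin_equiv H B C"
  show ?thesis
    using laplacian_lattice_diff[OF a(1)[unfolded lin_equiv_def] lin_equiv_sym[OF a(2), unfolded lin_equiv_def]]
    by (simp add: lin_equiv_def)
qed

lemma orientation_class_eq_iff:
  assumes "A' \<in> acyclic_orientations H"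
  shows "orientation_class H A = orientation_class H A' \<longleftrightarrow> lin_equiv H A A'"
proof -
  have *: "orientation_class H A = {B \<in> acyclic_orientations H. lin_equiv H A B}" for A
    by (simp add: orientation_class_def lin_equiv_def)
  show ?thesis
    using assms unfolding * by (blast intro: lin_equiv_refl lin_equiv_sym lin_equiv_trans)
qed

text \<open>An edge with ends v and y contributes c v - c y to the Laplacian of c at v. Summing over
  both ends of the edge adds only the zero term y = v, so the other end need not be named.\<close>

lemma laplacian_sum:
  fixes c :: "'v \<Rightarrow> int"
  assumes H: "multigraph H" and v: "v \<in> verts H"
  shows "(\<Sum>u\<in>verts H. c u * laplacian H u v) =
    (\<Sum>f\<in>{f \<in> nonloop_edges H. v \<in> ends H f}. \<Sum>y\<in>ends H f. c v - c y)"
proof -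
  let ?E = "{f \<in> nonloop_edges H. v \<in> ends H f}"
  have fV: "finite (verts H)" and fE: "finite ?E"
    using H finite_nonloop[OF H] by (auto simp: multigraph_def)
  \<comment> \<open>Each nonloop edge has two ends, hence 2 * c v; one of the two copies is
    cancelled below by the term of the end v itself.\<close>
  have "(\<Sum>f\<in>?E. \<Sum>y\<in>ends H f. c v - c y) = (\<Sum>f\<in>?E. 2 * c v - (\<Sum>y\<in>ends H f. c y))"
    by (rule sum.cong) (auto simp: sum_subtractf nonloop_edges_def)
  also have "\<dots> = 2 * c v * int (card ?E) - (\<Sum>f\<in>?E. \<Sum>y\<in>ends H f. c y)"
    by (simp add: sum_subtractf)
  also have "(\<Sum>f\<in>?E. \<Sum>y\<in>ends H f. c y) = (\<Sum>f\<in>?E. \<Sum>u\<in>verts H. if u \<in> ends H f then c u else 0)"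
  proof (rule sum.cong[OF refl])
    fix f assume "f \<in> ?E"
    then have "verts H \<inter> {u. u \<in> ends H f} = ends H f" using ends_nonloop_subset[OF H] by auto
    then show "(\<Sum>y\<in>ends H f. c y) = (\<Sum>u\<in>verts H. if u \<in> ends H f then c u else 0)"
      using sum.inter_restrict[OF fV, of c "ends H f"] by simp
  qed
  also have "\<dots> = (\<Sum>u\<in>verts H. \<Sum>f\<in>?E. if u \<in> ends H f then c u else 0)"
    by (rule sum.swap)
  also have "\<dots> = (\<Sum>u\<in>verts H. c u * int (card {f \<in> ?E. u \<in> ends H f}))"
  proof (rule sum.cong[OF refl])
    fix u
    have "(\<Sum>f\<in>?E. if u \<in> ends H f then c u else 0) = (\<Sum>f\<in>{f \<in> ?E. u \<in> ends H f}. c u)"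
      by (rule sum.inter_filter[symmetric, OF fE])
    then show "(\<Sum>f\<in>?E. if u \<in> ends H f then c u else 0) = c u * int (card {f \<in> ?E. u \<in> ends H f})"
      by simp
  qed
  also have "\<dots> = c v * int (card ?E) + (\<Sum>u\<in>verts H - {v}. c u * int (card {f \<in> ?E. u \<in> ends H f}))"
    using v fV by (subst sum.remove[of _ v]) (auto intro!: arg_cong[of _ _ card])
  also have "(\<Sum>u\<in>verts H - {v}. c u * int (card {f \<in> ?E. u \<in> ends H f})) =
      - (\<Sum>u\<in>verts H - {v}. c u * laplacian H u v)"
    unfolding sum_negf[symmetric]
  proof (rule sum.cong[OF refl])
    fix u assume u: "u \<in> verts H - {v}"
    have "ends H f = {u, v}" if "f \<in> nonloop_edges H" "v \<in> ends H f" "u \<in> ends H f" for f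
      using nonloopE[OF that(1,2)] that(3) u by blast
    then have "{f \<in> ?E. u \<in> ends H f} = edges_between H u v"
      using u by (auto simp: edges_between_nonloop)
    then show "c u * int (card {f \<in> ?E. u \<in> ends H f}) = - (c u * laplacian H u v)"
      using u v by (simp add: laplacian_def)
  qed
  finally have "(\<Sum>f\<in>?E. \<Sum>y\<in>ends H f. c v - c y) =
      c v * int (card ?E) + (\<Sum>u\<in>verts H - {v}. c u * laplacian H u v)"
    by simp
  also have "\<dots> = (\<Sum>u\<in>verts H. c u * laplacian H u v)"
    using v fV by (subst (2) sum.remove[of _ v]) (auto simp: laplacian_def)
  finally show ?thesis ..
qed

text \<open>The contribution of edge f to the Laplacian of c at v, set to 0 when f misses v. Edge
  sums then run over the same set for every v, so they can be interchanged with sums over vertices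
  and compared edge by edge.\<close>

definition slope :: "('v, 'e) mgraph \<Rightarrow> ('v \<Rightarrow> int) \<Rightarrow> 'v \<Rightarrow> 'e \<Rightarrow> int" where
  "slope H c v f = (if v \<in> ends H f then \<Sum>y\<in>ends H f. c v - c y else 0)"

lemma outdeg_sum: "multigraph H \<Longrightarrow> int (outdeg H A v) = (\<Sum>f\<in>nonloop_edges H. of_bool (A f = v))"
  by (simp add: outdeg_def finite_nonloop Int_def flip: of_bool_def)

text \<open>The constants -1 in the two divisors cancel, which leaves sums over edges on both
  sides.\<close>

lemma lin_equiv_iff:
  assumes H: "multigraph H"
  shows "lin_equiv H A A' \<longleftrightarrow> (\<exists>c. \<forall>v\<in>verts H.
     (\<Sum>f\<in>nonloop_edges H. of_bool (A f = v) - of_bool (A' f = v)) =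
     (\<Sum>f\<in>nonloop_edges H. slope H c v f))"
proof -
  have 1: "(\<Sum>u\<in>verts H. c u * laplacian H u v) = (if v \<in> verts H then \<Sum>f\<in>nonloop_edges H. slope H c v f else 0)" for c v
  proof (cases "v \<in> verts H")
    case True
    then show ?thesis
      unfolding laplacian_sum[OF H True] sum.inter_filter[OF finite_nonloop[OF H]] by (simp add: slope_def)
  qed (simp add: laplacian_def)
  have 2: "orientation_divisor H A v - orientation_divisor H A' v =
     (if v \<in> verts H then \<Sum>f\<in>nonloop_edges H. of_bool (A f = v) - of_bool (A' f = v) else 0)" for v
    by (simp add: orientation_divisor_def outdeg_sum[OF H] sum_subtractf)
  show ?thesis
    unfolding lin_equiv_def laplacian_lattice_def 1 2 fun_eq_iff by (simp) meson
qed

text \<open>Among the edges on which the two orientations disagree, A has a source v. Of these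
  edges, A directs all that meet v out of v and A' directs them all into v, so the outdegrees at v
  differ.\<close>

lemma orientation_eq_if_outdeg_eq:
  assumes H: "multigraph H" and A: "A \<in> acyclic_orientations H" and A': "A' \<in> acyclic_orientations H"
    and eq: "\<And>v. v \<in> verts H \<Longrightarrow>
      (\<Sum>f\<in>nonloop_edges H. of_bool (A f = v) - of_bool (A' f = v)) = (0::int)"
  shows "A = A'"
proof (rule ccontr)
  assume "A \<noteq> A'"
  define F where "F = {f \<in> nonloop_edges H. A f \<noteq> A' f}"
  define r where "r = (\<Union>f\<in>F. {A f} \<times> (ends H f - {A f}))"
  obtain f0 where f0: "f0 \<in> F" using orientation_eqI[OF A A'] \<open>A \<noteq> A'\<close> by (auto simp: F_def)
  have fin: "finite F" using finite_nonloop[OF H] by (simp add: F_def)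
  have "r \<subseteq> arcs H A" by (auto simp: r_def arcs_def F_def)
  then have "acyclic r" using orientation_acyclic[OF A] acyclic_subset by blast
  moreover have "r \<subseteq> (\<lambda>f. A f) ` F \<times> (\<Union>f\<in>F. ends H f)" by (auto simp: r_def)
  then have "finite r"
  proof (rule finite_subset)
    have "finite (ends H f)" if "f \<in> F" for f
      using that by (intro card_ge_0_finite) (simp add: F_def nonloop_edges_def)
    then show "finite (A ` F \<times> (\<Union>f\<in>F. ends H f))" using fin by simp
  qed
  ultimately have "wf r" by (rule finite_acyclic_wf[rotated])
  moreover have "A f0 \<in> A ` F" using f0 by blast
  ultimately obtain v where v: "v \<in> A ` F" and vmin: "\<And>u. (u, v) \<in> r \<Longrightarrow> u \<notin> A ` F"
    using wfE_min[of r "A f0" "A ` F"] by blast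
  \<comment> \<open>Every predecessor in r is the tail of an edge of F, so minimality among the
    tails excludes all predecessors of v.\<close>
  have no: "(u, v) \<notin> r" for u using vmin[of u] by (auto simp: r_def)
  have "A f = v" if "f \<in> F" "v \<in> ends H f" for f
    using no[of "A f"] that by (auto simp: r_def)
  then have A'v: "A' f \<noteq> v" if "f \<in> F" for f
    using that orientation_source[OF A', of f] by (auto simp: F_def)
  obtain f1 where f1: "f1 \<in> F" "A f1 = v" using v by blast
  have vV: "v \<in> verts H"
    using f1 orientation_source[OF A, of f1] ends_nonloop_subset[OF H, of f1] by (auto simp: F_def)
  have "0 = (\<Sum>f\<in>nonloop_edges H. of_bool (A f = v) - of_bool (A' f = v) :: int)" using eq[OF vV] by simp
  also have "\<dots> = (\<Sum>f\<in>F. of_bool (A f = v) - of_bool (A' f = v))"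
    by (rule sum.mono_neutral_right) (auto simp: F_def finite_nonloop[OF H])
  also have "\<dots> = (\<Sum>f\<in>F. of_bool (A f = v))" by (rule sum.cong) (auto simp: A'v)
  also have "\<dots> > 0" using f1 fin by (intro sum_pos2[of _ f1]) auto
  finally show False by simp
qed

section \<open>Reversing directed cuts\<close>

lemma acyclic_cut:
  assumes r: "acyclic r" and s: "\<And>x y. (x, y) \<in> s \<Longrightarrow> (x, y) \<in> r \<and> (x \<in> S \<longleftrightarrow> y \<in> S) \<or> x \<in> S \<and> y \<notin> S"
  shows "acyclic s"
proof -
  \<comment> \<open>A walk in s that leaves S never returns, so a closed walk stays on one side and
    uses only arcs of r.\<close>
  have "(x, y) \<in> r\<^sup>+ \<and> (x \<in> S \<longleftrightarrow> y \<in> S) \<or> x \<in> S \<and> y \<notin> S" if "(x, y) \<in> s\<^sup>+" for x y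
    using that
  proof induction
    case (base y) then show ?case using s by blast
  next
    case (step y z) then show ?case using s[of y z] by (metis trancl.trancl_into_trancl)
  qed
  then show ?thesis using r by (auto simp: acyclic_def)
qed

text \<open>Chip firing of the vertex set S, seen on orientations: the sources of the crossing edges
  move from S to its complement. An empty cut is allowed and gives A = B.\<close>

definition cut_step :: "('v, 'e) mgraph \<Rightarrow> 'v set \<Rightarrow> ('e \<Rightarrow> 'v) \<Rightarrow> ('e \<Rightarrow> 'v) \<Rightarrow> bool" where
  "cut_step H S A B \<longleftrightarrow> A \<in> acyclic_orientations H \<and> B \<in> acyclic_orientations H \<and>
     (\<forall>f\<in>nonloop_edges H. if ends H f \<subseteq> S \<or> ends H f \<inter> S = {} then B f = A f else A f \<in> S \<and> B f \<notin> S)"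

text \<open>The equation already holds edge by edge: a crossing edge has slope 1 at its end in S and
  -1 at the other end, and any other edge has slope 0.\<close>

lemma cut_step_divisor:
  assumes H: "multigraph H" and st: "cut_step H S A B"
  shows "(\<Sum>f\<in>nonloop_edges H. of_bool (A f = v) - of_bool (B f = v)) =
     (\<Sum>f\<in>nonloop_edges H. slope H (\<lambda>u. of_bool (u \<in> S)) v f)"
proof (rule sum.cong[OF refl])
  fix f assume f: "f \<in> nonloop_edges H"
  have A: "A f \<in> ends H f" and B: "B f \<in> ends H f" using st f by (auto simp: cut_step_def orientation_source)
  obtain y where y: "ends H f = {A f, y}" "A f \<noteq> y" using nonloopE[OF f A] .
  have *: "if ends H f \<subseteq> S \<or> ends H f \<inter> S = {} then B f = A f else A f \<in> S \<and> B f \<notin> S"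
    using st f by (simp add: cut_step_def)
  show "(of_bool (A f = v) - of_bool (B f = v)) = slope H (\<lambda>u. of_bool (u \<in> S)) v f"
    using * B unfolding slope_def y(1) using y(2) by (auto split: if_splits)
qed

lemma cut_step_lin_equiv:
  assumes H: "multigraph H" and st: "cut_step H S A B"
  shows "lin_equiv H A B"
  unfolding lin_equiv_iff[OF H] using cut_step_divisor[OF H st] by blast

text \<open>Sum the divisor equation over S. A crossing edge has total slope at least 1, since the
  integer c is below M outside S, while the two orientations contribute at most 1 for it; other
  edges contribute 0 to both sides. Equality of the sums forces equality for every edge, and for a
  crossing edge this pins both directions.\<close>

lemma argmax_cut:
  fixes c :: "'v \<Rightarrow> int"
  assumes H: "multigraph H" and A: "A \<in> acyclic_orientations H" and A': "A' \<in> acyclic_orientations H"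
    and eq: "\<And>v. v \<in> verts H \<Longrightarrow>
      (\<Sum>f\<in>nonloop_edges H. of_bool (A f = v) - of_bool (A' f = v)) = (\<Sum>f\<in>nonloop_edges H. slope H c v f)"
    and S: "S = {v \<in> verts H. c v = M}" and M: "\<And>v. v \<in> verts H \<Longrightarrow> c v \<le> M"
    and f: "f \<in> nonloop_edges H" "\<not> ends H f \<subseteq> S" "ends H f \<inter> S \<noteq> {}"
  shows "A f \<in> S \<and> A' f \<notin> S"
proof -
  have fV: "finite (verts H)" using H by (simp add: multigraph_def)
  have fS: "finite S" and SV: "S \<subseteq> verts H" unfolding S using fV by auto
  \<comment> \<open>The excess, for a single edge, of the slope side over the orientation side after
    summation over S.\<close>
  define d where "d f = (\<Sum>v\<in>S. slope H c v f) - (of_bool (A f \<in> S) - of_bool (A' f \<in> S))" for f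
  have slope_S: "(\<Sum>v\<in>S. slope H c v f) = (\<Sum>v\<in>ends H f \<inter> S. \<Sum>y\<in>ends H f. M - c y)" for f
  proof -
    have "(\<Sum>v\<in>S. slope H c v f) = (\<Sum>v\<in>S. if v \<in> ends H f then \<Sum>y\<in>ends H f. M - c y else 0)"
      by (rule sum.cong) (auto simp: slope_def S)
    also have "\<dots> = (\<Sum>v\<in>S \<inter> ends H f. \<Sum>y\<in>ends H f. M - c y)" by (rule sum.inter_restrict[symmetric, OF fS])
    finally show ?thesis by (simp add: Int_commute)
  qed
  have noncut: "d f = 0" if "f \<in> nonloop_edges H" "ends H f \<subseteq> S \<or> ends H f \<inter> S = {}" for f
  proof -
    have "A f \<in> S \<longleftrightarrow> A' f \<in> S"
      using that orientation_source[OF A, of f] orientation_source[OF A', of f] by auto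
    moreover have "(\<Sum>v\<in>ends H f \<inter> S. \<Sum>y\<in>ends H f. M - c y) = 0"
      using that(2) by (auto intro!: sum.neutral simp: S)
    ultimately show ?thesis by (simp add: d_def slope_S)
  qed
  have cut: "d f \<ge> 1 - (of_bool (A f \<in> S) - of_bool (A' f \<in> S))"
    if f: "f \<in> nonloop_edges H" and cutf: "\<not> ends H f \<subseteq> S" "ends H f \<inter> S \<noteq> {}" for f
  proof -
    obtain x where x: "x \<in> ends H f" "x \<in> S" using cutf by blast
    obtain y where y: "ends H f = {x, y}" "x \<noteq> y" using nonloopE[OF f x(1)] .
    have yS: "y \<notin> S" using cutf x y by auto
    have "y \<in> verts H" using y ends_nonloop_subset[OF H f] by auto
    then have "c y < M" using M[of y] yS by (auto simp: S)
    moreover have "ends H f \<inter> S = {x}" "c x = M" using x y yS by (auto simp: S)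
    ultimately have "(\<Sum>v\<in>ends H f \<inter> S. \<Sum>y\<in>ends H f. M - c y) \<ge> 1" using y by simp
    then show ?thesis by (simp add: d_def slope_S)
  qed
  have nonneg: "d f \<ge> 0" if "f \<in> nonloop_edges H" for f
    using noncut[OF that] cut[OF that] by (cases "ends H f \<subseteq> S \<or> ends H f \<inter> S = {}") (auto simp: of_bool_def split: if_splits)
  have "(\<Sum>v\<in>S. \<Sum>f\<in>nonloop_edges H. slope H c v f) =
        (\<Sum>v\<in>S. \<Sum>f\<in>nonloop_edges H. of_bool (A f = v) - of_bool (A' f = v))"
    by (rule sum.cong[OF refl], rule eq[symmetric]) (use SV in auto)
  then have "(\<Sum>f\<in>nonloop_edges H. \<Sum>v\<in>S. slope H c v f) =
        (\<Sum>f\<in>nonloop_edges H. \<Sum>v\<in>S. of_bool (A f = v) - of_bool (A' f = v))"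
    by (subst (1 2) sum.swap)
  also have "\<dots> = (\<Sum>f\<in>nonloop_edges H. of_bool (A f \<in> S) - of_bool (A' f \<in> S))"
    using fS by (simp add: sum_subtractf of_bool_def)
  finally have "(\<Sum>f\<in>nonloop_edges H. d f) = 0"
    by (simp add: d_def sum_subtractf)
  then have "d f = 0"
    using sum_nonneg_eq_0_iff[of "nonloop_edges H" d] nonneg finite_nonloop[OF H] f(1) by blast
  then show ?thesis using cut[OF f] by (auto simp: of_bool_def split: if_splits)
qed

lemma slope_diff: "slope H (\<lambda>u. c u - d u) v f = slope H c v f - slope H d v f"
proof -
  have "(\<Sum>y\<in>ends H f. (c v - d v) - (c y - d y)) = (\<Sum>y\<in>ends H f. (c v - c y) - (d v - d y))"
    by (rule sum.cong) auto
  then show ?thesis by (simp add: slope_def sum_subtractf)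
qed

lemma slope_const: "slope H (\<lambda>_. k) v f = 0"
  by (simp add: slope_def)

lemma cut_step_exists:
  assumes A: "A \<in> acyclic_orientations H" and A': "A' \<in> acyclic_orientations H"
    and cut: "\<And>f. f \<in> nonloop_edges H \<Longrightarrow> \<not> ends H f \<subseteq> S \<Longrightarrow> ends H f \<inter> S \<noteq> {} \<Longrightarrow> A f \<in> S \<and> A' f \<notin> S"
  shows "\<exists>B. cut_step H S A B"
proof -
  \<comment> \<open>On the cut edges A' already points into S, so its values there serve as the
    reversal of A.\<close>
  define B where "B = (\<lambda>f\<in>nonloop_edges H. if ends H f \<subseteq> S \<or> ends H f \<inter> S = {} then A f else A' f)"
  have "acyclic (arcs H B)"
  \<comment> \<open>In B the crossing arcs leave the complement of S, hence the use of
    \<open>- S\<close>.\<close>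
  proof (rule acyclic_cut[OF orientation_acyclic[OF A], of _ "- S"])
    fix x y assume "(x, y) \<in> arcs H B"
    then obtain f where f: "f \<in> nonloop_edges H" "x = B f" "y \<in> ends H f" "y \<noteq> x" by (auto simp: arcs_def)
    have xf: "x \<in> ends H f" using f orientation_source[OF A f(1)] orientation_source[OF A' f(1)] by (simp add: B_def)
    show "(x, y) \<in> arcs H A \<and> (x \<in> - S \<longleftrightarrow> y \<in> - S) \<or> x \<in> - S \<and> y \<notin> - S"
    proof (cases "ends H f \<subseteq> S \<or> ends H f \<inter> S = {}")
      case True
      then have "x = A f" using f by (simp add: B_def)
      then show ?thesis using True f xf by (auto simp: arcs_def)
    next
      case False
      then have "x = A' f" using f by (simp add: B_def)
      moreover obtain z where "ends H f = {x, z}" using nonloopE[OF f(1) xf] by blast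
      moreover have "A f \<in> ends H f" by (rule orientation_source[OF A f(1)])
      ultimately show ?thesis using cut[OF f(1)] False f by auto
    qed
  qed
  then have "B \<in> acyclic_orientations H"
    using orientation_source[OF A] orientation_source[OF A'] by (auto simp: acyclic_orientations_iff B_def)
  then have "cut_step H S A B" using A cut by (auto simp: cut_step_def B_def)
  then show ?thesis by blast
qed

text \<open>If \<open>D\<^sub>A - D\<^sub>A'\<close> is the Laplacian of \<open>c\<close>, then the edges leaving the set where \<open>c\<close> is maximal
  are all directed outwards by \<open>A\<close>; reversing that cut lowers \<open>c\<close> on this set.\<close>

lemma lin_equiv_cut_steps:
  assumes H: "multigraph H" and A: "A \<in> acyclic_orientations H" and A': "A' \<in> acyclic_orientations H"
    and eqv: "lin_equiv H A A'"
  shows "(\<lambda>B B'. \<exists>S. cut_step H S B B')\<^sup>*\<^sup>* A A'"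
proof -
  have fV: "finite (verts H)" using H by (simp add: multigraph_def)
  have main: "(\<lambda>B B'. \<exists>S. cut_step H S B B')\<^sup>*\<^sup>* A A'"
    if "A \<in> acyclic_orientations H" "\<And>v. v \<in> verts H \<Longrightarrow> c v \<ge> 0"
      "\<And>v. v \<in> verts H \<Longrightarrow> (\<Sum>f\<in>nonloop_edges H. of_bool (A f = v) - of_bool (A' f = v)) =
         (\<Sum>f\<in>nonloop_edges H. slope H c v f)" for c A
    using that
  \<comment> \<open>The potential is kept nonnegative so that its total is a measure that falls with
    each reversal.\<close>
  proof (induction "nat (sum c (verts H))" arbitrary: c A rule: less_induct)
    case less
    show ?case
    proof (cases "\<forall>v\<in>verts H. c v = 0")
      case True
      \<comment> \<open>A vanishing potential means equal outdegrees at every vertex, hence equal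
        orientations.\<close>
      then have "slope H c v f = 0" if "f \<in> nonloop_edges H" "v \<in> verts H" for f v
        using that ends_nonloop_subset[OF H that(1)] by (auto simp: slope_def intro!: sum.neutral)
      then have "A = A'" using less.prems by (intro orientation_eq_if_outdeg_eq[OF H _ A']) auto
      then show ?thesis by simp
    next
      case False
      then have ne: "verts H \<noteq> {}" by auto
      define M where "M = Max (c ` verts H)"
      have M: "c v \<le> M" if "v \<in> verts H" for v using that fV by (simp add: M_def)
      define S where "S = {v \<in> verts H. c v = M}"
      have "M \<in> c ` verts H" using ne fV unfolding M_def by (intro Max_in) auto
      then have Sne: "S \<noteq> {}" by (auto simp: S_def)
      \<comment> \<open>Since c is nonnegative and not identically zero, its maximum is positive,
        and lowering c by 1 on S keeps it nonnegative.\<close>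
      have Mpos: "M > 0" using False less.prems(2) M by (metis less_le_trans order_less_le)
      have "A f \<in> S \<and> A' f \<notin> S" if "f \<in> nonloop_edges H" "\<not> ends H f \<subseteq> S" "ends H f \<inter> S \<noteq> {}" for f
        using argmax_cut[OF H less.prems(1) A' less.prems(3) S_def M that] .
      then obtain B where B: "cut_step H S A B" using cut_step_exists[OF less.prems(1) A'] by blast
      define c' where "c' u = c u - of_bool (u \<in> S)" for u
      have "sum c' (verts H) < sum c (verts H)"
        using Sne fV by (intro sum_strict_mono_ex1) (auto simp: c'_def S_def)
      moreover have "c' v \<ge> 0" if "v \<in> verts H" for v
        using less.prems(2)[OF that] Mpos by (auto simp: c'_def S_def)
      moreover have "(\<Sum>f\<in>nonloop_edges H. of_bool (B f = v) - of_bool (A' f = v)) =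
         (\<Sum>f\<in>nonloop_edges H. slope H c' v f)" if "v \<in> verts H" for v
      proof -
        have "(\<Sum>f\<in>nonloop_edges H. of_bool (B f = v) - of_bool (A' f = v)) =
          (\<Sum>f\<in>nonloop_edges H. of_bool (A f = v) - of_bool (A' f = v)) -
          (\<Sum>f\<in>nonloop_edges H. of_bool (A f = v) - of_bool (B f = v) :: int)"
          by (simp add: sum_subtractf)
        also have "\<dots> = (\<Sum>f\<in>nonloop_edges H. slope H c v f) -
           (\<Sum>f\<in>nonloop_edges H. slope H (\<lambda>u. of_bool (u \<in> S)) v f)"
          by (simp only: less.prems(3)[OF that] cut_step_divisor[OF H B])
        finally show ?thesis by (simp add: c'_def[abs_def] slope_diff sum_subtractf)
      qed
      moreover have "sum c' (verts H) \<ge> 0" using calculation(2) by (intro sum_nonneg) auto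
      ultimately have "(\<lambda>B B'. \<exists>S. cut_step H S B B')\<^sup>*\<^sup>* B A'"
        using B by (intro less.hyps[of c' B]) (auto simp: cut_step_def)
      moreover have "\<exists>S. cut_step H S A B" using B by blast
      ultimately show ?thesis
        using converse_rtranclp_into_rtranclp[of "\<lambda>B B'. \<exists>S. cut_step H S B B'" A B A'] by simp
    qed
  qed
  obtain c where c: "\<And>v. v \<in> verts H \<Longrightarrow>
     (\<Sum>f\<in>nonloop_edges H. of_bool (A f = v) - of_bool (A' f = v)) = (\<Sum>f\<in>nonloop_edges H. slope H c v f)"
    using eqv by (auto simp: lin_equiv_iff[OF H])
  show ?thesis
  \<comment> \<open>Shifting c by a constant changes no slope, so the potential can be made
    nonnegative by subtracting its minimum.\<close>
  proof (rule main[of A "\<lambda>u. c u - Min (c ` verts H)"])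
    show "c v - Min (c ` verts H) \<ge> 0" if "v \<in> verts H" for v using that fV by simp
    show "(\<Sum>f\<in>nonloop_edges H. of_bool (A f = v) - of_bool (A' f = v)) =
         (\<Sum>f\<in>nonloop_edges H. slope H (\<lambda>u. c u - Min (c ` verts H)) v f)" if "v \<in> verts H" for v
      using c[OF that] by (simp add: slope_diff[of H c "\<lambda>_. Min (c ` verts H)"] slope_const)
  qed (use A in auto)
qed

section \<open>Contraction and deletion\<close>

lemma delete_edge_simps [simp]:
  "verts (delete_edge H e) = verts H" "ends (delete_edge H e) = ends H"
  "edges (delete_edge H e) = edges H - {e}"
  "nonloop_edges (delete_edge H e) = nonloop_edges H - {e}"
  by (auto simp: delete_edge_def nonloop_edges_def)

lemma edges_between_delete: "edges_between (delete_edge H e) u w = edges_between H u w - {e}"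
  by (auto simp: edges_between_def)

lemma multigraph_delete: "multigraph H \<Longrightarrow> multigraph (delete_edge H e)"
  by (simp add: multigraph_def)

lemma contract_pair_simps [simp]:
  "verts (contract_pair H u w) = merge u w ` verts H"
  "edges (contract_pair H u w) = edges H - edges_between H u w"
  "ends (contract_pair H u w) f = merge u w ` ends H f"
  by (simp_all add: contract_pair_def)

text \<open>Only u and w are identified by \<open>merge\<close>, and an edge with two ends contains
  both of them only if it joins them.\<close>

lemma merge_inj_on_ends:
  assumes "f \<in> nonloop_edges H" "ends H f \<noteq> {u, w}"
  shows "inj_on (merge u w) (ends H f)"
proof (rule inj_onI)
  fix x y assume xy: "x \<in> ends H f" "y \<in> ends H f" "merge u w x = merge u w y"
  obtain z where "ends H f = {x, z}" using nonloopE[OF assms(1) xy(1)] by blast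
  then show "x = y" using xy assms(2) by (auto simp: merge_def split: if_splits)
qed

lemma nonloop_contract:
  assumes H: "multigraph H" and f: "f \<in> edges H" and uw: "u \<noteq> w"
  shows "card (merge u w ` ends H f) = 2 \<longleftrightarrow> f \<in> nonloop_edges H \<and> ends H f \<noteq> {u, w}"
proof (cases "f \<in> nonloop_edges H")
  case True
  show ?thesis
  proof (cases "ends H f = {u, w}")
    case True
    then have "merge u w ` ends H f = {u}" by (auto simp: merge_def)
    then show ?thesis using True by simp
  next
    case False
    then show ?thesis using True card_image[OF merge_inj_on_ends[OF True False]]
      by (simp add: nonloop_edges_def)
  qed
next
  case False
  then have "card (ends H f) = 1" using H f by (auto simp: multigraph_def nonloop_edges_def)
  then show ?thesis using False by (auto simp: card_1_singleton_iff)
qed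

lemma nonloop_contract_pair:
  assumes "multigraph H" "u \<noteq> w"
  shows "nonloop_edges (contract_pair H u w) = {f \<in> nonloop_edges H. ends H f \<noteq> {u, w}}"
  using nonloop_contract[OF assms(1) _ assms(2)]
  by (auto simp: nonloop_edges_def[of "contract_pair H u w"] edges_between_def) (auto simp: nonloop_edges_def)

text \<open>The two contractions differ only in the edges parallel to e, which become loops in one
  and vanish in the other; orientations see neither.\<close>

lemma acyclic_orientations_contract_edge:
  assumes H: "multigraph H" and uw: "u \<noteq> w" and e: "ends H e = {u, w}"
  shows "acyclic_orientations (contract_edge H e u w) = acyclic_orientations (contract_pair H u w)"
proof -
  have "nonloop_edges (contract_edge H e u w) = nonloop_edges (contract_pair H u w)"
    using nonloop_contract[OF H _ uw] e
    unfolding nonloop_contract_pair[OF H uw] nonloop_edges_def[of "contract_edge H e u w"]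
    by (auto simp: contract_edge_def nonloop_edges_def simp del: image_insert)
  moreover have "ends (contract_edge H e u w) = ends (contract_pair H u w)"
    by (simp add: contract_edge_def contract_pair_def)
  ultimately have "A \<in> acyclic_orientations (contract_edge H e u w) \<longleftrightarrow>
      A \<in> acyclic_orientations (contract_pair H u w)" for A
    by (simp only: acyclic_orientations_iff arcs_def)
  then show ?thesis by blast
qed

text \<open>Describes the two extensions of one orientation of H/(u,w) inside H, without mention of
  the contraction. In this form pairs can be restricted and lifted directly along the deletion of an
  edge; \<open>opposite_pair_contract\<close> recovers the orientation of the contraction when u and
  w are adjacent.\<close>

definition opposite_pair :: "('v, 'e) mgraph \<Rightarrow> 'v \<Rightarrow> 'v \<Rightarrow> ('e \<Rightarrow> 'v) \<Rightarrow> ('e \<Rightarrow> 'v) \<Rightarrow> bool" where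
  "opposite_pair H u w A A' \<longleftrightarrow> A \<in> acyclic_orientations H \<and> A' \<in> acyclic_orientations H \<and>
     (\<forall>f\<in>nonloop_edges H. if ends H f = {u, w} then A f = u \<and> A' f = w else A f = A' f)"

lemma opposite_pair_commute: "opposite_pair H u w A A' \<Longrightarrow> opposite_pair H w u A' A"
  by (auto simp: opposite_pair_def insert_commute)

lemma extend_orientation_nonparallel:
  assumes f: "f \<in> nonloop_edges H" "ends H f \<noteq> {u, w}" and x: "x \<in> ends H f" "merge u w x = B f"
  shows "extend_orientation H u w B p f = x"
proof -
  have "(THE y. y \<in> ends H f \<and> merge u w y = B f) = x"
    using x merge_inj_on_ends[OF f] by (intro the_equality) (auto simp: inj_on_def)
  then show ?thesis using f by (simp add: extend_orientation_def)
qed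

lemma extend_orientation_nonparallel':
  assumes H: "multigraph H" "u \<noteq> w" and B: "B \<in> acyclic_orientations (contract_pair H u w)"
    and f: "f \<in> nonloop_edges H" "ends H f \<noteq> {u, w}"
  shows "extend_orientation H u w B p f \<in> ends H f" "merge u w (extend_orientation H u w B p f) = B f"
proof -
  have "B f \<in> merge u w ` ends H f"
    using orientation_source[OF B, of f] f by (simp add: nonloop_contract_pair[OF H])
  then obtain x where "x \<in> ends H f" "merge u w x = B f" by auto
  moreover from this have "extend_orientation H u w B p f = x" by (intro extend_orientation_nonparallel[OF f])
  ultimately show "extend_orientation H u w B p f \<in> ends H f" "merge u w (extend_orientation H u w B p f) = B f"
    by auto
qed

text \<open>Projecting a walk to H/(u,w) loses only arcs from p to q, and two of these never follow
  each other. A closed walk would therefore project to a nonempty closed walk. The names p and q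
  cover both choices of the source at once.\<close>

lemma extend_orientation_acyclic:
  assumes H: "multigraph H" "u \<noteq> w" and B: "B \<in> acyclic_orientations (contract_pair H u w)"
    and pq: "{p, q} = {u, w}"
  shows "extend_orientation H u w B p \<in> acyclic_orientations H"
proof -
  let ?A = "extend_orientation H u w B p" and ?r = "arcs (contract_pair H u w) B"
  have mpq: "merge u w p = merge u w q" "p \<noteq> q" using pq H(2) by (auto simp: merge_def doubleton_eq_iff)
  have par: "?A f = p" if "f \<in> nonloop_edges H" "ends H f = {u, w}" for f
    using that by (simp add: extend_orientation_def)
  note nonpar = extend_orientation_nonparallel'[OF H B]
  have arc: "(merge u w x, merge u w y) \<in> ?r \<or> x = p \<and> y = q" if xy: "(x, y) \<in> arcs H ?A" for x y
  proof -
    obtain f where f: "f \<in> nonloop_edges H" "x = ?A f" "y \<in> ends H f" "y \<noteq> x"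
      using xy by (auto simp: arcs_def)
    show ?thesis
    proof (cases "ends H f = {u, w}")
      case True then show ?thesis using par[OF f(1) True] f pq by auto
    next
      case False
      have "f \<in> nonloop_edges (contract_pair H u w)" using f False by (simp add: nonloop_contract_pair[OF H])
      moreover have "merge u w y \<noteq> merge u w x"
        using merge_inj_on_ends[OF f(1) False] f nonpar(1)[OF f(1) False] by (auto simp: inj_on_def)
      ultimately show ?thesis using f nonpar(2)[OF f(1) False] by (auto simp: arcs_def)
    qed
  qed
  \<comment> \<open>The second alternative covers the one walk that collapses under projection, a
    single arc from p to q.\<close>
  have "(merge u w x, merge u w y) \<in> ?r\<^sup>+ \<or> x = p \<and> y = q" if "(x, y) \<in> (arcs H ?A)\<^sup>+" for x y
    using that
  proof induction
    case (base y) then show ?case using arc[of x y] by blast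
  next
    case (step y z)
    then show ?case using arc[of y z] mpq by (metis r_into_trancl' trancl.trancl_into_trancl)
  qed
  then have "acyclic (arcs H ?A)"
    using orientation_acyclic[OF B] mpq(2) unfolding acyclic_def by metis
  moreover have "?A f \<in> ends H f" if "f \<in> nonloop_edges H" for f
    using par[OF that] nonpar(1)[OF that] pq by (cases "ends H f = {u, w}") auto
  ultimately show ?thesis by (auto simp: acyclic_orientations_iff extend_orientation_def)
qed

lemma extend_orientation_pair:
  assumes H: "multigraph H" "u \<noteq> w" and B: "B \<in> acyclic_orientations (contract_pair H u w)"
  shows "opposite_pair H u w (extend_orientation H u w B u) (extend_orientation H u w B w)"
  unfolding opposite_pair_def
proof (intro conjI ballI)
  show "extend_orientation H u w B u \<in> acyclic_orientations H"
    by (rule extend_orientation_acyclic[OF H B, of u w]) simp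
  show "extend_orientation H u w B w \<in> acyclic_orientations H"
    by (rule extend_orientation_acyclic[OF H B, of w u]) auto
qed (simp add: extend_orientation_def)

text \<open>A directed walk in the quotient by \<open>u \<sim> w\<close> lifts either to a walk or to two walks joined at
  the merged vertex.\<close>

lemma acyclic_merge:
  assumes r: "acyclic r" and uw: "(u, w) \<notin> r\<^sup>+" "(w, u) \<notin> r\<^sup>+"
  shows "acyclic (map_prod (merge u w) (merge u w) ` r)"
proof -
  let ?m = "merge u w"
  have loop: "(x, x) \<notin> r\<^sup>+" for x using r by (simp add: acyclic_def)
  have same: "x = y \<or> x = u \<and> y = w \<or> x = w \<and> y = u" if "?m x = ?m y" for x y
    using that by (auto simp: merge_def split: if_splits)
  \<comment> \<open>In the second alternative the walk enters the merged vertex at p and leaves it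
    at q.\<close>
  have walk: "(\<exists>x' y'. ?m x' = x \<and> ?m y' = y \<and> (x', y') \<in> r\<^sup>+) \<or>
      (\<exists>x' p q y'. ?m x' = x \<and> ?m y' = y \<and> p \<in> {u, w} \<and> q \<in> {u, w} \<and> (x', p) \<in> r\<^sup>+ \<and> (q, y') \<in> r\<^sup>+)"
    if "(x, y) \<in> (map_prod ?m ?m ` r)\<^sup>+" for x y
    using that
  proof induction
    case (base y) then show ?case by (auto simp: map_prod_def)
  next
    case (step y z)
    then obtain s t where st: "(s, t) \<in> r" "y = ?m s" "z = ?m t" by auto
    from step.IH show ?case
    proof (elim disjE exE conjE)
      fix x' y' assume a: "?m x' = x" "?m y' = y" "(x', y') \<in> r\<^sup>+"
      then consider "y' = s" | "y' \<in> {u, w}" "s \<in> {u, w}" using same[of y' s] st by auto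
      then show ?thesis
      proof cases
        case 1 then have "(x', t) \<in> r\<^sup>+" using a st by auto
        then show ?thesis using a st by blast
      next
        case 2 then show ?thesis using a st by blast
      qed
    next
      fix x' p q y'
      assume a: "?m x' = x" "?m y' = y" "p \<in> {u, w}" "q \<in> {u, w}" "(x', p) \<in> r\<^sup>+" "(q, y') \<in> r\<^sup>+"
      then consider "y' = s" | "y' \<in> {u, w}" using same[of y' s] st by auto
      then show ?thesis
      proof cases
        case 1 then have "(q, t) \<in> r\<^sup>+" using a st by auto
        then show ?thesis using a st by blast
      next
        \<comment> \<open>A second passage through the merged vertex would need a walk in r between
          two elements of {u, w}, equal or not, and these are all excluded.\<close>
        case 2 then show ?thesis using a uw loop by auto
      qed
    qed
  qed
  show ?thesis
    unfolding acyclic_def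
  proof (intro allI notI)
    fix x assume "(x, x) \<in> (map_prod ?m ?m ` r)\<^sup>+"
    from walk[OF this] show False
    proof (elim disjE exE conjE)
      fix x' y' assume a: "?m x' = x" "?m y' = x" "(x', y') \<in> r\<^sup>+"
      then show False using same[of x' y'] uw loop by auto
    next
      fix x' p q y'
      assume a: "?m x' = x" "?m y' = x" "p \<in> {u, w}" "q \<in> {u, w}" "(x', p) \<in> r\<^sup>+" "(q, y') \<in> r\<^sup>+"
      then consider "x' = y'" | "x' \<in> {u, w}" using same[of x' y'] by auto
      then show False
      proof cases
        \<comment> \<open>The two pieces close up at x' = y' and form a walk from q to p, again
          between elements of {u, w}.\<close>
        case 1 then have "(q, p) \<in> r\<^sup>+" using a by auto
        then show False using a uw loop by auto
      next
        case 2 then show False using a uw loop by auto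
      qed
    qed
  qed
qed

text \<open>Away from the edges between u and w both orientations have the same arcs r. By adjacency
  one of them has the arc from u to w and the other its reverse, so acyclicity excludes walks in r
  between u and w in either direction, as \<open>acyclic_merge\<close> requires.\<close>

lemma opposite_pair_contract:
  assumes H: "multigraph H" "u \<noteq> w" and adj: "edges_between H u w \<noteq> {}" and op: "opposite_pair H u w A A'"
  shows "\<exists>B\<in>acyclic_orientations (contract_pair H u w).
    extend_orientation H u w B u = A \<and> extend_orientation H u w B w = A'"
proof -
  let ?C = "contract_pair H u w"
  define B where "B = (\<lambda>f\<in>nonloop_edges ?C. merge u w (A f))"
  have A: "A \<in> acyclic_orientations H" and A': "A' \<in> acyclic_orientations H" using op by (auto simp: opposite_pair_def)
  have par: "A f = u" "A' f = w" if "f \<in> nonloop_edges H" "ends H f = {u, w}" for f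
    using op that by (auto simp: opposite_pair_def)
  have nonpar: "A f = A' f" if "f \<in> nonloop_edges H" "ends H f \<noteq> {u, w}" for f
    using op that by (auto simp: opposite_pair_def)
  have nC: "nonloop_edges ?C = {f \<in> nonloop_edges H. ends H f \<noteq> {u, w}}" by (rule nonloop_contract_pair[OF H])
  obtain f0 where f0: "f0 \<in> nonloop_edges H" "ends H f0 = {u, w}"
    using adj H(2) by (auto simp: edges_between_nonloop)
  define r where "r = (\<Union>f\<in>nonloop_edges ?C. {A f} \<times> (ends H f - {A f}))"
  have rA: "r \<subseteq> arcs H A" unfolding r_def arcs_def nC by blast
  have "r = (\<Union>f\<in>nonloop_edges ?C. {A' f} \<times> (ends H f - {A' f}))"
    unfolding r_def by (rule SUP_cong[OF refl]) (use nonpar nC in auto)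
  then have rA': "r \<subseteq> arcs H A'" unfolding arcs_def nC by blast
  have acyc: "acyclic r" using acyclic_subset[OF orientation_acyclic[OF A] rA] .
  have "(u, w) \<in> arcs H A" using par(1)[OF f0] f0 H(2) by (auto simp: arcs_def)
  then have 1: "(w, u) \<notin> r\<^sup>+"
    using orientation_acyclic[OF A] trancl_mono[OF _ rA] unfolding acyclic_def
    by (meson trancl.trancl_into_trancl)
  have "(w, u) \<in> arcs H A'" using par(2)[OF f0] f0 H(2) by (auto simp: arcs_def)
  then have 2: "(u, w) \<notin> r\<^sup>+"
    using orientation_acyclic[OF A'] trancl_mono[OF _ rA'] unfolding acyclic_def
    by (meson trancl.trancl_into_trancl)
  have "arcs ?C B \<subseteq> map_prod (merge u w) (merge u w) ` r"
  proof
    fix z assume "z \<in> arcs ?C B"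
    then obtain f y where f: "f \<in> nonloop_edges ?C" "z = (merge u w (A f), merge u w y)" "y \<in> ends H f"
      "merge u w y \<noteq> merge u w (A f)" by (auto simp: arcs_def B_def)
    then have "(A f, y) \<in> r" by (auto simp: r_def)
    then show "z \<in> map_prod (merge u w) (merge u w) ` r" using f(2) by force
  qed
  then have "acyclic (arcs ?C B)" using acyclic_merge[OF acyc 2 1] by (rule acyclic_subset[rotated])
  moreover have "B \<in> (\<Pi>\<^sub>E f\<in>nonloop_edges ?C. ends ?C f)"
    using orientation_source[OF A] by (auto simp: B_def nC)
  ultimately have B: "B \<in> acyclic_orientations ?C" by (simp add: acyclic_orientations_iff)
  have ext: "extend_orientation H u w B p f = A f" if "f \<in> nonloop_edges H" "ends H f \<noteq> {u, w}" for p f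
    using that orientation_source[OF A that(1)]
    by (intro extend_orientation_nonparallel) (auto simp: B_def nC)
  note pair = extend_orientation_pair[OF H B, unfolded opposite_pair_def]
  have "extend_orientation H u w B u f = A f" "extend_orientation H u w B w f = A' f"
    if "f \<in> nonloop_edges H" for f
    using pair ext[OF that] par[OF that] nonpar[OF that] that by (cases "ends H f = {u, w}"; simp)+
  then have "extend_orientation H u w B u = A" "extend_orientation H u w B w = A'"
    using pair A A' by (auto intro: orientation_eqI)
  then show ?thesis using B by blast
qed

section \<open>Deleting e and extending acyclic orientations over it\<close>

lemma arcs_delete: "arcs (delete_edge H e) (delete_orientation H e A) =
    (\<Union>f\<in>nonloop_edges H - {e}. {A f} \<times> (ends H f - {A f}))"
  by (simp add: arcs_def delete_orientation_def cong: SUP_cong_simp)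

lemma delete_orientation_acyclic:
  assumes "A \<in> acyclic_orientations H"
  shows "delete_orientation H e A \<in> acyclic_orientations (delete_edge H e)"
proof -
  have "acyclic (arcs (delete_edge H e) (delete_orientation H e A))"
    using orientation_acyclic[OF assms] unfolding arcs_delete by (rule acyclic_subset) (auto simp: arcs_def)
  then show ?thesis
    using orientation_source[OF assms] by (auto simp: acyclic_orientations_iff delete_orientation_def)
qed

lemma arcs_fun_upd:
  assumes e: "e \<in> nonloop_edges H" "ends H e = {x, y}" "x \<noteq> y"
  shows "arcs H (B(e := x)) = insert (x, y) (arcs (delete_edge H e) B)"
  using e unfolding arcs_def by (auto split: if_splits)

lemma fun_upd_acyclic_orientation:
  assumes B: "B \<in> acyclic_orientations (delete_edge H e)" and e: "e \<in> nonloop_edges H" "x \<in> ends H e"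
    and acyc: "acyclic (arcs H (B(e := x)))"
  shows "B(e := x) \<in> acyclic_orientations H" "delete_orientation H e (B(e := x)) = B"
proof -
  have "B(e := x) \<in> (\<Pi>\<^sub>E f\<in>nonloop_edges H. ends H f)"
    using B e by (auto simp: acyclic_orientations_iff PiE_def extensional_def)
  then show "B(e := x) \<in> acyclic_orientations H" using acyc by (simp add: acyclic_orientations_iff)
  show "delete_orientation H e (B(e := x)) = B"
    using B by (auto simp: delete_orientation_def acyclic_orientations_iff PiE_def extensional_def fun_eq_iff)
qed

text \<open>If both directions of e closed a cycle, its ends a and b would be reachable from each
  other in the orientation without e.\<close>

lemma acyclic_lift_exists:
  assumes B: "B \<in> acyclic_orientations (delete_edge H e)" and e: "e \<in> nonloop_edges H"
  shows "\<exists>A\<in>acyclic_orientations H. delete_orientation H e A = B"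
proof -
  obtain a b where ab: "ends H e = {a, b}" "a \<noteq> b"
    using e by (auto simp: nonloop_edges_def card_2_iff)
  let ?r = "arcs (delete_edge H e) B"
  have r: "acyclic ?r" by (rule orientation_acyclic[OF B])
  have "(b, a) \<notin> ?r\<^sup>* \<or> (a, b) \<notin> ?r\<^sup>*"
    using acyclic_impl_antisym_rtrancl[OF r] ab(2) by (auto simp: antisym_def)
  then have "acyclic (arcs H (B(e := a))) \<or> acyclic (arcs H (B(e := b)))"
    using r arcs_fun_upd[OF e ab, of B] arcs_fun_upd[OF e, of b a B] ab
    by (auto simp: insert_commute)
  then show ?thesis
    using fun_upd_acyclic_orientation[OF B e, of a] fun_upd_acyclic_orientation[OF B e, of b] ab by auto
qed

lemma delete_orientation_eqD:
  "delete_orientation H e A = delete_orientation H e A' \<Longrightarrow> f \<in> nonloop_edges H \<Longrightarrow> f \<noteq> e \<Longrightarrow> A f = A' f"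
  unfolding delete_orientation_def by (metis Diff_iff delete_edge_simps(4) restrict_apply' singletonD)

lemma parallel_orientation:
  assumes A: "A \<in> acyclic_orientations H" and f: "f \<in> nonloop_edges H" "g \<in> nonloop_edges H" "ends H f = ends H g"
  shows "A f = A g"
proof (rule ccontr)
  assume ne: "A f \<noteq> A g"
  have "(A f, A g) \<in> arcs H A" "(A g, A f) \<in> arcs H A"
    using ne f orientation_source[OF A f(1)] orientation_source[OF A f(2)] by (auto simp: arcs_def)
  then show False using orientation_acyclic[OF A] unfolding acyclic_def by (meson trancl.simps)
qed

text \<open>An edge parallel to e survives the deletion and forces the direction of e in both
  orientations, so they can differ only when e is the single edge between u and w.\<close>

lemma acyclic_lifts_eq_or_opposite:
  assumes e: "e \<in> edges H" "ends H e = {u, w}" "u \<noteq> w"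
    and A: "A \<in> acyclic_orientations H" "A' \<in> acyclic_orientations H"
    and del: "delete_orientation H e A = delete_orientation H e A'"
  shows "A = A' \<or> edges_between H u w = {e} \<and> (opposite_pair H u w A A' \<or> opposite_pair H u w A' A)"
proof (cases "A e = A' e")
  case True
  have "A f = A' f" if "f \<in> nonloop_edges H" for f
    using True delete_orientation_eqD[OF del that] by (cases "f = e") auto
  then have "A = A'" by (rule orientation_eqI[OF A])
  then show ?thesis ..
next
  case False
  have eN: "e \<in> nonloop_edges H" using e by (simp add: nonloop_edges_def)
  have "f = e" if "f \<in> edges_between H u w" for f
  proof (rule ccontr)
    assume "f \<noteq> e"
    moreover have f: "f \<in> nonloop_edges H" "ends H f = ends H e"
      using that e(2,3) by (simp_all add: edges_between_nonloop)
    ultimately have "A f = A' f" using delete_orientation_eqD[OF del] by blast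
    then show False using False parallel_orientation[OF A(1) f(1) eN f(2)] parallel_orientation[OF A(2) f(1) eN f(2)] by simp
  qed
  moreover have "e \<in> edges_between H u w" using e by (simp add: edges_between_def)
  ultimately have single: "edges_between H u w = {e}" by blast
  have ne: "ends H f \<noteq> {u, w}" if "f \<in> nonloop_edges H" "f \<noteq> e" for f
    using single that e(3) by (auto simp: edges_between_nonloop)
  have off: "A f = A' f" if "f \<in> nonloop_edges H" "f \<noteq> e" for f
    using delete_orientation_eqD[OF del that] .
  have "A e \<in> {u, w}" "A' e \<in> {u, w}"
    using orientation_source[OF A(1) eN] orientation_source[OF A(2) eN] e(2) by simp_all
  then consider "A e = u" "A' e = w" | "A e = w" "A' e = u" using False by auto
  then show ?thesis
  proof cases
    case 1
    then have "\<forall>f\<in>nonloop_edges H. if ends H f = {u, w} then A f = u \<and> A' f = w else A f = A' f"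
      using ne off e(2) by metis
    then show ?thesis using single A by (simp add: opposite_pair_def)
  next
    case 2
    then have "\<forall>f\<in>nonloop_edges H. if ends H f = {u, w} then A' f = u \<and> A f = w else A' f = A f"
      using ne off e(2) by metis
    then show ?thesis using single A by (simp add: opposite_pair_def)
  qed
qed

lemma opposite_pair_delete:
  assumes "opposite_pair H u w A A'"
  shows "opposite_pair (delete_edge H e) u w (delete_orientation H e A) (delete_orientation H e A')"
  using assms delete_orientation_acyclic[of A H e] delete_orientation_acyclic[of A' H e]
  unfolding opposite_pair_def by (simp add: delete_orientation_def)

lemma opposite_pair_delete_eq:
  assumes "opposite_pair H u w A A'" "edges_between H u w = {e}" "u \<noteq> w"
  shows "delete_orientation H e A = delete_orientation H e A'"
proof -
  have "A f = A' f" if "f \<in> nonloop_edges H - {e}" for f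
  proof -
    have "ends H f \<noteq> {u, w}" using assms(2,3) that by (auto simp: edges_between_nonloop)
    then show ?thesis using assms(1) that by (simp add: opposite_pair_def)
  qed
  then show ?thesis by (auto simp: delete_orientation_def fun_eq_iff)
qed

text \<open>Another edge g between u and w is left, and giving e the direction of g adds no new
  arc.\<close>

lemma opposite_pair_lift_parallel:
  assumes e: "e \<in> edges H" "ends H e = {u, w}" "u \<noteq> w"
    and adj: "edges_between (delete_edge H e) u w \<noteq> {}"
    and op: "opposite_pair (delete_edge H e) u w B B'"
  shows "\<exists>A A'. opposite_pair H u w A A' \<and> delete_orientation H e A = B \<and> delete_orientation H e A' = B'"
proof -
  have eN: "e \<in> nonloop_edges H" using e by (simp add: nonloop_edges_def)
  obtain g where g: "g \<in> nonloop_edges H" "g \<noteq> e" "ends H g = {u, w}"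
    using adj e(3) by (auto simp: edges_between_nonloop)
  have B: "B \<in> acyclic_orientations (delete_edge H e)" "B' \<in> acyclic_orientations (delete_edge H e)"
    and Bg: "B g = u" "B' g = w" using op g by (auto simp: opposite_pair_def)
  have "(u, w) \<in> arcs (delete_edge H e) B" using g Bg e(3) by (auto simp: arcs_def)
  then have "arcs H (B(e := u)) = arcs (delete_edge H e) B"
    using arcs_fun_upd[OF eN e(2,3)] by auto
  then have "acyclic (arcs H (B(e := u)))" using orientation_acyclic[OF B(1)] by simp
  note A = fun_upd_acyclic_orientation[OF B(1) eN _ this]
  have "(w, u) \<in> arcs (delete_edge H e) B'" using g Bg e(3) by (auto simp: arcs_def)
  then have "arcs H (B'(e := w)) = arcs (delete_edge H e) B'"
    using arcs_fun_upd[OF eN, of w u] e by (auto simp: insert_commute)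
  then have "acyclic (arcs H (B'(e := w)))" using orientation_acyclic[OF B(2)] by simp
  note A' = fun_upd_acyclic_orientation[OF B(2) eN _ this]
  have "opposite_pair H u w (B(e := u)) (B'(e := w))"
    using A(1) A'(1) op e by (auto simp: opposite_pair_def)
  then show ?thesis using A(2) A'(2) e by blast
qed

text \<open>Lifting B and B' separately could direct e in different ways. Instead e is restored in
  the contraction of u and w, where both come from one orientation Q, and the lift of Q is then
  extended in its two ways.\<close>

lemma opposite_pair_lift_nonparallel:
  assumes H: "multigraph H" and e: "e \<in> nonloop_edges H" "ends H e \<noteq> {u, w}" and uw: "u \<noteq> w"
    and adj: "edges_between (delete_edge H e) u w \<noteq> {}"
    and op: "opposite_pair (delete_edge H e) u w B B'"
  shows "\<exists>A A'. opposite_pair H u w A A' \<and> delete_orientation H e A = B \<and> delete_orientation H e A' = B'"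
proof -
  let ?D = "delete_edge H e"
  \<comment> \<open>As e does not join u and w, deletion and contraction commute.\<close>
  have eq: "contract_pair ?D u w = delete_edge (contract_pair H u w) e"
    using e by (auto simp: contract_pair_def delete_edge_def edges_between_def)
  obtain Q where Q: "Q \<in> acyclic_orientations (contract_pair ?D u w)"
      and BQ: "extend_orientation ?D u w Q u = B" "extend_orientation ?D u w Q w = B'"
    using opposite_pair_contract[OF multigraph_delete[OF H] uw adj op] by blast
  have "e \<in> nonloop_edges (contract_pair H u w)" using e by (simp add: nonloop_contract_pair[OF H uw])
  then obtain P where P: "P \<in> acyclic_orientations (contract_pair H u w)"
      and PQ: "delete_orientation (contract_pair H u w) e P = Q"
    using acyclic_lift_exists[of Q "contract_pair H u w" e] Q eq by auto
  have "delete_orientation H e (extend_orientation H u w P p) = extend_orientation ?D u w Q p" for p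
  proof
    fix f
    have "Q f = P f" if "f \<in> nonloop_edges H" "f \<noteq> e" "ends H f \<noteq> {u, w}"
      using that unfolding PQ[symmetric] by (simp add: delete_orientation_def nonloop_contract_pair[OF H uw])
    then show "delete_orientation H e (extend_orientation H u w P p) f = extend_orientation ?D u w Q p f"
      by (auto simp: delete_orientation_def extend_orientation_def)
  qed
  then show ?thesis using extend_orientation_pair[OF H uw P] BQ by metis
qed

lemma opposite_pair_lift:
  assumes H: "multigraph H" and e: "e \<in> nonloop_edges H" and uw: "u \<noteq> w"
    and adj: "edges_between (delete_edge H e) u w \<noteq> {}"
    and op: "opposite_pair (delete_edge H e) u w B B'"
  shows "\<exists>A A'. opposite_pair H u w A A' \<and> delete_orientation H e A = B \<and> delete_orientation H e A' = B'"
proof (cases "ends H e = {u, w}")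
  case True
  then show ?thesis using opposite_pair_lift_parallel[OF _ True uw adj op] e by (simp add: nonloop_edges_def)
qed (use opposite_pair_lift_nonparallel[OF H e _ uw adj op] in blast)

section \<open>Lifting cut reversals over e\<close>

lemma acyclic_fun_upd_cut:
  assumes e: "e \<in> nonloop_edges H" "ends H e = {x, y}" "x \<noteq> y"
    and B: "B \<in> acyclic_orientations (delete_edge H e)" and S: "x \<in> S" "y \<notin> S"
    and cut: "\<And>f. f \<in> nonloop_edges H \<Longrightarrow> f \<noteq> e \<Longrightarrow> \<not> ends H f \<subseteq> S \<Longrightarrow> ends H f \<inter> S \<noteq> {} \<Longrightarrow> B f \<in> S"
  shows "acyclic (arcs H (B(e := x)))"
\<comment> \<open>With e directed from x to y, every arc across the cut leaves S.\<close>
proof (rule acyclic_cut[OF orientation_acyclic[OF B], of _ S])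
  fix a b assume "(a, b) \<in> arcs H (B(e := x))"
  then consider "a = x" "b = y" | "(a, b) \<in> arcs (delete_edge H e) B"
    using arcs_fun_upd[OF e, of B] by blast
  then show "(a, b) \<in> arcs (delete_edge H e) B \<and> (a \<in> S \<longleftrightarrow> b \<in> S) \<or> a \<in> S \<and> b \<notin> S"
  proof cases
    case 1 then show ?thesis using S by simp
  next
    case 2
    then obtain f where f: "f \<in> nonloop_edges H" "f \<noteq> e" "a = B f" "b \<in> ends H f" "b \<noteq> a"
      by (auto simp: arcs_def)
    have "a \<in> ends H f" using orientation_source[OF B, of f] f by simp
    then obtain z where "ends H f = {a, z}" using nonloopE[OF f(1)] by metis
    then have ab: "ends H f = {a, b}" using f by auto
    then have "a \<in> S" if "b \<in> S" using cut[OF f(1,2)] f(3) that by auto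
    then show ?thesis using 2 by blast
  qed
qed

text \<open>If the cut does not separate the ends of \<open>e\<close>, both orientations direct \<open>e\<close> as an acyclic
  extension of the first one does; otherwise \<open>e\<close> joins the cut.\<close>

lemma cut_step_lift:
  assumes e: "e \<in> nonloop_edges H" and st: "cut_step (delete_edge H e) S B B'"
  shows "\<exists>A A'. cut_step H S A A' \<and> delete_orientation H e A = B \<and> delete_orientation H e A' = B'"
proof -
  let ?D = "delete_edge H e"
  have B: "B \<in> acyclic_orientations ?D" and B': "B' \<in> acyclic_orientations ?D"
    and step: "\<And>f. f \<in> nonloop_edges H \<Longrightarrow> f \<noteq> e \<Longrightarrow>
      (if ends H f \<subseteq> S \<or> ends H f \<inter> S = {} then B' f = B f else B f \<in> S \<and> B' f \<notin> S)"
    using st by (auto simp: cut_step_def)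
  have "\<exists>x x'. x \<in> ends H e \<and> x' \<in> ends H e \<and> acyclic (arcs H (B(e := x))) \<and> acyclic (arcs H (B'(e := x'))) \<and>
    (if ends H e \<subseteq> S \<or> ends H e \<inter> S = {} then x' = x else x \<in> S \<and> x' \<notin> S)"
  proof (cases "ends H e \<subseteq> S \<or> ends H e \<inter> S = {}")
    case True
    obtain A where A: "A \<in> acyclic_orientations H" "delete_orientation H e A = B"
      using acyclic_lift_exists[OF B e] by blast
    obtain y where y: "ends H e = {A e, y}" "A e \<noteq> y" using nonloopE[OF e orientation_source[OF A(1) e]] .
    have AB: "A f = B f" if "f \<in> nonloop_edges H" "f \<noteq> e" for f
      using A(2) that by (auto simp: delete_orientation_def)
    have "acyclic (arcs H (B'(e := A e)))"
    \<comment> \<open>Crossing arcs of B' leave the complement of S, while e and the other edges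
      that do not cross keep the direction that they have in A.\<close>
    proof (rule acyclic_cut[OF orientation_acyclic[OF A(1)], of _ "- S"])
      fix x z assume "(x, z) \<in> arcs H (B'(e := A e))"
      then obtain f where f: "f \<in> nonloop_edges H" "x = (B'(e := A e)) f" "z \<in> ends H f" "z \<noteq> x"
        by (auto simp: arcs_def)
      show "(x, z) \<in> arcs H A \<and> (x \<in> - S \<longleftrightarrow> z \<in> - S) \<or> x \<in> - S \<and> z \<notin> - S"
      proof (cases "f = e")
        case True2: True
        then have "x = A e" using f by simp
        then show ?thesis using True True2 f y(1) by (auto simp: arcs_def)
      next
        case False
        have xf: "x \<in> ends H f" using orientation_source[OF B', of f] f False by simp
        show ?thesis
        proof (cases "ends H f \<subseteq> S \<or> ends H f \<inter> S = {}")
          case True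
          then have "x = A f" using step[OF f(1) False] AB[OF f(1) False] f False by simp
          then show ?thesis using True f xf by (auto simp: arcs_def)
        next
          case ncut: False
          then have "x \<notin> S" using step[OF f(1) False] f False by simp
          moreover obtain z' where "ends H f = {x, z'}" using nonloopE[OF f(1) xf] by blast
          ultimately show ?thesis using ncut f by auto
        qed
      qed
    qed
    moreover have "B(e := A e) = A"
    proof
      fix f
      have "A \<in> extensional (nonloop_edges H)" "B \<in> extensional (nonloop_edges H - {e})"
        using A(1) B by (auto simp: acyclic_orientations_iff PiE_def)
      then show "(B(e := A e)) f = A f"
        using AB by (cases "f \<in> nonloop_edges H") (auto simp: extensional_def)
    qed
    ultimately show ?thesis
      using orientation_acyclic[OF A(1)] orientation_source[OF A(1) e] True by (intro exI[of _ "A e"]) simp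
  next
    case False
    then obtain x where x: "x \<in> ends H e" "x \<in> S" by blast
    obtain x' where x': "ends H e = {x, x'}" "x \<noteq> x'" using nonloopE[OF e x(1)] .
    have x'S: "x' \<notin> S" using False x x' by auto
    have x'swap: "ends H e = {x', x}" "x' \<noteq> x" using x' by auto
    have "acyclic (arcs H (B(e := x)))"
    proof (rule acyclic_fun_upd_cut[OF e x' B, of S])
      show "B f \<in> S" if "f \<in> nonloop_edges H" "f \<noteq> e" "\<not> ends H f \<subseteq> S" "ends H f \<inter> S \<noteq> {}" for f
        using step[OF that(1,2)] that(3,4) by simp
    qed (use x x'S in auto)
    moreover have "acyclic (arcs H (B'(e := x')))"
    \<comment> \<open>After the reversal the cut edges leave the complement, so S and
      \<open>- S\<close> change roles, and so do the two ends of e.\<close>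
    proof (rule acyclic_fun_upd_cut[OF e x'swap B', of "- S"])
      show "B' f \<in> - S" if "f \<in> nonloop_edges H" "f \<noteq> e" "\<not> ends H f \<subseteq> - S" "ends H f \<inter> - S \<noteq> {}" for f
      proof -
        have "\<not> (ends H f \<subseteq> S \<or> ends H f \<inter> S = {})" using that(3,4) by blast
        then show ?thesis using step[OF that(1,2)] by simp
      qed
    qed (use x x'S in auto)
    ultimately show ?thesis using False x x' x'S by (intro exI[of _ x] exI[of _ x']) simp
  qed
  then obtain x x' where xx': "x \<in> ends H e" "x' \<in> ends H e"
      "acyclic (arcs H (B(e := x)))" "acyclic (arcs H (B'(e := x')))"
      "if ends H e \<subseteq> S \<or> ends H e \<inter> S = {} then x' = x else x \<in> S \<and> x' \<notin> S" by blast
  note A = fun_upd_acyclic_orientation[OF B e xx'(1,3)]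
  note A' = fun_upd_acyclic_orientation[OF B' e xx'(2,4)]
  have "cut_step H S (B(e := x)) (B'(e := x'))"
    using A(1) A'(1) xx'(5) step by (auto simp: cut_step_def)
  then show ?thesis using A(2) A'(2) by blast
qed

text \<open>Turns h into a function on equivalence classes of G - e. Along a chain of cut reversals
  each step is lifted on its own; the lift that ends one step need not be the lift that begins the
  next, and \<open>del\<close> bridges the two.\<close>

lemma lift_invariant:
  assumes H: "multigraph H" and e: "e \<in> nonloop_edges H"
    and cls: "\<And>A A'. A \<in> acyclic_orientations H \<Longrightarrow> A' \<in> acyclic_orientations H \<Longrightarrow> lin_equiv H A A' \<Longrightarrow> h A = h A'"
    and del: "\<And>A A'. A \<in> acyclic_orientations H \<Longrightarrow> A' \<in> acyclic_orientations H \<Longrightarrow>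
      delete_orientation H e A = delete_orientation H e A' \<Longrightarrow> h A = h A'"
    and A: "A \<in> acyclic_orientations H" and A': "A' \<in> acyclic_orientations H"
    and eqv: "lin_equiv (delete_edge H e) (delete_orientation H e A) (delete_orientation H e A')"
  shows "h A = h A'"
proof -
  have "h A = h L" if L: "L \<in> acyclic_orientations H" "delete_orientation H e L = B'"
    and steps: "(\<lambda>B B'. \<exists>S. cut_step (delete_edge H e) S B B')\<^sup>*\<^sup>* (delete_orientation H e A) B'" for L B'
    using steps L
  proof (induction arbitrary: L)
    case base then show ?case using del[OF A] by simp
  next
    case (step B B')
    then obtain S where "cut_step (delete_edge H e) S B B'" by blast
    then obtain M M' where M: "cut_step H S M M'" "delete_orientation H e M = B" "delete_orientation H e M' = B'"
      using cut_step_lift[OF e] by blast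
    have MM: "M \<in> acyclic_orientations H" "M' \<in> acyclic_orientations H" using M(1) by (auto simp: cut_step_def)
    have "h A = h M" using step.IH[OF MM(1) M(2)] .
    also have "h M = h M'" using cls[OF MM cut_step_lin_equiv[OF H M(1)]] .
    also have "h M' = h L" using del[OF MM(2) step.prems(1)] M(3) step.prems(2) by simp
    finally show ?case .
  qed
  then show ?thesis
    using A' lin_equiv_cut_steps[OF multigraph_delete[OF H] delete_orientation_acyclic[OF A]
      delete_orientation_acyclic[OF A'] eqv] by blast
qed

section \<open>Graded groups\<close>

lemma abelian_group_homI':
  assumes "abelian_group M" "abelian_group N"
    and "\<And>x. x \<in> carrier M \<Longrightarrow> f x \<in> carrier N"
    and "\<And>x y. x \<in> carrier M \<Longrightarrow> y \<in> carrier M \<Longrightarrow> f (x \<oplus>\<^bsub>M\<^esub> y) = f x \<oplus>\<^bsub>N\<^esub> f y"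
  shows "abelian_group_hom M N f"
  using assms
  by (intro abelian_group_homI group_hom.intro group_hom_axioms.intro homI abelian_group.a_group) auto

lemma abelian_group_hom_comp:
  assumes "abelian_group_hom M N f" "abelian_group_hom N P g"
  shows "abelian_group_hom M P (\<lambda>x. g (f x))"
proof -
  interpret f: abelian_group_hom M N f by fact
  interpret g: abelian_group_hom N P g by fact
  show ?thesis by (intro abelian_group_homI' f.G.abelian_group_axioms g.H.abelian_group_axioms) auto
qed

lemma abelian_group_hom_finsum:
  assumes "abelian_group_hom M N f" "c \<in> A \<rightarrow> carrier M"
  shows "f (finsum M c A) = finsum N (\<lambda>i. f (c i)) A"
proof -
  interpret f: abelian_group_hom M N f by fact
  show ?thesis
    using assms(2)
  proof (induction A rule: infinite_finite_induct)
    case (insert x F)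
    then have "f (finsum M c (insert x F)) = f (c x) \<oplus>\<^bsub>N\<^esub> f (finsum M c F)"
      by (subst f.G.finsum_insert) auto
    also have "\<dots> = finsum N (\<lambda>i. f (c i)) (insert x F)"
      using insert by (subst f.H.finsum_insert) (auto simp: Pi_iff)
    finally show ?case .
  qed auto
qed

lemma (in abelian_group) finsum_support:
  assumes "finite K" "S \<subseteq> K" "c \<in> S \<rightarrow> carrier G" "\<And>k. k \<in> K - S \<Longrightarrow> c k = \<zero>"
  shows "finsum G c S = finsum G c K"
  using assms by (intro add.finprod_mono_neutral_cong_left) auto

lemma (in abelian_group) additive_subgroupI':
  assumes "H \<subseteq> carrier G" "\<zero> \<in> H" "\<And>x y. x \<in> H \<Longrightarrow> y \<in> H \<Longrightarrow> x \<oplus> y \<in> H" "\<And>x. x \<in> H \<Longrightarrow> \<ominus> x \<in> H"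
  shows "additive_subgroup H G"
  using assms by (intro additive_subgroup.intro subgroup.intro) (auto simp: a_inv_def)

lemma additive_subgroup_finsum:
  assumes "abelian_group M" "additive_subgroup H M" "\<And>i. i \<in> A \<Longrightarrow> c i \<in> H"
  shows "finsum M c A \<in> H"
proof -
  interpret abelian_group M by fact
  interpret H: additive_subgroup H M by fact
  show ?thesis
    using assms(3)
  proof (induction A rule: infinite_finite_induct)
    case (insert x F) then show ?case by (subst finsum_insert) (auto simp: H.a_Hcarr)
  qed auto
qed

lemma additive_subgroup_vimage:
  assumes "abelian_group_hom M N f" "additive_subgroup H N"
  shows "additive_subgroup {x \<in> carrier M. f x \<in> H} M"
proof -
  interpret f: abelian_group_hom M N f by fact
  interpret H: additive_subgroup H N by fact
  show ?thesis by (intro f.G.additive_subgroupI') auto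
qed

lemma additive_subgroup_equalizer:
  assumes "abelian_group_hom M N f" "abelian_group_hom M N g"
  shows "additive_subgroup {x \<in> carrier M. f x = g x} M"
proof -
  interpret f: abelian_group_hom M N f by fact
  interpret g: abelian_group_hom M N g by fact
  show ?thesis by (intro f.G.additive_subgroupI') auto
qed

lemma additive_subgroup_image:
  assumes "abelian_group_hom M N f" "additive_subgroup H M"
  shows "additive_subgroup (f ` H) N"
proof -
  interpret f: abelian_group_hom M N f by fact
  interpret H: additive_subgroup H M by fact
  show ?thesis
  proof (intro f.H.additive_subgroupI')
    show "\<zero>\<^bsub>N\<^esub> \<in> f ` H" using f.hom_zero H.zero_closed by (metis image_eqI)
    show "x \<oplus>\<^bsub>N\<^esub> y \<in> f ` H" if "x \<in> f ` H" "y \<in> f ` H" for x y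
      using that by (auto simp: H.a_Hcarr simp flip: f.hom_add)
    show "\<ominus>\<^bsub>N\<^esub> x \<in> f ` H" if "x \<in> f ` H" for x
      using that by (auto simp: H.a_Hcarr simp flip: f.hom_a_inv)
  qed (auto simp: H.a_Hcarr)
qed

section \<open>Graded groups and homogeneous components\<close>

definition graded_group :: "('a, 'b) gmodule \<Rightarrow> bool" where
  "graded_group M \<longleftrightarrow> abelian_group M \<and> (\<forall>k. additive_subgroup (grade M k) M) \<and>
     (\<forall>x\<in>carrier M. \<exists>!c. (\<forall>k. c k \<in> grade M k) \<and> finite {k. c k \<noteq> \<zero>\<^bsub>M\<^esub>} \<and>
        x = finsum M c {k. c k \<noteq> \<zero>\<^bsub>M\<^esub>})"

lemma graded_module_iff:
  "graded_module R M \<longleftrightarrow> module R M \<and> graded_group M \<and>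
     (\<forall>i j. \<forall>r\<in>grade R i. \<forall>x\<in>grade M j. r \<odot>\<^bsub>M\<^esub> x \<in> grade M (i + j))"
  by (auto simp: graded_module_def graded_group_def module_def)

definition hcomp :: "('a, 'b) gmodule \<Rightarrow> 'b \<Rightarrow> int \<Rightarrow> 'b" where
  "hcomp M x = (THE c. (\<forall>k. c k \<in> grade M k) \<and> finite {k. c k \<noteq> \<zero>\<^bsub>M\<^esub>} \<and>
     x = finsum M c {k. c k \<noteq> \<zero>\<^bsub>M\<^esub>})"

text \<open>A grading is recognised by its additive projections. The elements that are finite sums
  of their projections form a subgroup containing every degree, hence the whole group; applying a
  projection to any decomposition gives uniqueness.\<close>

lemma graded_groupI:
  assumes M: "abelian_group M" and gr: "\<And>k. additive_subgroup (grade M k) M"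
    and p: "\<And>k. abelian_group_hom M M (p k)" and p_grade: "\<And>k x. x \<in> carrier M \<Longrightarrow> p k x \<in> grade M k"
    and p_homog: "\<And>j k x. x \<in> grade M j \<Longrightarrow> p k x = (if k = j then x else \<zero>\<^bsub>M\<^esub>)"
    and span: "\<And>H. additive_subgroup H M \<Longrightarrow> (\<And>k. grade M k \<subseteq> H) \<Longrightarrow> carrier M \<subseteq> H"
  shows "graded_group M"
proof -
  interpret abelian_group M by fact
  have gr_carr: "x \<in> carrier M" if "x \<in> grade M k" for x k
    using additive_subgroup.a_Hcarr[OF gr that] .
  have p_add: "p k (x \<oplus>\<^bsub>M\<^esub> y) = p k x \<oplus>\<^bsub>M\<^esub> p k y" if "x \<in> carrier M" "y \<in> carrier M" for k x y
    using abelian_group_hom.hom_add[OF p that] .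
  have p_carr: "p k x \<in> carrier M" if "x \<in> carrier M" for k x using gr_carr[OF p_grade[OF that]] .
  have p_neg: "p k (\<ominus>\<^bsub>M\<^esub> x) = \<ominus>\<^bsub>M\<^esub> p k x" if "x \<in> carrier M" for k x
    using abelian_group_hom.hom_a_inv[OF p that] .
  have p_zero: "p k \<zero>\<^bsub>M\<^esub> = \<zero>\<^bsub>M\<^esub>" for k using abelian_group_hom.hom_zero[OF p] .
  \<comment> \<open>K may exceed the support, so that two elements can share one K when sums are
    treated.\<close>
  define Q where "Q x K \<longleftrightarrow> finite K \<and> (\<forall>k. k \<notin> K \<longrightarrow> p k x = \<zero>\<^bsub>M\<^esub>) \<and> x = finsum M (\<lambda>k. p k x) K" for x K
  have Q_mono: "Q x K'" if "Q x K" "K \<subseteq> K'" "finite K'" "x \<in> carrier M" for x K K'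
    using that finsum_support[of K' K "\<lambda>k. p k x"] p_carr unfolding Q_def by auto
  define H where "H = {x \<in> carrier M. \<exists>K. Q x K}"
  have "additive_subgroup H M"
  proof (rule additive_subgroupI')
    have "Q \<zero>\<^bsub>M\<^esub> {}" by (simp add: Q_def p_zero)
    then show "\<zero>\<^bsub>M\<^esub> \<in> H" by (auto simp: H_def)
  next
    fix x y assume "x \<in> H" "y \<in> H"
    then obtain K L where K: "Q x K" "Q y L" and xy: "x \<in> carrier M" "y \<in> carrier M" by (auto simp: H_def)
    have fin: "finite (K \<union> L)" using K by (simp add: Q_def)
    have "Q x (K \<union> L)" "Q y (K \<union> L)"
      using Q_mono[OF K(1) _ fin xy(1)] Q_mono[OF K(2) _ fin xy(2)] by simp_all
    then have KL: "finite (K \<union> L)" "x = finsum M (\<lambda>k. p k x) (K \<union> L)" "y = finsum M (\<lambda>k. p k y) (K \<union> L)"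
      "\<forall>k. k \<notin> K \<union> L \<longrightarrow> p k x = \<zero>\<^bsub>M\<^esub> \<and> p k y = \<zero>\<^bsub>M\<^esub>" unfolding Q_def by blast+
    have "x \<oplus>\<^bsub>M\<^esub> y = finsum M (\<lambda>k. p k x) (K \<union> L) \<oplus>\<^bsub>M\<^esub> finsum M (\<lambda>k. p k y) (K \<union> L)"
      using KL(2,3) by simp
    also have "\<dots> = finsum M (\<lambda>k. p k x \<oplus>\<^bsub>M\<^esub> p k y) (K \<union> L)"
      using xy p_carr by (intro finsum_addf[symmetric]) auto
    also have "\<dots> = finsum M (\<lambda>k. p k (x \<oplus>\<^bsub>M\<^esub> y)) (K \<union> L)" using xy by (simp add: p_add)
    finally have "x \<oplus>\<^bsub>M\<^esub> y = finsum M (\<lambda>k. p k (x \<oplus>\<^bsub>M\<^esub> y)) (K \<union> L)" .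
    moreover have "\<forall>k. k \<notin> K \<union> L \<longrightarrow> p k (x \<oplus>\<^bsub>M\<^esub> y) = \<zero>\<^bsub>M\<^esub>" using KL(4) xy by (simp add: p_add)
    ultimately have "Q (x \<oplus>\<^bsub>M\<^esub> y) (K \<union> L)" using KL(1) unfolding Q_def by blast
    then show "x \<oplus>\<^bsub>M\<^esub> y \<in> H" using xy by (auto simp: H_def)
  next
    fix x assume "x \<in> H"
    then obtain K where K: "Q x K" and x: "x \<in> carrier M" by (auto simp: H_def)
    have "abelian_group_hom M M (\<lambda>x. \<ominus>\<^bsub>M\<^esub> x)"
      by (intro abelian_group_homI' M) (auto simp: minus_add)
    then have neg: "\<ominus>\<^bsub>M\<^esub> finsum M (\<lambda>k. p k x) K = finsum M (\<lambda>k. \<ominus>\<^bsub>M\<^esub> p k x) K"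
      using abelian_group_hom_finsum[of M M "\<lambda>x. \<ominus>\<^bsub>M\<^esub> x" "\<lambda>k. p k x" K] p_carr[OF x] by auto
    have "x = finsum M (\<lambda>k. p k x) K" using K unfolding Q_def by blast
    from arg_cong[OF this, of "a_inv M"] have "\<ominus>\<^bsub>M\<^esub> x = finsum M (\<lambda>k. p k (\<ominus>\<^bsub>M\<^esub> x)) K"
      unfolding neg p_neg[OF x] .
    moreover have "\<forall>k. k \<notin> K \<longrightarrow> p k (\<ominus>\<^bsub>M\<^esub> x) = \<zero>\<^bsub>M\<^esub>" using K x p_neg by (simp add: Q_def)
    ultimately have "Q (\<ominus>\<^bsub>M\<^esub> x) K" using K unfolding Q_def by blast
    then show "\<ominus>\<^bsub>M\<^esub> x \<in> H" using x by (auto simp: H_def)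
  qed (auto simp: H_def)
  moreover have "grade M k \<subseteq> H" for k
  proof
    fix x assume x: "x \<in> grade M k"
    then have "Q x {k}" using gr_carr[OF x] p_homog[OF x] by (simp add: Q_def)
    then show "x \<in> H" using gr_carr[OF x] by (auto simp: H_def)
  qed
  ultimately have H: "carrier M \<subseteq> H" by (rule span)
  have "\<exists>!c. (\<forall>k. c k \<in> grade M k) \<and> finite {k. c k \<noteq> \<zero>\<^bsub>M\<^esub>} \<and> x = finsum M c {k. c k \<noteq> \<zero>\<^bsub>M\<^esub>}"
    if x: "x \<in> carrier M" for x
  proof (rule ex1I[of _ "\<lambda>k. p k x"])
    obtain K where K: "Q x K" using H x by (auto simp: H_def)
    have sub: "{k. p k x \<noteq> \<zero>\<^bsub>M\<^esub>} \<subseteq> K" using K by (auto simp: Q_def)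
    have "finsum M (\<lambda>k. p k x) {k. p k x \<noteq> \<zero>\<^bsub>M\<^esub>} = finsum M (\<lambda>k. p k x) K"
      using K sub p_carr[OF x] by (intro finsum_support) (auto simp: Q_def)
    then show "(\<forall>k. p k x \<in> grade M k) \<and> finite {k. p k x \<noteq> \<zero>\<^bsub>M\<^esub>} \<and> x = finsum M (\<lambda>k. p k x) {k. p k x \<noteq> \<zero>\<^bsub>M\<^esub>}"
      using K p_grade[OF x] finite_subset[OF sub] by (simp add: Q_def)
  next
    fix c assume c: "(\<forall>k. c k \<in> grade M k) \<and> finite {k. c k \<noteq> \<zero>\<^bsub>M\<^esub>} \<and> x = finsum M c {k. c k \<noteq> \<zero>\<^bsub>M\<^esub>}"
    have cc: "c k \<in> carrier M" for k using c gr_carr by blast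
    show "c = (\<lambda>k. p k x)"
    proof
      fix j
      have "p j x = finsum M (\<lambda>k. p j (c k)) {k. c k \<noteq> \<zero>\<^bsub>M\<^esub>}"
        using c abelian_group_hom_finsum[OF p, of c "{k. c k \<noteq> \<zero>\<^bsub>M\<^esub>}" j] cc by auto
      also have "\<dots> = finsum M (\<lambda>k. if j = k then c k else \<zero>\<^bsub>M\<^esub>) {k. c k \<noteq> \<zero>\<^bsub>M\<^esub>}"
        using c p_homog cc by (intro finsum_cong') auto
      also have "\<dots> = c j"
        using c cc by (cases "c j = \<zero>\<^bsub>M\<^esub>") (auto simp: finsum_singleton intro!: add.finprod_one_eqI)
      finally show "c j = p j x" ..
    qed
  qed
  then show ?thesis using M gr by (simp add: graded_group_def)
qed

locale graded_grp = abelian_group M for M :: "('a, 'b) gmodule" (structure) +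
  assumes gr: "graded_group M"
begin

lemma grade_subgroup: "additive_subgroup (grade M k) M"
  using gr by (simp add: graded_group_def)

lemma grade_carrier: "x \<in> grade M k \<Longrightarrow> x \<in> carrier M"
  using additive_subgroup.a_Hcarr[OF grade_subgroup] .

lemma grade_zero [simp]: "\<zero> \<in> grade M k"
  using additive_subgroup.zero_closed[OF grade_subgroup] .

lemma hcomp_props:
  assumes "x \<in> carrier M"
  shows "hcomp M x k \<in> grade M k" "finite {k. hcomp M x k \<noteq> \<zero>}"
    "x = finsum M (hcomp M x) {k. hcomp M x k \<noteq> \<zero>}"
proof -
  have "\<exists>!c. (\<forall>k. c k \<in> grade M k) \<and> finite {k. c k \<noteq> \<zero>} \<and> x = finsum M c {k. c k \<noteq> \<zero>}"
    using gr assms by (simp add: graded_group_def)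
  from theI'[OF this] show "hcomp M x k \<in> grade M k" "finite {k. hcomp M x k \<noteq> \<zero>}"
    "x = finsum M (hcomp M x) {k. hcomp M x k \<noteq> \<zero>}"
    unfolding hcomp_def by blast+
qed

lemma hcomp_carrier [simp]: "x \<in> carrier M \<Longrightarrow> hcomp M x k \<in> carrier M"
  using grade_carrier hcomp_props(1) .

lemma hcomp_sum:
  assumes "x \<in> carrier M" "finite K" "{k. hcomp M x k \<noteq> \<zero>} \<subseteq> K"
  shows "finsum M (hcomp M x) K = x"
proof -
  have "finsum M (hcomp M x) {k. hcomp M x k \<noteq> \<zero>} = finsum M (hcomp M x) K"
    using assms by (intro finsum_support) auto
  then show ?thesis using hcomp_props(3)[OF assms(1)] by simp
qed

lemma hcomp_unique:
  assumes c: "\<And>k. c k \<in> grade M k" and K: "finite K" "\<And>k. k \<notin> K \<Longrightarrow> c k = \<zero>"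
  shows "hcomp M (finsum M c K) = c"
proof -
  have cc: "c k \<in> carrier M" for k using grade_carrier[OF c] .
  let ?x = "finsum M c K"
  have x: "?x \<in> carrier M" using cc by auto
  have ex: "\<exists>!c. (\<forall>k. c k \<in> grade M k) \<and> finite {k. c k \<noteq> \<zero>} \<and> ?x = finsum M c {k. c k \<noteq> \<zero>}"
    using gr x by (simp add: graded_group_def)
  have sub: "{k. c k \<noteq> \<zero>} \<subseteq> K" using K by auto
  have "finsum M c {k. c k \<noteq> \<zero>} = ?x" using K sub cc by (intro finsum_support) auto
  then have "(\<forall>k. c k \<in> grade M k) \<and> finite {k. c k \<noteq> \<zero>} \<and> ?x = finsum M c {k. c k \<noteq> \<zero>}"
    using c finite_subset[OF sub] K by simp
  then show ?thesis unfolding hcomp_def by (rule the1_equality[OF ex])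
qed

lemma hcomp_homogeneous: "x \<in> grade M j \<Longrightarrow> hcomp M x k = (if k = j then x else \<zero>)"
  using hcomp_unique[of "\<lambda>k. if k = j then x else \<zero>" "{j}"] grade_carrier[of x j] by auto

lemma hcomp_add:
  assumes x: "x \<in> carrier M" and y: "y \<in> carrier M"
  shows "hcomp M (x \<oplus> y) k = hcomp M x k \<oplus> hcomp M y k"
proof -
  let ?K = "{k. hcomp M x k \<noteq> \<zero>} \<union> {k. hcomp M y k \<noteq> \<zero>}"
  have K: "finite ?K" using hcomp_props(2) x y by auto
  have "x \<oplus> y = finsum M (hcomp M x) ?K \<oplus> finsum M (hcomp M y) ?K"
    using hcomp_sum[OF x K] hcomp_sum[OF y K] by auto
  also have "\<dots> = finsum M (\<lambda>k. hcomp M x k \<oplus> hcomp M y k) ?K"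
    using x y by (intro finsum_addf[symmetric]) auto
  finally have "x \<oplus> y = finsum M (\<lambda>k. hcomp M x k \<oplus> hcomp M y k) ?K" .
  moreover have "hcomp M (finsum M (\<lambda>k. hcomp M x k \<oplus> hcomp M y k) ?K) = (\<lambda>k. hcomp M x k \<oplus> hcomp M y k)"
    using K hcomp_props(1)[OF x] hcomp_props(1)[OF y] additive_subgroup.a_closed[OF grade_subgroup]
    by (intro hcomp_unique) auto
  ultimately show ?thesis by simp
qed

lemma hcomp_hom: "abelian_group_hom M M (\<lambda>x. hcomp M x k)"
  by (intro abelian_group_homI' abelian_group_axioms) (auto simp: hcomp_add)

lemma grade_span:
  assumes H: "additive_subgroup H M" and "\<And>k. grade M k \<subseteq> H"
  shows "carrier M \<subseteq> H"
proof
  fix x assume x: "x \<in> carrier M"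
  have "finsum M (hcomp M x) {k. hcomp M x k \<noteq> \<zero>} \<in> H"
    using assms(2) hcomp_props(1)[OF x] by (intro additive_subgroup_finsum[OF abelian_group_axioms H]) blast
  then show "x \<in> H" using hcomp_props(3)[OF x] by simp
qed

end

lemma graded_grpI: "graded_group M \<Longrightarrow> graded_grp M"
  by (simp add: graded_grp_def graded_grp_axioms_def graded_group_def)

lemma graded_module_D:
  assumes "graded_module R M"
  shows "module R M" "graded_grp M" "graded_group M"
    "\<And>i j r x. r \<in> grade R i \<Longrightarrow> x \<in> grade M j \<Longrightarrow> r \<odot>\<^bsub>M\<^esub> x \<in> grade M (i + j)"
  using assms graded_grpI by (auto simp: graded_module_iff)

section \<open>Quotients\<close>

lemma quot_gmod_simps [simp]:
  "\<zero>\<^bsub>quot_gmod M N\<^esub> = N"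
  "grade (quot_gmod M N) k = (\<lambda>x. N +>\<^bsub>M\<^esub> x) ` grade M k"
  by (simp_all add: quot_gmod_def)

locale quotient_group = abelian_group M for M :: "('a, 'b) gmodule" (structure) +
  fixes N assumes N: "additive_subgroup N M"
begin

sublocale N: abelian_subgroup N M
  using N by (rule abelian_subgroupI3) (rule abelian_group_axioms)

lemma quot_carrier: "carrier (quot_gmod M N) = (\<lambda>x. N +> x) ` carrier M"
  by (auto simp: quot_gmod_def A_RCOSETS_def')

lemma quot_add: "x \<in> carrier M \<Longrightarrow> y \<in> carrier M \<Longrightarrow>
    (N +> x) \<oplus>\<^bsub>quot_gmod M N\<^esub> (N +> y) = N +> (x \<oplus> y)"
  by (simp add: quot_gmod_def N.a_rcos_sum)

lemma quot_eq_iff: "x \<in> carrier M \<Longrightarrow> y \<in> carrier M \<Longrightarrow> N +> x = N +> y \<longleftrightarrow> x \<ominus> y \<in> N"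
  by (metis N.a_rcos_module N.a_rcos_self N.a_repr_independence' a_minus_def)

lemma quot_zero: "N +> \<zero> = N"
  using N.a_subset by simp

lemma quot_eq_zero_iff: "x \<in> carrier M \<Longrightarrow> N +> x = N \<longleftrightarrow> x \<in> N"
  using N.a_rcos_const N.a_rcos_self by blast

lemma quot_group: "abelian_group (quot_gmod M N)"
proof -
  have "\<exists>y\<in>carrier (quot_gmod M N). y \<oplus>\<^bsub>quot_gmod M N\<^esub> X = N" if X: "X \<in> carrier (quot_gmod M N)" for X
  proof -
    obtain x where x: "x \<in> carrier M" "X = N +> x" using X by (auto simp: quot_carrier)
    then have "(N +> \<ominus> x) \<oplus>\<^bsub>quot_gmod M N\<^esub> X = N" by (simp add: quot_add l_neg quot_zero)
    then show ?thesis using x by (auto simp: quot_carrier)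
  qed
  moreover have "N \<oplus>\<^bsub>quot_gmod M N\<^esub> (N +> x) = N +> x" if "x \<in> carrier M" for x
    using quot_add[of \<zero> x] that by (simp add: quot_zero)
  moreover have "N \<in> carrier (quot_gmod M N)" using quot_zero by (auto simp: quot_carrier)
  ultimately show ?thesis
    by (intro abelian_groupI) (auto simp: quot_carrier quot_add a_ac)
qed

lemma quot_hom: "abelian_group_hom M (quot_gmod M N) (\<lambda>x. N +> x)"
  by (intro abelian_group_homI' abelian_group_axioms quot_group) (auto simp: quot_carrier quot_add)

text \<open>In \<open>quot_gmod\<close> a scalar multiple is the union of cosets over all
  representatives; stability of N makes these cosets coincide.\<close>

lemma quot_smult:
  assumes f: "\<And>x. x \<in> carrier M \<Longrightarrow> r \<odot> x \<in> carrier M"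
    "\<And>x y. x \<in> carrier M \<Longrightarrow> y \<in> carrier M \<Longrightarrow> r \<odot> (x \<oplus> y) = r \<odot> x \<oplus> r \<odot> y"
    and fN: "\<And>x. x \<in> N \<Longrightarrow> r \<odot> x \<in> N" and x: "x \<in> carrier M"
  shows "r \<odot>\<^bsub>quot_gmod M N\<^esub> (N +> x) = N +> (r \<odot> x)"
proof -
  have "N +> (r \<odot> y) = N +> (r \<odot> x)" if "y \<in> N +> x" for y
  proof -
    have y: "y \<in> carrier M" using N.a_elemrcos_carrier[OF x that] .
    have "y \<ominus> x \<in> N" using N.a_rcos_module_imp[OF x that] by (simp add: a_minus_def)
    then have "r \<odot> (y \<ominus> x) \<in> N" by (rule fN)
    moreover have "r \<odot> y = r \<odot> ((y \<ominus> x) \<oplus> x)" using x y by (simp add: a_minus_def a_assoc l_neg)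
    then have "r \<odot> y = r \<odot> (y \<ominus> x) \<oplus> r \<odot> x" using x y f(2)[of "y \<ominus> x" x] by simp
    then have "r \<odot> y \<ominus> r \<odot> x = r \<odot> (y \<ominus> x)"
      using f(1)[of "y \<ominus> x"] f(1)[OF x] x y by (simp add: a_minus_def a_assoc r_neg)
    ultimately show ?thesis using quot_eq_iff f(1) x y by simp
  qed
  then have "(\<Union>y\<in>N +> x. N +> (r \<odot> y)) = (\<Union>y\<in>N +> x. N +> (r \<odot> x))" by (rule SUP_cong[OF refl])
  also have "\<dots> = N +> (r \<odot> x)" using N.a_rcos_self[OF x] by blast
  finally show ?thesis by (simp add: quot_gmod_def)
qed

text \<open>The last three axioms are required only modulo N. The tensor product needs this: on the
  free abelian group of pairs, scalars act on the second entry, and (r + s) times a pair is not the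
  sum of its two multiples.\<close>

lemma quot_module:
  assumes R: "cring R"
    and closed: "\<And>r x. r \<in> carrier R \<Longrightarrow> x \<in> carrier M \<Longrightarrow> r \<odot> x \<in> carrier M"
    and additive: "\<And>r x y. r \<in> carrier R \<Longrightarrow> x \<in> carrier M \<Longrightarrow> y \<in> carrier M \<Longrightarrow> r \<odot> (x \<oplus> y) = r \<odot> x \<oplus> r \<odot> y"
    and stable: "\<And>r x. r \<in> carrier R \<Longrightarrow> x \<in> N \<Longrightarrow> r \<odot> x \<in> N"
    and "\<And>r s x. r \<in> carrier R \<Longrightarrow> s \<in> carrier R \<Longrightarrow> x \<in> carrier M \<Longrightarrow>
      N +> ((r \<oplus>\<^bsub>R\<^esub> s) \<odot> x) = N +> (r \<odot> x \<oplus> s \<odot> x)"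
    and "\<And>r s x. r \<in> carrier R \<Longrightarrow> s \<in> carrier R \<Longrightarrow> x \<in> carrier M \<Longrightarrow>
      N +> ((r \<otimes>\<^bsub>R\<^esub> s) \<odot> x) = N +> (r \<odot> (s \<odot> x))"
    and "\<And>x. x \<in> carrier M \<Longrightarrow> N +> (\<one>\<^bsub>R\<^esub> \<odot> x) = N +> x"
  shows "module R (quot_gmod M N)"
proof -
  interpret R: cring R by fact
  have sm: "r \<odot>\<^bsub>quot_gmod M N\<^esub> (N +> x) = N +> (r \<odot> x)" if "r \<in> carrier R" "x \<in> carrier M" for r x
    using quot_smult[of r x] that closed additive stable by blast
  show ?thesis
    using assms
    by (intro moduleI R quot_group) (auto simp: quot_carrier sm quot_add)
qed

text \<open>\<open>the_elem\<close> is justified because f is constant on each coset of N, so the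
  image of a coset is a singleton.\<close>

lemma induced_map:
  assumes f: "abelian_group_hom M P f" and fN: "\<And>x. x \<in> N \<Longrightarrow> f x = \<zero>\<^bsub>P\<^esub>"
  shows "abelian_group_hom (quot_gmod M N) P (induced_map f)"
    and "\<And>x. x \<in> carrier M \<Longrightarrow> induced_map f (N +> x) = f x"
proof -
  interpret f: abelian_group_hom M P f by fact
  show *: "induced_map f (N +> x) = f x" if x: "x \<in> carrier M" for x
  proof -
    have "f y = f x" if "y \<in> N +> x" for y
    proof -
      have y: "y \<in> carrier M" using N.a_elemrcos_carrier[OF x that] .
      have "y \<ominus> x \<in> N" using N.a_rcos_module_imp[OF x that] by (simp add: a_minus_def)
      then have "f (y \<ominus> x) = \<zero>\<^bsub>P\<^esub>" by (rule fN)
      moreover have "f y = f ((y \<ominus> x) \<oplus> x)" using x y by (simp add: a_minus_def a_assoc l_neg)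
      then have "f y = f (y \<ominus> x) \<oplus>\<^bsub>P\<^esub> f x" using x y f.hom_add[of "y \<ominus> x" x] by simp
      ultimately show ?thesis using x by simp
    qed
    moreover have "x \<in> N +> x" using N.a_rcos_self[OF x] .
    ultimately have "f ` (N +> x) = {f x}" by blast
    then show ?thesis by (simp add: induced_map_def)
  qed
  show "abelian_group_hom (quot_gmod M N) P (induced_map f)"
    by (intro abelian_group_homI' quot_group f.H.abelian_group_axioms) (auto simp: quot_carrier quot_add *)
qed

end

section \<open>Polynomial rings\<close>

text \<open>The base case is asked only for the actual terms of p, so support and degree conditions
  on p remain available there.\<close>

lemma poly_mapping_induct [case_names zero single add]:
  fixes p :: "'a \<Rightarrow>\<^sub>0 'b::comm_monoid_add"
  assumes "P 0" "\<And>u c. u \<in> Poly_Mapping.keys p \<Longrightarrow> c = Poly_Mapping.lookup p u \<Longrightarrow> P (Poly_Mapping.single u c)"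
    and "\<And>q r. P q \<Longrightarrow> P r \<Longrightarrow> P (q + r)"
  shows "P p"
proof -
  have "P (\<Sum>u\<in>S. Poly_Mapping.single u (Poly_Mapping.lookup p u))" if "S \<subseteq> Poly_Mapping.keys p" for S
    using that by (induction S rule: infinite_finite_induct) (auto intro: assms)
  moreover have "(\<Sum>u\<in>Poly_Mapping.keys p. Poly_Mapping.single u (Poly_Mapping.lookup p u)) = p"
    by (rule poly_mapping_eqI) (auto simp: lookup_sum lookup_single when_def in_keys_iff)
  ultimately show ?thesis by (metis order_refl)
qed

text \<open>The exponent vector that occurs inside \<open>subst_vars\<close>. Its additivity in u
  becomes multiplicativity of the substitution.\<close>

definition subst_monomial :: "('v \<Rightarrow> 'w) \<Rightarrow> ('v \<Rightarrow>\<^sub>0 nat) \<Rightarrow> 'w \<Rightarrow>\<^sub>0 nat" where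
  "subst_monomial \<rho> u = (\<Sum>v\<in>Poly_Mapping.keys u. Poly_Mapping.single (\<rho> v) (Poly_Mapping.lookup u v))"

lemma subst_monomial_superset:
  assumes "finite S" "Poly_Mapping.keys u \<subseteq> S"
  shows "subst_monomial \<rho> u = (\<Sum>v\<in>S. Poly_Mapping.single (\<rho> v) (Poly_Mapping.lookup u v))"
  unfolding subst_monomial_def using assms by (intro sum.mono_neutral_left) (auto simp: in_keys_iff)

lemma subst_monomial_add: "subst_monomial \<rho> (u + w) = subst_monomial \<rho> u + subst_monomial \<rho> w"
proof -
  let ?S = "Poly_Mapping.keys u \<union> Poly_Mapping.keys w"
  have "Poly_Mapping.keys (u + w) \<subseteq> ?S" by (rule keys_add)
  then show ?thesis
    by (simp add: subst_monomial_superset[of ?S] lookup_add single_add sum.distrib)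
qed

lemma subst_monomial_single: "subst_monomial \<rho> (Poly_Mapping.single v n) = Poly_Mapping.single (\<rho> v) n"
  by (simp add: subst_monomial_superset[of "{v}"])

lemma keys_subst_monomial: "Poly_Mapping.keys (subst_monomial \<rho> u) \<subseteq> \<rho> ` Poly_Mapping.keys u"
proof -
  have "Poly_Mapping.keys (\<Sum>v\<in>S. Poly_Mapping.single (\<rho> v) (Poly_Mapping.lookup u v)) \<subseteq> \<rho> ` S" for S
    by (induction S rule: infinite_finite_induct) (auto dest!: subsetD[OF keys_add] split: if_splits)
  then show ?thesis by (simp add: subst_monomial_def)
qed

lemma monomial_degree_superset:
  assumes "finite S" "Poly_Mapping.keys u \<subseteq> S"
  shows "monomial_degree u = (\<Sum>v\<in>S. Poly_Mapping.lookup u v)"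
  unfolding monomial_degree_def using assms by (intro sum.mono_neutral_left) (auto simp: in_keys_iff)

lemma monomial_degree_add: "monomial_degree (u + w) = monomial_degree u + monomial_degree w"
proof -
  let ?S = "Poly_Mapping.keys u \<union> Poly_Mapping.keys w"
  have "Poly_Mapping.keys (u + w) \<subseteq> ?S" by (rule keys_add)
  then show ?thesis
    by (simp add: monomial_degree_superset[of ?S] lookup_add sum.distrib)
qed

lemma monomial_degree_single: "monomial_degree (Poly_Mapping.single v n) = n"
  by (simp add: monomial_degree_superset[of "{v}"])

lemma monomial_degree_subst: "monomial_degree (subst_monomial \<rho> u) = monomial_degree u"
proof (induction u rule: poly_mapping_induct)
  case zero then show ?case by (simp add: subst_monomial_def monomial_degree_def)
qed (simp_all add: subst_monomial_single monomial_degree_single subst_monomial_add monomial_degree_add)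

lemma subst_vars_superset:
  assumes "finite S" "Poly_Mapping.keys p \<subseteq> S"
  shows "subst_vars \<rho> p = (\<Sum>u\<in>S. Poly_Mapping.single (subst_monomial \<rho> u) (Poly_Mapping.lookup p u))"
  unfolding subst_vars_def subst_monomial_def[symmetric]
  using assms by (intro sum.mono_neutral_left) (auto simp: in_keys_iff)

lemma subst_vars_add: "subst_vars \<rho> (p + q) = subst_vars \<rho> p + subst_vars \<rho> q"
proof -
  let ?S = "Poly_Mapping.keys p \<union> Poly_Mapping.keys q"
  have "Poly_Mapping.keys (p + q) \<subseteq> ?S" by (rule keys_add)
  then show ?thesis
    by (simp add: subst_vars_superset[of ?S] lookup_add single_add sum.distrib)
qed

lemma subst_vars_single: "subst_vars \<rho> (Poly_Mapping.single u c) = Poly_Mapping.single (subst_monomial \<rho> u) c"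
  by (simp add: subst_vars_superset[of "{u}"])

lemma subst_vars_0 [simp]: "subst_vars \<rho> 0 = 0"
  by (simp add: subst_vars_def)

lemma subst_vars_mult: "subst_vars \<rho> (p * q) = subst_vars \<rho> p * subst_vars \<rho> q"
proof (induction p rule: poly_mapping_induct)
  case (single u c)
  show ?case
  proof (induction q rule: poly_mapping_induct)
    case (single w d)
    show ?case by (simp add: mult_single subst_vars_single subst_monomial_add)
  qed (simp_all add: subst_vars_add distrib_left)
qed (simp_all add: subst_vars_add distrib_right)

lemma subst_vars_1 [simp]: "subst_vars \<rho> 1 = 1"
proof -
  have "subst_vars \<rho> (Poly_Mapping.single 0 1) = Poly_Mapping.single 0 1"
    unfolding subst_vars_single by (simp add: subst_monomial_def)
  then show ?thesis by simp
qed

lemma subst_vars_power: "subst_vars \<rho> (p ^ n) = subst_vars \<rho> p ^ n"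
  by (induction n) (simp_all add: subst_vars_mult)

lemma subst_vars_var: "subst_vars \<rho> (var v) = var (\<rho> v)"
  by (simp add: var_def monom_def subst_vars_single subst_monomial_single)

lemma mpolys_0 [simp]: "0 \<in> mpolys V"
  by (simp add: mpolys_def)

lemma mpolys_1 [simp]: "(1 :: ('v, 'k::field) mpoly) \<in> mpolys V"
  by (simp add: mpolys_def)

lemma mpolys_add [simp]: "p \<in> mpolys V \<Longrightarrow> q \<in> mpolys V \<Longrightarrow> p + q \<in> mpolys V"
  for p q :: "('v, 'k::field) mpoly"
  using keys_add[of p q] by (auto simp: mpolys_def)

lemma mpolys_uminus [simp]: "p \<in> mpolys V \<Longrightarrow> - p \<in> mpolys V"
  for p :: "('v, 'k::field) mpoly"
  by (simp add: mpolys_def in_keys_iff)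

lemma mpolys_mult [simp]: "p \<in> mpolys V \<Longrightarrow> q \<in> mpolys V \<Longrightarrow> p * q \<in> mpolys V"
  for p q :: "('v, 'k::field) mpoly"
proof -
  assume a: "p \<in> mpolys V" "q \<in> mpolys V"
  show ?thesis
    unfolding mpolys_def
  proof (intro CollectI ballI)
    fix u assume "u \<in> Poly_Mapping.keys (p * q)"
    then obtain b c where "u = b + c" "b \<in> Poly_Mapping.keys p" "c \<in> Poly_Mapping.keys q"
      using keys_mult[of p q] by auto
    then show "Poly_Mapping.keys u \<subseteq> V" using a keys_add[of b c] unfolding mpolys_def by blast
  qed
qed

lemma mpolys_power [simp]: "p \<in> mpolys V \<Longrightarrow> p ^ n \<in> mpolys V"
  for p :: "('v, 'k::field) mpoly"
  by (induction n) auto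

lemma mpolys_var [simp]: "v \<in> V \<Longrightarrow> var v \<in> mpolys V"
  by (simp add: mpolys_def var_def monom_def)

lemma mpolys_single: "Poly_Mapping.keys u \<subseteq> V \<Longrightarrow> Poly_Mapping.single u c \<in> mpolys V"
  by (simp add: mpolys_def)

lemma subst_vars_mpolys:
  fixes p :: "('v, 'k::field) mpoly"
  assumes p: "p \<in> mpolys V"
  shows "subst_vars \<rho> p \<in> mpolys (\<rho> ` V)"
proof (rule poly_mapping_induct[where p = p])
  fix u c assume "u \<in> Poly_Mapping.keys p"
  then have "Poly_Mapping.keys u \<subseteq> V" using p by (auto simp: mpolys_def)
  then show "subst_vars \<rho> (Poly_Mapping.single u c) \<in> mpolys (\<rho> ` V)"
    unfolding subst_vars_single using keys_subst_monomial[of \<rho> u] by (intro mpolys_single) blast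
qed (simp_all add: subst_vars_add)

lemma polyring_simps [simp]:
  "carrier (polyring V) = mpolys V" "p \<oplus>\<^bsub>polyring V\<^esub> q = p + q" "\<zero>\<^bsub>polyring V\<^esub> = 0"
  "p \<otimes>\<^bsub>polyring V\<^esub> q = p * q" "\<one>\<^bsub>polyring V\<^esub> = 1" "p \<odot>\<^bsub>polyring V\<^esub> q = p * q"
  by (simp_all add: polyring_def)

lemma polyring_grade:
  "p \<in> grade (polyring V) k \<longleftrightarrow> p \<in> mpolys V \<and> (\<forall>u\<in>Poly_Mapping.keys p. int (monomial_degree u) = k)"
  by (simp add: polyring_def)

lemma cring_polyring: "cring (polyring V :: (('v, 'k::field) mpoly, ('v, 'k) mpoly) gmodule)"
proof (intro cringI abelian_groupI comm_monoidI)
  fix p assume "p \<in> carrier (polyring V :: (('v, 'k) mpoly, ('v, 'k) mpoly) gmodule)"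
  then show "\<exists>q\<in>carrier (polyring V). q \<oplus>\<^bsub>polyring V\<^esub> p = \<zero>\<^bsub>polyring V\<^esub>"
    by (intro bexI[of _ "- p"]) auto
qed (auto simp: algebra_simps)

definition degree_part :: "int \<Rightarrow> ('v, 'k::field) mpoly \<Rightarrow> ('v, 'k) mpoly" where
  "degree_part k p = (\<Sum>u\<in>{u \<in> Poly_Mapping.keys p. int (monomial_degree u) = k}.
     Poly_Mapping.single u (Poly_Mapping.lookup p u))"

lemma lookup_degree_part:
  "Poly_Mapping.lookup (degree_part k p) u = (if int (monomial_degree u) = k then Poly_Mapping.lookup p u else 0)"
  by (auto simp: degree_part_def lookup_sum lookup_single when_def in_keys_iff)

lemma polyring_minus:
  "p \<in> mpolys V \<Longrightarrow> \<ominus>\<^bsub>polyring V\<^esub> p = - p" for p :: "('v, 'k::field) mpoly"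
proof -
  interpret cring "polyring V :: (('v, 'k) mpoly, ('v, 'k) mpoly) gmodule" by (rule cring_polyring)
  assume "p \<in> mpolys V"
  then show ?thesis by (intro minus_equality) auto
qed

lemma graded_group_polyring: "graded_group (polyring V :: (('v, 'k::field) mpoly, ('v, 'k) mpoly) gmodule)"
proof (rule graded_groupI[where p = degree_part])
  let ?R = "polyring V :: (('v, 'k) mpoly, ('v, 'k) mpoly) gmodule"
  interpret cring ?R by (rule cring_polyring)
  show "abelian_group ?R" by (rule abelian_group_axioms)
  show "additive_subgroup (grade ?R k) ?R" for k
    using keys_add by (intro additive_subgroupI') (fastforce simp: polyring_grade polyring_minus)+
  have part: "degree_part k p \<in> mpolys V" if "p \<in> mpolys V" for k and p :: "('v, 'k) mpoly"
    using that by (auto simp: mpolys_def in_keys_iff lookup_degree_part split: if_splits)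
  show "abelian_group_hom ?R ?R (degree_part k)" for k
    by (intro abelian_group_homI' abelian_group_axioms)
       (auto simp: part lookup_degree_part lookup_add intro!: poly_mapping_eqI)
  show "degree_part k p \<in> grade ?R k" if "p \<in> carrier ?R" for k p
    using part[of p k] that by (auto simp: polyring_grade in_keys_iff lookup_degree_part split: if_splits)
  show "degree_part k p = (if k = j then p else \<zero>\<^bsub>?R\<^esub>)" if "p \<in> grade ?R j" for j k p
    using that by (auto simp: polyring_grade in_keys_iff lookup_degree_part intro!: poly_mapping_eqI)
  fix H assume H: "additive_subgroup H ?R" and sub: "\<And>k. grade ?R k \<subseteq> H"
  interpret H: additive_subgroup H ?R by (rule H)
  show "carrier ?R \<subseteq> H"
  proof
    fix p assume p: "p \<in> carrier ?R"
    show "p \<in> H"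
    proof (rule poly_mapping_induct[where p = p])
      show "0 \<in> H" using H.zero_closed by simp
      show "q + r \<in> H" if "q \<in> H" "r \<in> H" for q r using H.a_closed[OF that] by simp
      fix u c assume "u \<in> Poly_Mapping.keys p"
      then have "Poly_Mapping.keys u \<subseteq> V" using p by (auto simp: mpolys_def)
      then have "Poly_Mapping.single u c \<in> grade ?R (int (monomial_degree u))"
        by (simp add: polyring_grade mpolys_single)
      then show "Poly_Mapping.single u c \<in> H" using sub by blast
    qed
  qed
qed

lemma polyring_grade_mult:
  fixes p q :: "('v, 'k::field) mpoly"
  assumes "p \<in> grade (polyring V) i" "q \<in> grade (polyring V) j"
  shows "p * q \<in> grade (polyring V) (i + j)"
proof -
  have "int (monomial_degree u) = i + j" if "u \<in> Poly_Mapping.keys (p * q)" for u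
    using keys_mult[of p q] that assms by (auto simp: polyring_grade monomial_degree_add)
  then show ?thesis using assms by (simp add: polyring_grade)
qed

lemma polyring_grade_1: "1 \<in> grade (polyring V) 0"
  by (simp add: polyring_grade monomial_degree_def)

lemma polyring_grade_var: "v \<in> V \<Longrightarrow> var v \<in> grade (polyring V) 1"
  using mpolys_var[of v V] by (auto simp: polyring_grade var_def monom_def monomial_degree_single)

lemma polyring_grade_var_power: "v \<in> V \<Longrightarrow> var v ^ n \<in> grade (polyring V) (int n)"
proof (induction n)
  case (Suc n)
  then show ?case using polyring_grade_mult[OF polyring_grade_var[of v V], of "var v ^ n" "int n"] by simp
qed (simp add: polyring_grade_1)

text \<open>Distinct monomials can become equal under the substitution, so the argument is by
  additivity from single terms instead of through the support of the result.\<close>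

lemma subst_vars_grade:
  fixes \<rho> :: "'v \<Rightarrow> 'w" and p :: "('v, 'k::field) mpoly"
  assumes "p \<in> grade (polyring V) k"
  shows "subst_vars \<rho> p \<in> grade (polyring (\<rho> ` V)) k"
proof -
  interpret graded_grp "polyring (\<rho> ` V) :: (('w, 'k) mpoly, ('w, 'k) mpoly) gmodule"
    by (intro graded_grpI graded_group_polyring)
  interpret H: additive_subgroup "grade (polyring (\<rho> ` V)) k" "polyring (\<rho> ` V) :: (('w, 'k) mpoly, ('w, 'k) mpoly) gmodule"
    by (rule grade_subgroup)
  show ?thesis
  proof (rule poly_mapping_induct[where p = p])
    show "subst_vars \<rho> (q + r) \<in> grade (polyring (\<rho> ` V)) k"
      if "subst_vars \<rho> q \<in> grade (polyring (\<rho> ` V)) k" "subst_vars \<rho> r \<in> grade (polyring (\<rho> ` V)) k" for q r :: "('v, 'k) mpoly"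
      using H.a_closed[OF that] by (simp add: subst_vars_add)
    fix u and c :: 'k assume "u \<in> Poly_Mapping.keys p"
    then have u: "Poly_Mapping.keys u \<subseteq> V" "int (monomial_degree u) = k"
      using assms by (auto simp: polyring_grade mpolys_def)
    have "Poly_Mapping.keys (subst_monomial \<rho> u) \<subseteq> \<rho> ` V" using keys_subst_monomial[of \<rho> u] u(1) by blast
    then show "subst_vars \<rho> (Poly_Mapping.single u c) \<in> grade (polyring (\<rho> ` V)) k"
      using u(2) by (auto simp: subst_vars_single polyring_grade monomial_degree_subst intro!: mpolys_single)
  qed (use H.zero_closed in simp)
qed

lemma merged_polyring_simps [simp]:
  "carrier (merged_polyring v w V) = mpolys (merge v w ` V)" "p \<oplus>\<^bsub>merged_polyring v w V\<^esub> q = p + q"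
  "\<zero>\<^bsub>merged_polyring v w V\<^esub> = 0" "p \<otimes>\<^bsub>merged_polyring v w V\<^esub> q = p * q"
  "\<one>\<^bsub>merged_polyring v w V\<^esub> = 1" "p \<odot>\<^bsub>merged_polyring v w V\<^esub> q = subst_vars (merge v w) p * q"
  "grade (merged_polyring v w V) = grade (polyring (merge v w ` V))"
  by (simp_all add: merged_polyring_def polyring_def)

section \<open>The tensor product with the merged polynomial ring\<close>

locale merged_tensor =
  fixes v w :: 'v and V :: "'v set" and C :: "(('v, 'k::field) mpoly, 'c) gmodule"
  assumes C: "module (polyring V) C"
begin

abbreviation "W \<equiv> merge v w ` V"
abbreviation "T \<equiv> merged_polyring v w V :: (('v, 'k) mpoly, ('v, 'k) mpoly) gmodule"
abbreviation "S \<equiv> polyring W :: (('v, 'k) mpoly, ('v, 'k) mpoly) gmodule"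
abbreviation "P \<equiv> pretensor C T"
abbreviation "Null \<equiv> tensor_null (polyring V) C T"
abbreviation "X \<equiv> tensor (polyring V) C T"
abbreviation "pure \<equiv> pure_tensor (polyring V) C T"
abbreviation "\<sigma> \<equiv> subst_vars (merge v w) :: ('v, 'k) mpoly \<Rightarrow> ('v, 'k) mpoly"

sublocale C: module "polyring V" C by (rule C)

lemma pretensor_simps [simp]:
  "carrier P = {z. Poly_Mapping.keys z \<subseteq> carrier C \<times> mpolys W}"
  "x \<oplus>\<^bsub>P\<^esub> y = x + y" "\<zero>\<^bsub>P\<^esub> = 0"
  "s \<odot>\<^bsub>P\<^esub> z = frag_extend (\<lambda>(m, t). frag_of (m, s * t)) z"
  "grade P k = {z. Poly_Mapping.keys z \<subseteq> (\<Union>i. grade C i \<times> grade S (k - i))}"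
  by (simp_all add: pretensor_def)

lemma pretensor_group: "abelian_group P"
proof (intro abelian_groupI)
  fix z assume "z \<in> carrier P"
  then show "\<exists>y\<in>carrier P. y \<oplus>\<^bsub>P\<^esub> z = \<zero>\<^bsub>P\<^esub>" by (intro bexI[of _ "- z"]) auto
next
  show "x \<oplus>\<^bsub>P\<^esub> y \<in> carrier P" if "x \<in> carrier P" "y \<in> carrier P" for x y
    using that keys_add[of x y] by auto
qed (simp_all add: add.assoc add.commute)

sublocale P: abelian_group P by (rule pretensor_group)

lemma pretensor_minus: "z \<in> carrier P \<Longrightarrow> \<ominus>\<^bsub>P\<^esub> z = - z"
  by (intro P.minus_equality) auto

lemma frag_of_carrier: "m \<in> carrier C \<Longrightarrow> t \<in> mpolys W \<Longrightarrow> frag_of (m, t) \<in> carrier P"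
  by (simp add: keys_frag_of)

lemma tensor_relations_carrier: "tensor_relations (polyring V) C T \<subseteq> carrier P"
proof -
  have *: "a - b \<in> carrier P" if "a \<in> carrier P" "b \<in> carrier P" for a b
    using that keys_diff[of a b] by auto
  show ?thesis
    unfolding tensor_relations_def
    by (intro subsetI, elim UnE CollectE exE conjE)
       (auto simp del: pretensor_simps simp: subst_vars_mpolys intro!: * frag_of_carrier)
qed

lemma null_subgroup: "additive_subgroup Null P"
  unfolding tensor_null_def additive_subgroup_def
  using group.generate_is_subgroup[OF P.a_group] tensor_relations_carrier by simp

lemma null_least:
  assumes "additive_subgroup H P" "tensor_relations (polyring V) C T \<subseteq> H"
  shows "Null \<subseteq> H"
  using assms group.generate_subgroup_incl[OF P.a_group, of "tensor_relations (polyring V) C T" H]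
  by (simp add: tensor_null_def additive_subgroup_def)

lemma relation_in_null: "z \<in> tensor_relations (polyring V) C T \<Longrightarrow> z \<in> Null"
  unfolding tensor_null_def by (rule generate.incl)

sublocale X: quotient_group P Null
  by (intro quotient_group.intro quotient_group_axioms.intro pretensor_group null_subgroup)

lemma tensor_eq: "X = quot_gmod P Null"
  by (simp add: tensor_def)

lemma tensor_group: "abelian_group X"
  using X.quot_group by (simp add: tensor_eq)

sublocale XG: abelian_group X by (rule tensor_group)

lemma pure_eq: "pure m t = Null +>\<^bsub>P\<^esub> frag_of (m, t)"
  by (simp add: pure_tensor_def)

lemma pure_carrier [simp]: "m \<in> carrier C \<Longrightarrow> t \<in> mpolys W \<Longrightarrow> pure m t \<in> carrier X"
  using frag_of_carrier[of m t] by (auto simp: pure_eq tensor_eq X.quot_carrier simp del: pretensor_simps)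

lemma coset_eqI:
  assumes "x - y \<in> Null" "x \<in> carrier P" "y \<in> carrier P"
  shows "Null +>\<^bsub>P\<^esub> x = Null +>\<^bsub>P\<^esub> y"
  using assms by (simp add: X.quot_eq_iff a_minus_def pretensor_minus del: pretensor_simps(1))

lemma pure_add_left:
  assumes "m \<in> carrier C" "m' \<in> carrier C" "t \<in> mpolys W"
  shows "pure (m \<oplus>\<^bsub>C\<^esub> m') t = pure m t \<oplus>\<^bsub>X\<^esub> pure m' t"
proof -
  have "frag_of (m \<oplus>\<^bsub>C\<^esub> m', t) - frag_of (m, t) - frag_of (m', t) \<in> Null"
    using assms by (intro relation_in_null) (auto simp: tensor_relations_def)
  then have "frag_of (m \<oplus>\<^bsub>C\<^esub> m', t) - (frag_of (m, t) + frag_of (m', t)) \<in> Null" by (simp add: diff_diff_eq)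
  moreover have "frag_of (m, t) + frag_of (m', t) \<in> carrier P"
    using P.a_closed[OF frag_of_carrier frag_of_carrier] assms by (simp del: pretensor_simps(1))
  ultimately have "pure (m \<oplus>\<^bsub>C\<^esub> m') t = Null +>\<^bsub>P\<^esub> (frag_of (m, t) + frag_of (m', t))"
    unfolding pure_eq using frag_of_carrier assms by (intro coset_eqI) auto
  then show ?thesis using X.quot_add[OF frag_of_carrier frag_of_carrier] assms
    by (simp add: pure_eq tensor_eq del: pretensor_simps(1))
qed

lemma pure_add_right:
  assumes "m \<in> carrier C" "t \<in> mpolys W" "t' \<in> mpolys W"
  shows "pure m (t + t') = pure m t \<oplus>\<^bsub>X\<^esub> pure m t'"
proof -
  have "frag_of (m, t + t') - frag_of (m, t) - frag_of (m, t') \<in> Null"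
    using assms by (intro relation_in_null) (auto simp: tensor_relations_def)
  then have "frag_of (m, t + t') - (frag_of (m, t) + frag_of (m, t')) \<in> Null" by (simp add: diff_diff_eq)
  moreover have "frag_of (m, t) + frag_of (m, t') \<in> carrier P"
    using P.a_closed[OF frag_of_carrier frag_of_carrier] assms by (simp del: pretensor_simps(1))
  ultimately have "pure m (t + t') = Null +>\<^bsub>P\<^esub> (frag_of (m, t) + frag_of (m, t'))"
    unfolding pure_eq using frag_of_carrier assms by (intro coset_eqI) auto
  then show ?thesis using X.quot_add[OF frag_of_carrier frag_of_carrier] assms
    by (simp add: pure_eq tensor_eq del: pretensor_simps(1))
qed

lemma pure_balanced:
  assumes "r \<in> mpolys V" "m \<in> carrier C" "t \<in> mpolys W"
  shows "pure (r \<odot>\<^bsub>C\<^esub> m) t = pure m (\<sigma> r * t)"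
proof -
  have "frag_of (r \<odot>\<^bsub>C\<^esub> m, t) - frag_of (m, \<sigma> r * t) \<in> Null"
    using assms by (intro relation_in_null) (auto simp: tensor_relations_def)
  then show ?thesis
    unfolding pure_eq using assms by (intro coset_eqI frag_of_carrier) (auto simp: subst_vars_mpolys)
qed

text \<open>The set A is chosen later either as all pairs or as the homogeneous pairs of one fixed
  total degree.\<close>

lemma pretensor_span:
  assumes H: "additive_subgroup H P" and gen: "\<And>x. x \<in> A \<Longrightarrow> frag_of x \<in> H"
    and z: "Poly_Mapping.keys z \<subseteq> A"
  shows "z \<in> H"
proof -
  interpret H: additive_subgroup H P by fact
  show ?thesis
    using z
  proof (induction rule: frag_induction)
    case zero then show ?case using H.zero_closed by simp
  next
    case (one x) then show ?case by (rule gen)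
  next
    case (diff a b)
    then have "a \<oplus>\<^bsub>P\<^esub> \<ominus>\<^bsub>P\<^esub> b \<in> H" by (intro H.a_closed H.a_inv_closed)
    then show ?case using H.a_Hcarr[OF diff(2)] by (simp add: pretensor_minus del: pretensor_simps(1))
  qed
qed

lemma pretensor_hom_eq:
  assumes f: "abelian_group_hom P Y f" and g: "abelian_group_hom P Y g"
    and eq: "\<And>m t. m \<in> carrier C \<Longrightarrow> t \<in> mpolys W \<Longrightarrow> f (frag_of (m, t)) = g (frag_of (m, t))"
    and z: "z \<in> carrier P"
  shows "f z = g z"
proof -
  have "z \<in> {z \<in> carrier P. f z = g z}"
  proof (rule pretensor_span[OF additive_subgroup_equalizer[OF f g], of "carrier C \<times> mpolys W"])
    show "frag_of x \<in> {z \<in> carrier P. f z = g z}" if "x \<in> carrier C \<times> mpolys W" for x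
      using that eq frag_of_carrier by (cases x) auto
  qed (use z in simp)
  then show ?thesis by simp
qed

lemma tensor_span:
  assumes H: "additive_subgroup H X" and gen: "\<And>m t. m \<in> carrier C \<Longrightarrow> t \<in> mpolys W \<Longrightarrow> pure m t \<in> H"
  shows "carrier X \<subseteq> H"
proof -
  have "z \<in> {z \<in> carrier P. Null +>\<^bsub>P\<^esub> z \<in> H}" if "z \<in> carrier P" for z
  proof (rule pretensor_span[where A = "carrier C \<times> mpolys W"])
    show "additive_subgroup {z \<in> carrier P. Null +>\<^bsub>P\<^esub> z \<in> H} P"
      using additive_subgroup_vimage[OF X.quot_hom] H by (simp only: tensor_eq)
    show "frag_of x \<in> {z \<in> carrier P. Null +>\<^bsub>P\<^esub> z \<in> H}" if "x \<in> carrier C \<times> mpolys W" for x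
      using that gen[of "fst x" "snd x"] frag_of_carrier[of "fst x" "snd x"]
      by (cases x) (simp add: pure_eq del: pretensor_simps)
  qed (use that in simp)
  then show ?thesis by (auto simp: tensor_eq X.quot_carrier simp del: pretensor_simps)
qed

lemma smult_hom:
  assumes s: "s \<in> mpolys W"
  shows "abelian_group_hom P P (\<lambda>z. s \<odot>\<^bsub>P\<^esub> z)"
proof (intro abelian_group_homI' pretensor_group)
  show "s \<odot>\<^bsub>P\<^esub> z \<in> carrier P" if "z \<in> carrier P" for z
    using that s keys_frag_extend[of "\<lambda>(m, t). frag_of (m, s * t)" z]
    by (fastforce simp: keys_frag_of)
qed (simp add: frag_extend_add)

text \<open>Multiplying the second entries by s turns each bilinearity relation into one of the same
  kind; for the balancing relation this uses commutativity of the ring.\<close>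

lemma smult_null:
  assumes s: "s \<in> mpolys W" and z: "z \<in> Null"
  shows "s \<odot>\<^bsub>P\<^esub> z \<in> Null"
proof -
  have "Null \<subseteq> {z \<in> carrier P. s \<odot>\<^bsub>P\<^esub> z \<in> Null}"
  proof (rule null_least)
    show "additive_subgroup {z \<in> carrier P. s \<odot>\<^bsub>P\<^esub> z \<in> Null} P"
      by (rule additive_subgroup_vimage[OF smult_hom[OF s] null_subgroup])
    have "s \<odot>\<^bsub>P\<^esub> z \<in> tensor_relations (polyring V) C T" if "z \<in> tensor_relations (polyring V) C T" for z
      using that unfolding tensor_relations_def
    proof (elim UnE CollectE exE conjE, goal_cases)
      case (1 m m' t)
      have "s \<odot>\<^bsub>P\<^esub> z = frag_of (m \<oplus>\<^bsub>C\<^esub> m', s * t) - frag_of (m, s * t) - frag_of (m', s * t)"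
        using 1 by (simp add: frag_extend_diff)
      moreover have "s * t \<in> mpolys W" using 1 s by simp
      ultimately show ?case using 1(2,3) by simp blast
    next
      case (2 m t t')
      have "s \<odot>\<^bsub>P\<^esub> z = frag_of (m, s * t + s * t') - frag_of (m, s * t) - frag_of (m, s * t')"
        using 2 by (simp add: frag_extend_diff distrib_left)
      moreover have "s * t \<in> mpolys W" "s * t' \<in> mpolys W" using 2 s by simp_all
      ultimately show ?case using 2(2) by simp blast
    next
      case (3 r m t)
      have "s \<odot>\<^bsub>P\<^esub> z = frag_of (r \<odot>\<^bsub>C\<^esub> m, s * t) - frag_of (m, \<sigma> r * (s * t))"
        using 3 by (simp add: frag_extend_diff mult.left_commute)
      moreover have "s * t \<in> mpolys W" using 3 s by simp
      ultimately show ?case using 3(2,3) by simp blast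
    qed
    then show "tensor_relations (polyring V) C T \<subseteq> {z \<in> carrier P. s \<odot>\<^bsub>P\<^esub> z \<in> Null}"
      using relation_in_null tensor_relations_carrier by blast
  qed
  then show ?thesis using z by blast
qed

lemma smult_coset:
  assumes "s \<in> mpolys W" "z \<in> carrier P"
  shows "s \<odot>\<^bsub>X\<^esub> (Null +>\<^bsub>P\<^esub> z) = Null +>\<^bsub>P\<^esub> (s \<odot>\<^bsub>P\<^esub> z)"
  unfolding tensor_eq
proof (rule X.quot_smult)
  interpret s: abelian_group_hom P P "\<lambda>z. s \<odot>\<^bsub>P\<^esub> z" by (rule smult_hom[OF assms(1)])
  show "s \<odot>\<^bsub>P\<^esub> x \<in> carrier P" if "x \<in> carrier P" for x using that by (rule s.hom_closed)
  show "s \<odot>\<^bsub>P\<^esub> (x \<oplus>\<^bsub>P\<^esub> y) = s \<odot>\<^bsub>P\<^esub> x \<oplus>\<^bsub>P\<^esub> s \<odot>\<^bsub>P\<^esub> y" if "x \<in> carrier P" "y \<in> carrier P" for x y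
    using that by (rule s.hom_add)
qed (use assms smult_null in auto)

lemma smult_pure:
  assumes "s \<in> mpolys W" "m \<in> carrier C" "t \<in> mpolys W"
  shows "s \<odot>\<^bsub>X\<^esub> pure m t = pure m (s * t)"
  using smult_coset[OF assms(1) frag_of_carrier[OF assms(2,3)]] by (simp add: pure_eq del: pretensor_simps(1))

text \<open>Distributivity over sums of scalars holds only modulo \<open>Null\<close>. Both sides of
  each axiom are additive in x, so comparing them on pairs suffices.\<close>

lemma tensor_module: "module S X"
  unfolding tensor_eq
proof (rule X.quot_module[OF cring_polyring])
  note hom = abelian_group_hom_comp[OF smult_hom X.quot_hom]
  show "Null +>\<^bsub>P\<^esub> ((r \<oplus>\<^bsub>S\<^esub> s) \<odot>\<^bsub>P\<^esub> x) = Null +>\<^bsub>P\<^esub> (r \<odot>\<^bsub>P\<^esub> x \<oplus>\<^bsub>P\<^esub> s \<odot>\<^bsub>P\<^esub> x)"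
    if "r \<in> carrier S" "s \<in> carrier S" "x \<in> carrier P" for r s x
  proof (rule pretensor_hom_eq[where f = "\<lambda>x. Null +>\<^bsub>P\<^esub> ((r \<oplus>\<^bsub>S\<^esub> s) \<odot>\<^bsub>P\<^esub> x)" and Y = X])
    show "abelian_group_hom P X (\<lambda>x. Null +>\<^bsub>P\<^esub> ((r \<oplus>\<^bsub>S\<^esub> s) \<odot>\<^bsub>P\<^esub> x))"
      using hom[of "r \<oplus>\<^bsub>S\<^esub> s"] that by (simp add: tensor_eq)
    have "abelian_group_hom P P (\<lambda>x. r \<odot>\<^bsub>P\<^esub> x \<oplus>\<^bsub>P\<^esub> s \<odot>\<^bsub>P\<^esub> x)"
    proof (intro abelian_group_homI' pretensor_group)
      show "r \<odot>\<^bsub>P\<^esub> x \<oplus>\<^bsub>P\<^esub> s \<odot>\<^bsub>P\<^esub> x \<in> carrier P" if "x \<in> carrier P" for x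
        using that \<open>r \<in> carrier S\<close> \<open>s \<in> carrier S\<close> abelian_group_hom.hom_closed[OF smult_hom]
        by (intro P.a_closed) auto
    qed (simp add: frag_extend_add)
    from abelian_group_hom_comp[OF this X.quot_hom]
    show "abelian_group_hom P X (\<lambda>x. Null +>\<^bsub>P\<^esub> (r \<odot>\<^bsub>P\<^esub> x \<oplus>\<^bsub>P\<^esub> s \<odot>\<^bsub>P\<^esub> x))" by (simp only: tensor_eq)
    fix m and t :: "('v, 'k) mpoly" assume mt: "m \<in> carrier C" "t \<in> mpolys W"
    have "Null +>\<^bsub>P\<^esub> (frag_of (m, r * t) + frag_of (m, s * t)) = pure m (r * t) \<oplus>\<^bsub>X\<^esub> pure m (s * t)"
      using X.quot_add[OF frag_of_carrier frag_of_carrier] mt that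
      by (simp add: pure_eq tensor_eq del: pretensor_simps(1))
    also have "\<dots> = pure m ((r + s) * t)" using pure_add_right[of m "r * t" "s * t"] mt that by (simp add: distrib_right)
    finally show "Null +>\<^bsub>P\<^esub> ((r \<oplus>\<^bsub>S\<^esub> s) \<odot>\<^bsub>P\<^esub> frag_of (m, t)) =
        Null +>\<^bsub>P\<^esub> (r \<odot>\<^bsub>P\<^esub> frag_of (m, t) \<oplus>\<^bsub>P\<^esub> s \<odot>\<^bsub>P\<^esub> frag_of (m, t))"
      by (simp add: pure_eq)
  qed (use that in auto)
  show "Null +>\<^bsub>P\<^esub> ((r \<otimes>\<^bsub>S\<^esub> s) \<odot>\<^bsub>P\<^esub> x) = Null +>\<^bsub>P\<^esub> (r \<odot>\<^bsub>P\<^esub> (s \<odot>\<^bsub>P\<^esub> x))"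
    if "r \<in> carrier S" "s \<in> carrier S" "x \<in> carrier P" for r s x
  proof (rule pretensor_hom_eq[where f = "\<lambda>x. Null +>\<^bsub>P\<^esub> ((r \<otimes>\<^bsub>S\<^esub> s) \<odot>\<^bsub>P\<^esub> x)" and Y = X])
    show "abelian_group_hom P X (\<lambda>x. Null +>\<^bsub>P\<^esub> ((r \<otimes>\<^bsub>S\<^esub> s) \<odot>\<^bsub>P\<^esub> x))"
      using hom[of "r \<otimes>\<^bsub>S\<^esub> s"] that by (simp add: tensor_eq)
    show "abelian_group_hom P X (\<lambda>x. Null +>\<^bsub>P\<^esub> (r \<odot>\<^bsub>P\<^esub> (s \<odot>\<^bsub>P\<^esub> x)))"
      using abelian_group_hom_comp[OF smult_hom[of s] hom[of r]] that by (simp add: tensor_eq)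
  qed (use that in \<open>auto simp: mult.assoc\<close>)
  show "Null +>\<^bsub>P\<^esub> (\<one>\<^bsub>S\<^esub> \<odot>\<^bsub>P\<^esub> x) = Null +>\<^bsub>P\<^esub> x" if "x \<in> carrier P" for x
  proof (rule pretensor_hom_eq[where f = "\<lambda>x. Null +>\<^bsub>P\<^esub> (\<one>\<^bsub>S\<^esub> \<odot>\<^bsub>P\<^esub> x)" and Y = X])
    show "abelian_group_hom P X (\<lambda>x. Null +>\<^bsub>P\<^esub> (\<one>\<^bsub>S\<^esub> \<odot>\<^bsub>P\<^esub> x))"
      using hom[of "\<one>\<^bsub>S\<^esub>"] by (simp add: tensor_eq)
    show "abelian_group_hom P X (\<lambda>x. Null +>\<^bsub>P\<^esub> x)" using X.quot_hom by (simp add: tensor_eq)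
  qed (use that in auto)
  show "r \<odot>\<^bsub>P\<^esub> x \<in> carrier P" if "r \<in> carrier S" "x \<in> carrier P" for r x
    using abelian_group_hom.hom_closed[OF smult_hom, of r x] that by simp
  show "r \<odot>\<^bsub>P\<^esub> (x \<oplus>\<^bsub>P\<^esub> y) = r \<odot>\<^bsub>P\<^esub> x \<oplus>\<^bsub>P\<^esub> r \<odot>\<^bsub>P\<^esub> y" for r x y
    by (simp add: frag_extend_add)
  show "r \<odot>\<^bsub>P\<^esub> x \<in> Null" if "r \<in> carrier S" "x \<in> Null" for r x
    using smult_null[of r x] that by simp
qed

text \<open>The target is only an abelian group, so that one statement yields both the degree
  projections, which are not linear, and the linear maps out of a presentation.\<close>

lemma tensor_universal:
  assumes Y: "abelian_group Y"
    and b: "\<And>m t. m \<in> carrier C \<Longrightarrow> t \<in> mpolys W \<Longrightarrow> b m t \<in> carrier Y"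
    and add_left: "\<And>m m' t. m \<in> carrier C \<Longrightarrow> m' \<in> carrier C \<Longrightarrow> t \<in> mpolys W \<Longrightarrow>
      b (m \<oplus>\<^bsub>C\<^esub> m') t = b m t \<oplus>\<^bsub>Y\<^esub> b m' t"
    and add_right: "\<And>m t t'. m \<in> carrier C \<Longrightarrow> t \<in> mpolys W \<Longrightarrow> t' \<in> mpolys W \<Longrightarrow>
      b m (t + t') = b m t \<oplus>\<^bsub>Y\<^esub> b m t'"
    and balanced: "\<And>r m t. r \<in> mpolys V \<Longrightarrow> m \<in> carrier C \<Longrightarrow> t \<in> mpolys W \<Longrightarrow>
      b (r \<odot>\<^bsub>C\<^esub> m) t = b m (\<sigma> r * t)"
  shows "\<exists>f. abelian_group_hom X Y f \<and> (\<forall>m\<in>carrier C. \<forall>t\<in>mpolys W. f (pure m t) = b m t)"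
proof -
  interpret Y: abelian_group Y by fact
  have "(\<lambda>(m, t). b m t) ` (carrier C \<times> mpolys W) \<subseteq> carrier (add_monoid Y)" using b by auto
  from comm_group.free_Abelian_group_universal[OF Y.a_comm_group this]
  obtain h where h: "h \<in> hom (free_Abelian_group (carrier C \<times> mpolys W)) (add_monoid Y)"
    "\<And>x. x \<in> carrier C \<times> mpolys W \<Longrightarrow> h (frag_of x) = (\<lambda>(m, t). b m t) x" by blast
  have "abelian_group_hom P Y h"
    using h(1) by (intro abelian_group_homI' pretensor_group Y) (auto simp: hom_def free_Abelian_group_def)
  then interpret h: abelian_group_hom P Y h .
  have hf: "h (frag_of (m, t)) = b m t" if "m \<in> carrier C" "t \<in> mpolys W" for m t using h(2) that by simp
  have hdiff: "h (x - y) = h x \<ominus>\<^bsub>Y\<^esub> h y" if "x \<in> carrier P" "y \<in> carrier P" for x y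
    using h.hom_add[OF that(1) P.a_inv_closed[OF that(2)]] h.hom_a_inv[OF that(2)] pretensor_minus[OF that(2)]
    by (simp add: a_minus_def)
  have cdiff: "x - y \<in> carrier P" if "x \<in> carrier P" "y \<in> carrier P" for x y
    using that keys_diff[of x y] by auto
  have cancel: "(x \<oplus>\<^bsub>Y\<^esub> y) \<ominus>\<^bsub>Y\<^esub> x \<ominus>\<^bsub>Y\<^esub> y = \<zero>\<^bsub>Y\<^esub>" if "x \<in> carrier Y" "y \<in> carrier Y" for x y
  proof -
    have "y \<oplus>\<^bsub>Y\<^esub> (\<ominus>\<^bsub>Y\<^esub> x \<oplus>\<^bsub>Y\<^esub> \<ominus>\<^bsub>Y\<^esub> y) = \<ominus>\<^bsub>Y\<^esub> x \<oplus>\<^bsub>Y\<^esub> (y \<oplus>\<^bsub>Y\<^esub> \<ominus>\<^bsub>Y\<^esub> y)"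
      using that by (intro Y.a_lcomm) auto
    then show ?thesis using that by (simp add: a_minus_def Y.a_assoc Y.r_neg)
  qed
  have "tensor_relations (polyring V) C T \<subseteq> {z \<in> carrier P. h z \<in> {\<zero>\<^bsub>Y\<^esub>}}"
  proof
    fix z assume z: "z \<in> tensor_relations (polyring V) C T"
    then have "h z = \<zero>\<^bsub>Y\<^esub>"
      unfolding tensor_relations_def
    proof (elim UnE CollectE exE conjE, goal_cases)
      case (1 m m' t)
      then show ?case
        by (simp add: hdiff cdiff frag_of_carrier hf add_left cancel b del: pretensor_simps(1))
    next
      case (2 m t t')
      then show ?case
        by (simp add: hdiff cdiff frag_of_carrier hf add_right cancel b del: pretensor_simps(1))
    next
      case (3 r m t)
      then show ?case
        by (simp add: hdiff cdiff frag_of_carrier hf balanced b subst_vars_mpolys a_minus_def Y.r_neg del: pretensor_simps(1))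
    qed
    then show "z \<in> {z \<in> carrier P. h z \<in> {\<zero>\<^bsub>Y\<^esub>}}" using z tensor_relations_carrier by blast
  qed
  moreover have "additive_subgroup {\<zero>\<^bsub>Y\<^esub>} Y"
    using abelian_group.additive_subgroupI'[OF Y, of "{\<zero>\<^bsub>Y\<^esub>}"] Y.minus_equality[of "\<zero>\<^bsub>Y\<^esub>" "\<zero>\<^bsub>Y\<^esub>"] by simp
  ultimately have "Null \<subseteq> {z \<in> carrier P. h z \<in> {\<zero>\<^bsub>Y\<^esub>}}"
    by (intro null_least additive_subgroup_vimage[OF h.abelian_group_hom_axioms])
  then have hN: "h z = \<zero>\<^bsub>Y\<^esub>" if "z \<in> Null" for z using that by blast
  note ind = X.induced_map[OF h.abelian_group_hom_axioms]
  show ?thesis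
  proof (intro exI[of _ "induced_map h"] conjI ballI)
    show "abelian_group_hom X Y (induced_map h)" using ind(1)[OF hN] by (simp only: tensor_eq)
    show "induced_map h (pure m t) = b m t" if "m \<in> carrier C" "t \<in> mpolys W" for m t
      using ind(2)[OF hN frag_of_carrier[OF that]] hf[OF that] by (simp add: pure_eq)
  qed
qed

end

section \<open>The grading of the tensor product\<close>

lemma (in graded_grp) hom_eq_on_grades:
  assumes "abelian_group_hom M Y f" "abelian_group_hom M Y g"
    and "\<And>k x. x \<in> grade M k \<Longrightarrow> f x = g x" and "x \<in> carrier M"
  shows "f x = g x"
  using grade_span[OF additive_subgroup_equalizer[OF assms(1,2)]] assms(3,4) grade_carrier by blast

locale graded_merged_tensor = merged_tensor v w V C
  for v w :: 'v and V and C :: "(('v, 'k::field) mpoly, 'c) gmodule" +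
  assumes C_graded: "graded_module (polyring V) C"
begin

sublocale CG: graded_grp C using graded_module_D(2)[OF C_graded] .
sublocale RG: graded_grp "polyring V :: (('v, 'k) mpoly, ('v, 'k) mpoly) gmodule"
  by (intro graded_grpI graded_group_polyring)
sublocale SG: graded_grp "polyring (merge v w ` V) :: (('v, 'k) mpoly, ('v, 'k) mpoly) gmodule"
  by (intro graded_grpI graded_group_polyring)

lemma pure_hom_left: "t \<in> mpolys W \<Longrightarrow> abelian_group_hom C X (\<lambda>m. pure m t)"
  by (intro abelian_group_homI' C.M.abelian_group_axioms tensor_group) (auto simp: pure_add_left)

lemma pure_hom_right: "m \<in> carrier C \<Longrightarrow> abelian_group_hom S X (\<lambda>t. pure m t)"
  by (intro abelian_group_homI' SG.abelian_group_axioms tensor_group) (auto simp: pure_add_right)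

lemma pure_grade:
  assumes "m \<in> grade C i" "t \<in> grade S j"
  shows "pure m t \<in> grade X (i + j)"
proof -
  have "(m, t) \<in> grade C i \<times> grade S (i + j - i)" using assms by simp
  then have "frag_of (m, t) \<in> grade P (i + j)" by (auto simp: keys_frag_of)
  then show ?thesis by (auto simp: tensor_eq pure_eq simp del: pretensor_simps)
qed

lemma pretensor_grade_subgroup: "additive_subgroup (grade P k) P"
proof (rule P.additive_subgroupI')
  show "grade P k \<subseteq> carrier P" using CG.grade_carrier SG.grade_carrier by fastforce
  then show "\<ominus>\<^bsub>P\<^esub> z \<in> grade P k" if "z \<in> grade P k" for z
    using that by (subst pretensor_minus) auto
  show "x \<oplus>\<^bsub>P\<^esub> y \<in> grade P k" if "x \<in> grade P k" "y \<in> grade P k" for x y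
    using that keys_add[of x y] by auto
qed simp

lemma tensor_grade_eq: "grade X k = (\<lambda>z. Null +>\<^bsub>P\<^esub> z) ` grade P k"
  by (simp add: tensor_eq del: pretensor_simps)

lemma tensor_grade_subgroup: "additive_subgroup (grade X k) X"
  unfolding tensor_grade_eq
  using additive_subgroup_image[OF X.quot_hom pretensor_grade_subgroup] by (simp only: tensor_eq)

lemma tensor_grade_least:
  assumes H: "additive_subgroup H X"
    and gen: "\<And>i m t. m \<in> grade C i \<Longrightarrow> t \<in> grade S (k - i) \<Longrightarrow> pure m t \<in> H"
  shows "grade X k \<subseteq> H"
proof
  fix x assume "x \<in> grade X k"
  then obtain z where z: "z \<in> grade P k" "x = Null +>\<^bsub>P\<^esub> z" by (auto simp: tensor_grade_eq simp del: pretensor_simps)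
  have "z \<in> {z \<in> carrier P. Null +>\<^bsub>P\<^esub> z \<in> H}"
  proof (rule pretensor_span[where A = "\<Union>i. grade C i \<times> grade S (k - i)"])
    show "additive_subgroup {z \<in> carrier P. Null +>\<^bsub>P\<^esub> z \<in> H} P"
      using additive_subgroup_vimage[OF X.quot_hom] H by (simp only: tensor_eq)
    fix y assume "y \<in> (\<Union>i. grade C i \<times> grade S (k - i))"
    then obtain i m t where y: "y = (m, t)" "m \<in> grade C i" "t \<in> grade S (k - i)" by auto
    then have "frag_of (m, t) \<in> carrier P"
      using CG.grade_carrier[of m] SG.grade_carrier[of t] by (intro frag_of_carrier) auto
    then show "frag_of y \<in> {z \<in> carrier P. Null +>\<^bsub>P\<^esub> z \<in> H}"
      using gen[OF y(2,3)] by (simp add: y(1) pure_eq del: pretensor_simps)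
  qed (use z in simp)
  then show "x \<in> H" using z by simp
qed

text \<open>The degree k part of m tensor t, obtained from the pairs of components whose degrees add
  up to k. Summing over the support of m keeps it finite; additivity in t is then immediate, and
  additivity in m needs a common larger index set.\<close>

definition component :: "int \<Rightarrow> 'c \<Rightarrow> ('v, 'k) mpoly \<Rightarrow> (('c \<times> ('v, 'k) mpoly) \<Rightarrow>\<^sub>0 int) set" where
  "component k m t = finsum X (\<lambda>i. pure (hcomp C m i) (hcomp S t (k - i))) {i. hcomp C m i \<noteq> \<zero>\<^bsub>C\<^esub>}"

lemma pure_hcomp_carrier: "m \<in> carrier C \<Longrightarrow> t \<in> mpolys W \<Longrightarrow> pure (hcomp C m i) (hcomp S t j) \<in> carrier X"
  using SG.hcomp_carrier[of t j] by (intro pure_carrier) auto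

lemma component_superset:
  assumes "m \<in> carrier C" "t \<in> mpolys W" "finite K" "{i. hcomp C m i \<noteq> \<zero>\<^bsub>C\<^esub>} \<subseteq> K"
  shows "component k m t = finsum X (\<lambda>i. pure (hcomp C m i) (hcomp S t (k - i))) K"
  unfolding component_def
proof (rule XG.finsum_support[OF assms(3,4)])
  show "pure (hcomp C m i) (hcomp S t (k - i)) = \<zero>\<^bsub>X\<^esub>" if "i \<in> K - {i. hcomp C m i \<noteq> \<zero>\<^bsub>C\<^esub>}" for i
    using that abelian_group_hom.hom_zero[OF pure_hom_left[of "hcomp S t (k - i)"]] SG.hcomp_carrier[of t "k - i"] assms(2)
    by simp
qed (use pure_hcomp_carrier assms in auto)

lemma component_hom_left:
  assumes t: "t \<in> mpolys W"
  shows "abelian_group_hom C X (\<lambda>m. component k m t)"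
proof (intro abelian_group_homI' C.M.abelian_group_axioms tensor_group)
  show "component k m t \<in> carrier X" if "m \<in> carrier C" for m
    unfolding component_def using pure_hcomp_carrier[OF that t] by auto
  fix m m' assume m: "m \<in> carrier C" "m' \<in> carrier C"
  let ?K = "{i. hcomp C m i \<noteq> \<zero>\<^bsub>C\<^esub>} \<union> {i. hcomp C m' i \<noteq> \<zero>\<^bsub>C\<^esub>}"
  have K: "finite ?K" using CG.hcomp_props(2) m by simp
  have "{i. hcomp C (m \<oplus>\<^bsub>C\<^esub> m') i \<noteq> \<zero>\<^bsub>C\<^esub>} \<subseteq> ?K" using m by (auto simp: CG.hcomp_add)
  then have "component k (m \<oplus>\<^bsub>C\<^esub> m') t =
      finsum X (\<lambda>i. pure (hcomp C (m \<oplus>\<^bsub>C\<^esub> m') i) (hcomp S t (k - i))) ?K"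
    using m t K by (intro component_superset) auto
  also have "\<dots> = finsum X (\<lambda>i. pure (hcomp C m i) (hcomp S t (k - i)) \<oplus>\<^bsub>X\<^esub> pure (hcomp C m' i) (hcomp S t (k - i))) ?K"
    using m t SG.hcomp_carrier[of t] pure_hcomp_carrier by (intro XG.finsum_cong') (auto simp: CG.hcomp_add pure_add_left)
  also have "\<dots> = component k m t \<oplus>\<^bsub>X\<^esub> component k m' t"
    using m t K pure_hcomp_carrier by (simp add: component_superset[of _ t ?K] XG.finsum_addf)
  finally show "component k (m \<oplus>\<^bsub>C\<^esub> m') t = component k m t \<oplus>\<^bsub>X\<^esub> component k m' t" .
qed

lemma component_hom_right:
  assumes m: "m \<in> carrier C"
  shows "abelian_group_hom S X (\<lambda>t. component k m t)"
proof (intro abelian_group_homI' SG.abelian_group_axioms tensor_group)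
  show "component k m t \<in> carrier X" if "t \<in> carrier S" for t
    using abelian_group_hom.hom_closed[OF component_hom_left m] that by simp
  fix t t' assume t: "t \<in> carrier S" "t' \<in> carrier S"
  have "pure (hcomp C m i) (hcomp S (t \<oplus>\<^bsub>S\<^esub> t') j) =
      pure (hcomp C m i) (hcomp S t j) \<oplus>\<^bsub>X\<^esub> pure (hcomp C m i) (hcomp S t' j)" for i j
    using SG.hcomp_add[OF t] SG.hcomp_carrier[OF t(1)] SG.hcomp_carrier[OF t(2)] m by (simp add: pure_add_right)
  then show "component k m (t \<oplus>\<^bsub>S\<^esub> t') = component k m t \<oplus>\<^bsub>X\<^esub> component k m t'"
    unfolding component_def using m t pure_hcomp_carrier by (simp add: XG.finsum_addf Pi_def)
qed

lemma component_homogeneous: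
  assumes m: "m \<in> grade C i" and t: "t \<in> grade S j"
  shows "component k m t = (if k = i + j then pure m t else \<zero>\<^bsub>X\<^esub>)"
proof -
  have mc: "m \<in> carrier C" "t \<in> mpolys W" using CG.grade_carrier[OF m] SG.grade_carrier[OF t] by auto
  have "{i. hcomp C m i \<noteq> \<zero>\<^bsub>C\<^esub>} \<subseteq> {i}" using m by (auto simp: CG.hcomp_homogeneous)
  then have "component k m t = finsum X (\<lambda>i. pure (hcomp C m i) (hcomp S t (k - i))) {i}"
    using mc by (intro component_superset) auto
  also have "\<dots> = pure m (hcomp S t (k - i))"
    using pure_hcomp_carrier[OF mc, of i "k - i"] by (simp add: CG.hcomp_homogeneous[OF m])
  also have "\<dots> = (if k = i + j then pure m t else \<zero>\<^bsub>X\<^esub>)"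
    using abelian_group_hom.hom_zero[OF pure_hom_right[OF mc(1)]] by (auto simp: SG.hcomp_homogeneous[OF t])
  finally show ?thesis .
qed

lemma C_smult_grade: "r \<in> grade (polyring V) i \<Longrightarrow> m \<in> grade C j \<Longrightarrow> r \<odot>\<^bsub>C\<^esub> m \<in> grade C (i + j)"
  by (rule graded_module_D(4)[OF C_graded])

lemma C_smult_hom_left: "m \<in> carrier C \<Longrightarrow> abelian_group_hom (polyring V) C (\<lambda>r. r \<odot>\<^bsub>C\<^esub> m)"
  using C.smult_l_distr by (intro abelian_group_homI' C.R.abelian_group_axioms C.M.abelian_group_axioms) auto

lemma C_smult_hom_right: "r \<in> mpolys V \<Longrightarrow> abelian_group_hom C C (\<lambda>m. r \<odot>\<^bsub>C\<^esub> m)"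
  using C.smult_r_distr by (intro abelian_group_homI' C.M.abelian_group_axioms) auto

lemma \<sigma>_mult_hom_left: "t \<in> mpolys W \<Longrightarrow> abelian_group_hom (polyring V) S (\<lambda>r. \<sigma> r * t)"
  by (intro abelian_group_homI' C.R.abelian_group_axioms SG.abelian_group_axioms)
     (auto simp: subst_vars_mpolys subst_vars_add distrib_right)

lemma \<sigma>_mult_hom_right: "r \<in> mpolys V \<Longrightarrow> abelian_group_hom S S (\<lambda>t. \<sigma> r * t)"
  by (intro abelian_group_homI' SG.abelian_group_axioms) (auto simp: subst_vars_mpolys distrib_left)

text \<open>For homogeneous r, m and t both sides are concentrated in the sum of the three degrees.
  Additivity in t, m and r, in this order, removes the homogeneity assumptions one at a
  time.\<close>

lemma component_balanced:
  assumes r: "r \<in> mpolys V" and m: "m \<in> carrier C" and t: "t \<in> mpolys W"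
  shows "component k (r \<odot>\<^bsub>C\<^esub> m) t = component k m (\<sigma> r * t)"
proof -
  have 1: "component k (r \<odot>\<^bsub>C\<^esub> m) t = component k m (\<sigma> r * t)"
    if r: "r \<in> grade (polyring V) j" and m: "m \<in> grade C i" and t: "t \<in> grade S l" for r m t i j l
  proof -
    have rc: "r \<in> mpolys V" "m \<in> carrier C" "t \<in> mpolys W"
      using RG.grade_carrier[OF r] CG.grade_carrier[OF m] SG.grade_carrier[OF t] by auto
    have "component k (r \<odot>\<^bsub>C\<^esub> m) t = (if k = j + i + l then pure (r \<odot>\<^bsub>C\<^esub> m) t else \<zero>\<^bsub>X\<^esub>)"
      by (rule component_homogeneous[OF C_smult_grade[OF r m] t])
    also have "\<dots> = (if k = i + (j + l) then pure m (\<sigma> r * t) else \<zero>\<^bsub>X\<^esub>)"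
      using rc by (simp add: pure_balanced)
    also have "\<dots> = component k m (\<sigma> r * t)"
      by (rule component_homogeneous[OF m, symmetric]) (rule polyring_grade_mult[OF subst_vars_grade[OF r] t])
    finally show ?thesis .
  qed
  have 2: "component k (r \<odot>\<^bsub>C\<^esub> m) t = component k m (\<sigma> r * t)"
    if r: "r \<in> grade (polyring V) j" and m: "m \<in> grade C i" and t: "t \<in> mpolys W" for r m t i j
  proof (rule SG.hom_eq_on_grades[where x = t and Y = X])
    have rc: "r \<in> mpolys V" "m \<in> carrier C" using RG.grade_carrier[OF r] CG.grade_carrier[OF m] by auto
    show "abelian_group_hom S X (\<lambda>t. component k (r \<odot>\<^bsub>C\<^esub> m) t)" using rc by (intro component_hom_right) auto
    show "abelian_group_hom S X (\<lambda>t. component k m (\<sigma> r * t))"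
      by (rule abelian_group_hom_comp[OF \<sigma>_mult_hom_right[OF rc(1)] component_hom_right[OF rc(2)]])
  qed (use 1[OF r m] t in auto)
  have 3: "component k (r \<odot>\<^bsub>C\<^esub> m) t = component k m (\<sigma> r * t)"
    if r: "r \<in> grade (polyring V) j" and m: "m \<in> carrier C" and t: "t \<in> mpolys W" for r m t j
  proof (rule CG.hom_eq_on_grades[where x = m and Y = X])
    have rc: "r \<in> mpolys V" "\<sigma> r * t \<in> mpolys W" using RG.grade_carrier[OF r] t by (auto simp: subst_vars_mpolys)
    show "abelian_group_hom C X (\<lambda>m. component k (r \<odot>\<^bsub>C\<^esub> m) t)"
      by (rule abelian_group_hom_comp[OF C_smult_hom_right[OF rc(1)] component_hom_left[OF t]])
    show "abelian_group_hom C X (\<lambda>m. component k m (\<sigma> r * t))" by (rule component_hom_left[OF rc(2)])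
  qed (use 2[OF r _ t] m in auto)
  show ?thesis
  proof (rule RG.hom_eq_on_grades[where x = r and Y = X])
    show "abelian_group_hom (polyring V) X (\<lambda>r. component k (r \<odot>\<^bsub>C\<^esub> m) t)"
      by (rule abelian_group_hom_comp[OF C_smult_hom_left[OF m] component_hom_left[OF t]])
    show "abelian_group_hom (polyring V) X (\<lambda>r. component k m (\<sigma> r * t))"
      by (rule abelian_group_hom_comp[OF \<sigma>_mult_hom_left[OF t] component_hom_right[OF m]])
  qed (use 3[OF _ m t] r in auto)
qed

text \<open>Being balanced and additive in both arguments, \<open>component\<close> descends to
  additive maps of the tensor product, which are the projections that \<open>graded_groupI\<close>
  asks for.\<close>

lemma tensor_graded: "graded_module S X"
proof -
  have "\<exists>f. abelian_group_hom X X f \<and> (\<forall>m\<in>carrier C. \<forall>t\<in>mpolys W. f (pure m t) = component k m t)" for k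
  proof (rule tensor_universal[OF tensor_group])
    show "component k m t \<in> carrier X" if "m \<in> carrier C" "t \<in> mpolys W" for m t
      using abelian_group_hom.hom_closed[OF component_hom_left] that by simp
    show "component k (m \<oplus>\<^bsub>C\<^esub> m') t = component k m t \<oplus>\<^bsub>X\<^esub> component k m' t"
      if "m \<in> carrier C" "m' \<in> carrier C" "t \<in> mpolys W" for m m' t
      using abelian_group_hom.hom_add[OF component_hom_left] that by simp
    show "component k m (t + t') = component k m t \<oplus>\<^bsub>X\<^esub> component k m t'"
      if "m \<in> carrier C" "t \<in> mpolys W" "t' \<in> mpolys W" for m t t'
      using abelian_group_hom.hom_add[OF component_hom_right, of m t t'] that by simp
  qed (rule component_balanced)
  then obtain p where p: "\<And>k. abelian_group_hom X X (p k)"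
    and p_pure: "\<And>k m t. m \<in> carrier C \<Longrightarrow> t \<in> mpolys W \<Longrightarrow> p k (pure m t) = component k m t" by metis
  have gr: "graded_group X"
  proof (rule graded_groupI[where p = p])
    show "abelian_group X" by (rule tensor_group)
    show "additive_subgroup (grade X k) X" for k by (rule tensor_grade_subgroup)
    show "abelian_group_hom X X (p k)" for k by (rule p)
    show "p k x \<in> grade X k" if "x \<in> carrier X" for k x
    proof -
      have "carrier X \<subseteq> {x \<in> carrier X. p k x \<in> grade X k}"
      proof (rule tensor_span[OF additive_subgroup_vimage[OF p tensor_grade_subgroup]])
        fix m and t :: "('v, 'k) mpoly" assume mt: "m \<in> carrier C" "t \<in> mpolys W"
        have "component k m t \<in> grade X k"
          unfolding component_def
        proof (rule additive_subgroup_finsum[OF tensor_group tensor_grade_subgroup])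
          show "pure (hcomp C m i) (hcomp S t (k - i)) \<in> grade X k" for i
            using pure_grade[OF CG.hcomp_props(1)[OF mt(1)] SG.hcomp_props(1), of t i "k - i"] mt(2) by simp
        qed
        then show "pure m t \<in> {x \<in> carrier X. p k x \<in> grade X k}" using mt by (simp add: p_pure)
      qed
      then show ?thesis using that by blast
    qed
    show "p k x = (if k = j then x else \<zero>\<^bsub>X\<^esub>)" if "x \<in> grade X j" for j k x
    proof -
      have hom: "abelian_group_hom X X (\<lambda>x. if k = j then x else \<zero>\<^bsub>X\<^esub>)"
        by (intro abelian_group_homI' tensor_group) auto
      have "grade X j \<subseteq> {x \<in> carrier X. p k x = (if k = j then x else \<zero>\<^bsub>X\<^esub>)}"
      proof (rule tensor_grade_least[OF additive_subgroup_equalizer[OF p hom]])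
        fix i m and t :: "('v, 'k) mpoly" assume mt: "m \<in> grade C i" "t \<in> grade S (j - i)"
        then have "m \<in> carrier C" "t \<in> mpolys W" using CG.grade_carrier[of m] SG.grade_carrier[of t] by auto
        then show "pure m t \<in> {x \<in> carrier X. p k x = (if k = j then x else \<zero>\<^bsub>X\<^esub>)}"
          using component_homogeneous[OF mt, of k] by (simp add: p_pure)
      qed
      then show ?thesis using that by blast
    qed
    fix H assume H: "additive_subgroup H X" and sub: "\<And>k. grade X k \<subseteq> H"
    \<comment> \<open>First t is decomposed while m is homogeneous, and afterwards m.\<close>
    have 1: "pure m t \<in> H" if m: "m \<in> grade C i" and t: "t \<in> mpolys W" for m t i
    proof -
      have "carrier S \<subseteq> {t \<in> carrier S. pure m t \<in> H}"
      proof (rule SG.grade_span[OF additive_subgroup_vimage[OF pure_hom_right[OF CG.grade_carrier[OF m]] H]])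
        show "grade S j \<subseteq> {t \<in> carrier S. pure m t \<in> H}" for j
          using pure_grade[OF m] sub SG.grade_carrier by blast
      qed
      then show ?thesis using t by auto
    qed
    show "carrier X \<subseteq> H"
    proof (rule tensor_span[OF H])
      fix m and t :: "('v, 'k) mpoly" assume m: "m \<in> carrier C" and t: "t \<in> mpolys W"
      have "carrier C \<subseteq> {m \<in> carrier C. pure m t \<in> H}"
        using 1[OF _ t] CG.grade_carrier by (intro CG.grade_span[OF additive_subgroup_vimage[OF pure_hom_left[OF t] H]]) blast
      then show "pure m t \<in> H" using m by auto
    qed
  qed
  have "s \<odot>\<^bsub>X\<^esub> x \<in> grade X (j + k)" if s: "s \<in> grade S j" and x: "x \<in> grade X k" for s x j k
  proof -
    interpret X: module S X by (rule tensor_module)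
    have sc: "s \<in> mpolys W" using SG.grade_carrier[OF s] by simp
    have hom: "abelian_group_hom X X (\<lambda>x. s \<odot>\<^bsub>X\<^esub> x)"
      using X.smult_r_distr X.smult_closed sc by (intro abelian_group_homI' tensor_group) auto
    have "grade X k \<subseteq> {x \<in> carrier X. s \<odot>\<^bsub>X\<^esub> x \<in> grade X (j + k)}"
    proof (rule tensor_grade_least[OF additive_subgroup_vimage[OF hom tensor_grade_subgroup]])
      fix i m and t :: "('v, 'k) mpoly" assume mt: "m \<in> grade C i" "t \<in> grade S (k - i)"
      then have mtc: "m \<in> carrier C" "t \<in> mpolys W" using CG.grade_carrier[of m] SG.grade_carrier[of t] by auto
      have "pure m (s * t) \<in> grade X (i + (j + (k - i)))" by (intro pure_grade polyring_grade_mult mt s)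
      then show "pure m t \<in> {x \<in> carrier X. s \<odot>\<^bsub>X\<^esub> x \<in> grade X (j + k)}"
        using mtc sc by (simp add: smult_pure)
    qed
    then show ?thesis using x by blast
  qed
  then show ?thesis using gr tensor_module by (simp add: graded_module_iff)
qed

end

section \<open>Generators and relations\<close>

definition generates :: "('a, 'a) gmodule \<Rightarrow> ('a, 'b) gmodule \<Rightarrow> 'b set \<Rightarrow> bool" where
  "generates R M B \<longleftrightarrow> (\<forall>H. submodule H R M \<longrightarrow> B \<subseteq> H \<longrightarrow> carrier M \<subseteq> H)"

lemma generatesI: "submodule_generated R M B = carrier M \<Longrightarrow> generates R M B"
  by (auto simp: generates_def submodule_generated_def)

lemma generatesD: "generates R M B \<Longrightarrow> submodule H R M \<Longrightarrow> B \<subseteq> H \<Longrightarrow> carrier M \<subseteq> H"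
  by (simp add: generates_def)

lemma submodule_additive_subgroup: "submodule H R M \<Longrightarrow> additive_subgroup H M"
  by (simp add: submodule_def additive_subgroup_def)

lemma submoduleI': "additive_subgroup H M \<Longrightarrow> (\<And>r x. r \<in> carrier R \<Longrightarrow> x \<in> H \<Longrightarrow> r \<odot>\<^bsub>M\<^esub> x \<in> H) \<Longrightarrow> submodule H R M"
  by (simp add: submodule_def submodule_axioms_def additive_subgroup_def)

lemma mod_homs_hom:
  assumes "f \<in> mod_homs R M N" "abelian_group M" "abelian_group N"
  shows "abelian_group_hom M N f"
  using assms by (intro abelian_group_homI') (auto simp: mod_homs_def)

lemma mod_homsI:
  assumes "abelian_group_hom M N f" "\<And>r x. r \<in> carrier R \<Longrightarrow> x \<in> carrier M \<Longrightarrow> f (r \<odot>\<^bsub>M\<^esub> x) = r \<odot>\<^bsub>N\<^esub> f x"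
  shows "f \<in> mod_homs R M N"
proof -
  interpret abelian_group_hom M N f by fact
  show ?thesis using assms(2) by (auto simp: mod_homs_def)
qed

lemma mod_homs_smult: "f \<in> mod_homs R M N \<Longrightarrow> r \<in> carrier R \<Longrightarrow> x \<in> carrier M \<Longrightarrow> f (r \<odot>\<^bsub>M\<^esub> x) = r \<odot>\<^bsub>N\<^esub> f x"
  by (simp add: mod_homs_def)

lemma equalizer_submodule:
  assumes "module R M" "module R N" and f: "f \<in> mod_homs R M N" and g: "g \<in> mod_homs R M N"
  shows "submodule {x \<in> carrier M. f x = g x} R M"
proof -
  interpret M: module R M by fact
  interpret N: module R N by fact
  note hom = mod_homs_hom[OF _ M.M.abelian_group_axioms N.M.abelian_group_axioms]
  show ?thesis
    using additive_subgroup_equalizer[OF hom[OF f] hom[OF g]]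
    by (rule submoduleI') (auto simp: mod_homs_smult[OF f] mod_homs_smult[OF g])
qed

lemma image_submodule:
  assumes "module R M" "module R N" and f: "f \<in> mod_homs R M N"
  shows "submodule (f ` carrier M) R N"
proof -
  interpret M: module R M by fact
  interpret N: module R N by fact
  interpret f: abelian_group_hom M N f
    by (rule mod_homs_hom[OF f M.M.abelian_group_axioms N.M.abelian_group_axioms])
  have "additive_subgroup (carrier M) M" by (intro M.M.additive_subgroupI') auto
  from additive_subgroup_image[OF f.abelian_group_hom_axioms this] show ?thesis
    by (rule submoduleI') (auto simp flip: mod_homs_smult[OF f])
qed

lemma mod_homs_eq_on_generators:
  assumes "module R M" "module R N" "f \<in> mod_homs R M N" "g \<in> mod_homs R M N"
    and "generates R M B" "\<And>x. x \<in> B \<Longrightarrow> x \<in> carrier M \<and> f x = g x" "x \<in> carrier M"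
  shows "f x = g x"
  using generatesD[OF assms(5) equalizer_submodule[OF assms(1-4)]] assms(6,7) by blast

text \<open>Homogeneous elements do not form a submodule, so the claim is proved for all elements at
  once: those whose components are all shifted correctly form a submodule, and it contains the
  generators.\<close>

lemma graded_hom_from_generators:
  fixes R :: "('a, 'a) gmodule"
  assumes R: "graded_group R" and M: "graded_module R M" and N: "graded_module R N"
    and f: "f \<in> mod_homs R M N" and gen: "generates R M B"
    and B: "\<And>x. x \<in> B \<Longrightarrow> x \<in> grade M d \<and> f x \<in> grade N (d + s)"
    and x: "x \<in> grade M k"
  shows "f x \<in> grade N (k + s)"
proof -
  interpret M: module R M using graded_module_D(1)[OF M] .
  interpret N: module R N using graded_module_D(1)[OF N] .
  interpret RG: graded_grp R using graded_grpI[OF R] .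
  interpret MG: graded_grp M using graded_module_D(2)[OF M] .
  interpret NG: graded_grp N using graded_module_D(2)[OF N] .
  interpret f: abelian_group_hom M N f
    by (rule mod_homs_hom[OF f M.M.abelian_group_axioms N.M.abelian_group_axioms])
  define H where "H = {x \<in> carrier M. \<forall>k. f (hcomp M x k) \<in> grade N (k + s)}"
  have closed: "a \<oplus>\<^bsub>N\<^esub> b \<in> grade N k" if "a \<in> grade N k" "b \<in> grade N k" for a b k
    using additive_subgroup.a_closed[OF NG.grade_subgroup that] .
  have H: "additive_subgroup H M"
  proof (rule M.M.additive_subgroupI')
    show "\<zero>\<^bsub>M\<^esub> \<in> H"
      using MG.hcomp_homogeneous[OF MG.grade_zero] by (simp add: H_def)
    show "\<ominus>\<^bsub>M\<^esub> x \<in> H" if "x \<in> H" for x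
      using that abelian_group_hom.hom_a_inv[OF MG.hcomp_hom] additive_subgroup.a_inv_closed[OF NG.grade_subgroup]
      by (simp add: H_def)
  qed (auto simp: H_def MG.hcomp_add closed)
  have "submodule H R M"
  proof (rule submoduleI'[OF H])
    fix r x assume r: "r \<in> carrier R" and x: "x \<in> H"
    then have xc: "x \<in> carrier M" by (simp add: H_def)
    have "abelian_group_hom R M (\<lambda>r. r \<odot>\<^bsub>M\<^esub> x)"
      using M.smult_l_distr xc by (intro abelian_group_homI' M.R.abelian_group_axioms M.M.abelian_group_axioms) auto
    \<comment> \<open>By additivity in r only homogeneous scalars have to be considered.\<close>
    from additive_subgroup_vimage[OF this H] have "carrier R \<subseteq> {r \<in> carrier R. r \<odot>\<^bsub>M\<^esub> x \<in> H}"
    proof (rule RG.grade_span)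
      fix j show "grade R j \<subseteq> {r \<in> carrier R. r \<odot>\<^bsub>M\<^esub> x \<in> H}"
      proof
        fix r assume r: "r \<in> grade R j"
        then have rc: "r \<in> carrier R" by (rule RG.grade_carrier)
        \<comment> \<open>For r of degree j, the component of r x in degree k is r times the
          component of x in degree k - j.\<close>
        let ?K = "{k. hcomp M x k \<noteq> \<zero>\<^bsub>M\<^esub>}" and ?c = "\<lambda>k. r \<odot>\<^bsub>M\<^esub> hcomp M x (k - j)"
        have fin: "finite ?K" by (rule MG.hcomp_props(2)[OF xc])
        have "x = finsum M (hcomp M x) ?K" by (rule MG.hcomp_props(3)[OF xc])
        then have "r \<odot>\<^bsub>M\<^esub> x = r \<odot>\<^bsub>M\<^esub> finsum M (hcomp M x) ?K" by (rule arg_cong)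
        also have "\<dots> = finsum M (\<lambda>k. r \<odot>\<^bsub>M\<^esub> hcomp M x k) ?K"
          using fin rc xc by (intro M.finsum_smult_ldistr) auto
        also have "\<dots> = finsum M (\<lambda>k. ?c (k + j)) ?K" by simp
        also have "\<dots> = finsum M ?c ((\<lambda>k. k + j) ` ?K)"
          using rc xc by (intro M.M.finsum_reindex[symmetric]) (auto simp: inj_on_def)
        finally have eq: "r \<odot>\<^bsub>M\<^esub> x = finsum M ?c ((\<lambda>k. k + j) ` ?K)" .
        have "hcomp M (r \<odot>\<^bsub>M\<^esub> x) = ?c"
          unfolding eq
        proof (rule MG.hcomp_unique)
          show "?c k \<in> grade M k" for k
            using graded_module_D(4)[OF M r MG.hcomp_props(1)[OF xc], of "k - j"] by simp
          show "?c k = \<zero>\<^bsub>M\<^esub>" if "k \<notin> (\<lambda>k. k + j) ` ?K" for k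
          proof -
            have "hcomp M x (k - j) = \<zero>\<^bsub>M\<^esub>" using that by (force simp: image_iff)
            then show ?thesis using rc by simp
          qed
        qed (use fin in simp)
        moreover have "f (?c k) \<in> grade N (k + s)" for k
        proof -
          have "f (hcomp M x (k - j)) \<in> grade N (k - j + s)" using x by (simp add: H_def)
          from graded_module_D(4)[OF N r this] show ?thesis
            using rc xc by (simp add: mod_homs_smult[OF f])
        qed
        ultimately have "f (hcomp M (r \<odot>\<^bsub>M\<^esub> x) k) \<in> grade N (k + s)" for k by simp
        then show "r \<in> {r \<in> carrier R. r \<odot>\<^bsub>M\<^esub> x \<in> H}" using rc xc by (simp add: H_def)
      qed
    qed
    then show "r \<odot>\<^bsub>M\<^esub> x \<in> H" using r by blast
  qed
  moreover have "B \<subseteq> H"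
  proof
    fix x assume "x \<in> B"
    then have x: "x \<in> grade M d" "f x \<in> grade N (d + s)" using B by auto
    then have "f (hcomp M x k) \<in> grade N (k + s)" for k by (simp add: MG.hcomp_homogeneous[OF x(1)])
    then show "x \<in> H" using MG.grade_carrier[OF x(1)] by (simp add: H_def)
  qed
  ultimately have "x \<in> H" using generatesD[OF gen] MG.grade_carrier[OF x] by blast
  then have "f (hcomp M x k) \<in> grade N (k + s)" by (simp add: H_def)
  then show ?thesis by (simp add: MG.hcomp_homogeneous[OF x])
qed

section \<open>Linear combinations and maps out of a presentation\<close>

lemma free_gmod_simps [simp]:
  "carrier (free_gmod R I d) = {a. (\<forall>i\<in>I. a i \<in> carrier R) \<and> (\<forall>i. i \<notin> I \<longrightarrow> a i = \<zero>\<^bsub>R\<^esub>)}"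
  "\<zero>\<^bsub>free_gmod R I d\<^esub> = (\<lambda>_. \<zero>\<^bsub>R\<^esub>)" "a \<oplus>\<^bsub>free_gmod R I d\<^esub> b = (\<lambda>i. a i \<oplus>\<^bsub>R\<^esub> b i)"
  "r \<odot>\<^bsub>free_gmod R I d\<^esub> a = (\<lambda>i. r \<otimes>\<^bsub>R\<^esub> a i)"
  by (simp_all add: free_gmod_def)

lemma free_gmod_group:
  "abelian_group (free_gmod (polyring V :: (('v, 'k::field) mpoly, ('v, 'k) mpoly) gmodule) I d)"
proof (intro abelian_groupI)
  fix a assume "a \<in> carrier (free_gmod (polyring V :: (('v, 'k) mpoly, ('v, 'k) mpoly) gmodule) I d)"
  then show "\<exists>b\<in>carrier (free_gmod (polyring V) I d).
      b \<oplus>\<^bsub>free_gmod (polyring V) I d\<^esub> a = \<zero>\<^bsub>free_gmod (polyring V) I d\<^esub>"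
    by (intro bexI[of _ "\<lambda>i. - a i"]) auto
qed (auto simp: algebra_simps)

text \<open>Evaluates a coefficient vector after transport by \<tau>. With \<tau> the identity this
  is the map that defines the presentation, and with \<tau> the substitution \<sigma> it is the
  corresponding map after extension of scalars.\<close>

locale lin_comb =
  fixes V :: "'v set" and U :: "'v set" and \<tau> :: "('v, 'k::field) mpoly \<Rightarrow> ('v, 'k) mpoly"
    and M :: "(('v, 'k) mpoly, 'c) gmodule" and I :: "'i set" and q :: "'i \<Rightarrow> 'c" and d :: "'i \<Rightarrow> int"
  assumes M: "module (polyring U) M" and I: "finite I" and q: "\<And>i. i \<in> I \<Longrightarrow> q i \<in> carrier M"
    and \<tau>_carrier: "\<And>p. p \<in> mpolys V \<Longrightarrow> \<tau> p \<in> mpolys U" and \<tau>_add: "\<And>p q. \<tau> (p + q) = \<tau> p + \<tau> q"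
    and \<tau>_mult: "\<And>p q. \<tau> (p * q) = \<tau> p * \<tau> q"
begin

sublocale M: module "polyring U" M by (rule M)

abbreviation "F \<equiv> free_gmod (polyring V :: (('v, 'k) mpoly, ('v, 'k) mpoly) gmodule) I d"

definition comb :: "('i \<Rightarrow> ('v, 'k) mpoly) \<Rightarrow> 'c" where
  "comb a = finsum M (\<lambda>i. \<tau> (a i) \<odot>\<^bsub>M\<^esub> q i) I"

lemma comb_hom: "abelian_group_hom F M comb"
proof (intro abelian_group_homI' free_gmod_group M.M.abelian_group_axioms)
  show "comb a \<in> carrier M" if "a \<in> carrier F" for a
    using that q \<tau>_carrier unfolding comb_def by (intro M.M.finsum_closed) auto
  fix a b assume ab: "a \<in> carrier F" "b \<in> carrier F"
  have "comb (a \<oplus>\<^bsub>F\<^esub> b) = finsum M (\<lambda>i. \<tau> (a i) \<odot>\<^bsub>M\<^esub> q i \<oplus>\<^bsub>M\<^esub> \<tau> (b i) \<odot>\<^bsub>M\<^esub> q i) I"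
    unfolding comb_def using ab q \<tau>_carrier M.smult_l_distr
    by (intro M.M.finsum_cong') (auto simp: \<tau>_add)
  also have "\<dots> = comb a \<oplus>\<^bsub>M\<^esub> comb b"
    unfolding comb_def using ab q \<tau>_carrier by (intro M.M.finsum_addf) auto
  finally show "comb (a \<oplus>\<^bsub>F\<^esub> b) = comb a \<oplus>\<^bsub>M\<^esub> comb b" .
qed

lemma comb_smult:
  assumes a: "a \<in> carrier F" and r: "r \<in> mpolys V"
  shows "comb (r \<odot>\<^bsub>F\<^esub> a) = \<tau> r \<odot>\<^bsub>M\<^esub> comb a"
proof -
  have "comb (r \<odot>\<^bsub>F\<^esub> a) = finsum M (\<lambda>i. \<tau> r \<odot>\<^bsub>M\<^esub> (\<tau> (a i) \<odot>\<^bsub>M\<^esub> q i)) I"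
    unfolding comb_def using a r q \<tau>_carrier M.smult_assoc1[of "\<tau> r"]
    by (intro M.M.finsum_cong') (auto simp: \<tau>_mult)
  also have "\<dots> = \<tau> r \<odot>\<^bsub>M\<^esub> comb a"
    unfolding comb_def using a r q \<tau>_carrier by (intro M.finsum_smult_ldistr[symmetric] I) auto
  finally show ?thesis .
qed

lemma F_smult_closed: "a \<in> carrier F \<Longrightarrow> r \<in> mpolys V \<Longrightarrow> r \<odot>\<^bsub>F\<^esub> a \<in> carrier F"
  by auto

lemma comb_kernel_submodule: "submodule {a \<in> carrier F. comb a = \<zero>\<^bsub>M\<^esub>} (polyring V) F"
proof (rule submoduleI')
  have "abelian_group_hom F M (\<lambda>_. \<zero>\<^bsub>M\<^esub>)"
    by (intro abelian_group_homI' free_gmod_group M.M.abelian_group_axioms) auto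
  from additive_subgroup_equalizer[OF comb_hom this]
  show "additive_subgroup {a \<in> carrier F. comb a = \<zero>\<^bsub>M\<^esub>} F" .
  show "r \<odot>\<^bsub>F\<^esub> a \<in> {a \<in> carrier F. comb a = \<zero>\<^bsub>M\<^esub>}"
    if "r \<in> carrier (polyring V)" "a \<in> {a \<in> carrier F. comb a = \<zero>\<^bsub>M\<^esub>}" for r a
  proof -
    have a: "a \<in> carrier F" "comb a = \<zero>\<^bsub>M\<^esub>" and r: "r \<in> mpolys V" using that by auto
    then have "comb (r \<odot>\<^bsub>F\<^esub> a) = \<zero>\<^bsub>M\<^esub>" using \<tau>_carrier[OF r] by (simp only: comb_smult) simp
    then show ?thesis using F_smult_closed[OF a(1) r] by blast
  qed
qed

lemma \<tau>_0: "\<tau> 0 = 0"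
  using \<tau>_add[of 0 0] by simp

lemma single_term:
  assumes "i \<in> I" "p \<in> mpolys V"
  shows "comb (\<lambda>k. if k = i then p else 0) = \<tau> p \<odot>\<^bsub>M\<^esub> q i"
proof -
  have null: "0 \<odot>\<^bsub>M\<^esub> x = \<zero>\<^bsub>M\<^esub>" if "x \<in> carrier M" for x using M.smult_l_null[OF that] by simp
  have "comb (\<lambda>k. if k = i then p else 0) = finsum M (\<lambda>k. if i = k then \<tau> p \<odot>\<^bsub>M\<^esub> q k else \<zero>\<^bsub>M\<^esub>) I"
    unfolding comb_def using assms q \<tau>_carrier by (intro M.M.finsum_cong') (auto simp: \<tau>_0 null)
  also have "\<dots> = \<tau> p \<odot>\<^bsub>M\<^esub> q i"
    using assms q \<tau>_carrier I by (intro M.M.finsum_singleton) auto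
  finally show ?thesis .
qed

text \<open>The shape of \<open>orientation_relation\<close>, including the case i = j in which both
  coefficients fall on one generator.\<close>

lemma two_terms:
  assumes "i \<in> I" "j \<in> I" "p \<in> mpolys V" "r \<in> mpolys V"
  shows "comb (\<lambda>k. (if k = i then p else 0) + (if k = j then r else 0)) = \<tau> p \<odot>\<^bsub>M\<^esub> q i \<oplus>\<^bsub>M\<^esub> \<tau> r \<odot>\<^bsub>M\<^esub> q j"
  using abelian_group_hom.hom_add[OF comb_hom, of "\<lambda>k. if k = i then p else 0" "\<lambda>k. if k = j then r else 0"] assms
  by (auto simp: single_term)

end

text \<open>The elements m for which m tensor t lies in H for every t form a submodule by balancing,
  and they include B because m tensor t is t times (m tensor 1).\<close>

lemma (in merged_tensor) tensor_generated:
  assumes gen: "generates (polyring V) C B" and B: "B \<subseteq> carrier C"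
  shows "generates S X ((\<lambda>m. pure m 1) ` B)"
  unfolding generates_def
proof (intro allI impI)
  fix H assume H: "submodule H S X" and BH: "(\<lambda>m. pure m 1) ` B \<subseteq> H"
  interpret H: submodule H S X by (rule H)
  have Hsub: "additive_subgroup H X" by (rule submodule_additive_subgroup[OF H])
  interpret HA: additive_subgroup H X by (rule Hsub)
  have zero: "pure \<zero>\<^bsub>C\<^esub> t = \<zero>\<^bsub>X\<^esub>" "pure (\<ominus>\<^bsub>C\<^esub> m) t = \<ominus>\<^bsub>X\<^esub> pure m t"
    if "t \<in> mpolys W" "m \<in> carrier C" for t m
  proof -
    interpret h: abelian_group_hom C X "\<lambda>m. pure m t"
      using that by (intro abelian_group_homI' C.M.abelian_group_axioms tensor_group) (auto simp: pure_add_left)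
    show "pure \<zero>\<^bsub>C\<^esub> t = \<zero>\<^bsub>X\<^esub>" by simp
    show "pure (\<ominus>\<^bsub>C\<^esub> m) t = \<ominus>\<^bsub>X\<^esub> pure m t" using that(2) by simp
  qed
  let ?L = "{m \<in> carrier C. \<forall>t\<in>mpolys W. pure m t \<in> H}"
  have "submodule ?L (polyring V) C"
  proof (rule submoduleI'[OF C.M.additive_subgroupI'])
    show "\<zero>\<^bsub>C\<^esub> \<in> ?L" using zero(1)[OF _ C.M.zero_closed] HA.zero_closed by simp
    show "\<ominus>\<^bsub>C\<^esub> m \<in> ?L" if "m \<in> ?L" for m using that zero by simp
    show "m \<oplus>\<^bsub>C\<^esub> m' \<in> ?L" if "m \<in> ?L" "m' \<in> ?L" for m m'
      using that by (simp add: pure_add_left)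
    show "r \<odot>\<^bsub>C\<^esub> m \<in> ?L" if "r \<in> carrier (polyring V)" "m \<in> ?L" for r m
      using that by (simp add: pure_balanced subst_vars_mpolys)
  qed simp
  moreover have "B \<subseteq> ?L"
  proof
    fix m assume m: "m \<in> B"
    then have mc: "m \<in> carrier C" using B by blast
    have "pure m t \<in> H" if t: "t \<in> mpolys W" for t
    proof -
      have "t \<odot>\<^bsub>X\<^esub> pure m 1 \<in> H" using m BH t by (intro H.smult_closed) auto
      then show ?thesis using smult_pure[OF t mc, of 1] by simp
    qed
    then show "m \<in> ?L" using mc by simp
  qed
  ultimately have "carrier C \<subseteq> ?L" by (rule generatesD[OF gen])
  then show "carrier X \<subseteq> H" by (intro tensor_span[OF Hsub]) blast
qed

text \<open>Universal property of a presentation after extension of scalars. Writing m as a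
  combination of generators gives a \<sigma>-semilinear map \<theta> from C to Y, well defined
  because the relations are killed in Y; then m tensor t is sent to t times \<theta> m.\<close>

lemma (in merged_tensor) tensor_lift:
  fixes Y :: "(('v, 'k) mpoly, 'y) gmodule" and d :: "'i \<Rightarrow> int"
  assumes I: "finite I" and g: "\<And>i. i \<in> I \<Longrightarrow> g i \<in> carrier C" and gen: "generates (polyring V) C (g ` I)"
    and ker: "{a \<in> carrier (free_gmod (polyring V) I d). (\<Oplus>\<^bsub>C\<^esub>i\<in>I. a i \<odot>\<^bsub>C\<^esub> g i) = \<zero>\<^bsub>C\<^esub>} =
      submodule_generated (polyring V) (free_gmod (polyring V) I d) Rel"
    and Y: "module S Y" and q: "\<And>i. i \<in> I \<Longrightarrow> q i \<in> carrier Y"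
    and Rel: "\<And>a. a \<in> Rel \<Longrightarrow> a \<in> carrier (free_gmod (polyring V) I d) \<and>
      (\<Oplus>\<^bsub>Y\<^esub>i\<in>I. \<sigma> (a i) \<odot>\<^bsub>Y\<^esub> q i) = \<zero>\<^bsub>Y\<^esub>"
  shows "\<exists>f\<in>mod_homs S X Y. \<forall>i\<in>I. f (pure (g i) 1) = q i"
proof -
  interpret Y: module S Y by (rule Y)
  interpret XM: module S X by (rule tensor_module)
  interpret \<Gamma>: lin_comb V V "\<lambda>p. p" C I g d
    by unfold_locales (use I g in auto)
  interpret \<Theta>: lin_comb V W \<sigma> Y I q d
    by (intro lin_comb.intro Y I q) (auto simp: subst_vars_mpolys subst_vars_add subst_vars_mult)
  let ?F = "free_gmod (polyring V :: (('v, 'k) mpoly, ('v, 'k) mpoly) gmodule) I d"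
  interpret G: abelian_group_hom ?F C \<Gamma>.comb by (rule \<Gamma>.comb_hom)
  interpret T: abelian_group_hom ?F Y \<Theta>.comb by (rule \<Theta>.comb_hom)
  have "Rel \<subseteq> {a \<in> carrier ?F. \<Theta>.comb a = \<zero>\<^bsub>Y\<^esub>}" using Rel unfolding \<Theta>.comb_def by blast
  then have "submodule_generated (polyring V) ?F Rel \<subseteq> {a \<in> carrier ?F. \<Theta>.comb a = \<zero>\<^bsub>Y\<^esub>}"
    unfolding submodule_generated_def by (intro Inter_lower CollectI conjI \<Theta>.comb_kernel_submodule)
  moreover have "{a \<in> carrier ?F. \<Gamma>.comb a = \<zero>\<^bsub>C\<^esub>} = submodule_generated (polyring V) ?F Rel"
    using ker by (simp only: \<Gamma>.comb_def)
  ultimately have "{a \<in> carrier ?F. \<Gamma>.comb a = \<zero>\<^bsub>C\<^esub>} \<subseteq> {a \<in> carrier ?F. \<Theta>.comb a = \<zero>\<^bsub>Y\<^esub>}" by (simp only:)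
  then have kern: "\<Theta>.comb a = \<zero>\<^bsub>Y\<^esub>" if "a \<in> carrier ?F" "\<Gamma>.comb a = \<zero>\<^bsub>C\<^esub>" for a
    using that by (simp only: subset_iff mem_Collect_eq)
  have unit: "(\<lambda>k. if k = i then 1 else 0) \<in> carrier ?F" if "i \<in> I" for i using that by auto
  have unitG: "\<Gamma>.comb (\<lambda>k. if k = i then 1 else 0) = g i" if "i \<in> I" for i
    using \<Gamma>.single_term[OF that mpolys_1] g[OF that] C.smult_one[of "g i"] by simp
  have unitT: "\<Theta>.comb (\<lambda>k. if k = i then 1 else 0) = q i" if "i \<in> I" for i
    using \<Theta>.single_term[OF that mpolys_1] q[OF that] Y.smult_one[of "q i"] by simp
  have "submodule (\<Gamma>.comb ` carrier ?F) (polyring V) C"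
  proof (rule submoduleI')
    have "additive_subgroup (carrier ?F) ?F"
      by (intro G.G.additive_subgroupI' subset_refl G.G.zero_closed G.G.a_closed G.G.a_inv_closed)
    from additive_subgroup_image[OF \<Gamma>.comb_hom this] show "additive_subgroup (\<Gamma>.comb ` carrier ?F) C" .
    show "r \<odot>\<^bsub>C\<^esub> x \<in> \<Gamma>.comb ` carrier ?F" if r: "r \<in> carrier (polyring V)" and x: "x \<in> \<Gamma>.comb ` carrier ?F" for r x
    proof -
      obtain a where a: "a \<in> carrier ?F" "x = \<Gamma>.comb a" using x by blast
      have r': "r \<in> mpolys V" using r by simp
      have "r \<odot>\<^bsub>C\<^esub> x = \<Gamma>.comb (r \<odot>\<^bsub>?F\<^esub> a)" unfolding a(2) by (rule \<Gamma>.comb_smult[OF a(1) r', symmetric])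
      then show ?thesis using \<Gamma>.F_smult_closed[OF a(1) r'] by blast
    qed
  qed
  moreover have "g ` I \<subseteq> \<Gamma>.comb ` carrier ?F" using unit unitG[symmetric] by blast
  ultimately have surj: "carrier C \<subseteq> \<Gamma>.comb ` carrier ?F" by (rule generatesD[OF gen])
  have pre: "\<exists>a. a \<in> carrier ?F \<and> m = \<Gamma>.comb a" if "m \<in> carrier C" for m
    using subsetD[OF surj that] by (simp only: image_iff Bex_def)
  define \<theta> where "\<theta> m = \<Theta>.comb (SOME a. a \<in> carrier ?F \<and> \<Gamma>.comb a = m)" for m
  \<comment> \<open>Two coefficient vectors of one element differ by a relation, so the chosen
    vector can be replaced by any other.\<close>
  have \<theta>: "\<theta> (\<Gamma>.comb a) = \<Theta>.comb a" if a: "a \<in> carrier ?F" for a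
  proof -
    define b where "b = (SOME b. b \<in> carrier ?F \<and> \<Gamma>.comb b = \<Gamma>.comb a)"
    have b: "b \<in> carrier ?F \<and> \<Gamma>.comb b = \<Gamma>.comb a"
      unfolding b_def by (rule someI[of _ a]) (use a in blast)
    have bc: "b \<in> carrier ?F" and na: "\<ominus>\<^bsub>?F\<^esub> a \<in> carrier ?F" using b G.G.a_inv_closed[OF a] by blast+
    note ab = G.G.a_closed[OF bc na]
    have "\<Gamma>.comb (b \<oplus>\<^bsub>?F\<^esub> \<ominus>\<^bsub>?F\<^esub> a) = \<Gamma>.comb b \<oplus>\<^bsub>C\<^esub> \<ominus>\<^bsub>C\<^esub> \<Gamma>.comb a"
      by (simp only: G.hom_add[OF bc na] G.hom_a_inv[OF a])
    also have "\<dots> = \<zero>\<^bsub>C\<^esub>" using b G.hom_closed[OF a] C.M.r_neg by simp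
    finally have "\<Theta>.comb (b \<oplus>\<^bsub>?F\<^esub> \<ominus>\<^bsub>?F\<^esub> a) = \<zero>\<^bsub>Y\<^esub>" by (rule kern[OF ab])
    then have "\<Theta>.comb b \<oplus>\<^bsub>Y\<^esub> \<ominus>\<^bsub>Y\<^esub> \<Theta>.comb a = \<zero>\<^bsub>Y\<^esub>"
      by (simp only: T.hom_add[OF bc na] T.hom_a_inv[OF a])
    then have "\<Theta>.comb b = \<Theta>.comb a"
      using Y.M.minus_equality[of "\<Theta>.comb b" "\<ominus>\<^bsub>Y\<^esub> \<Theta>.comb a"] T.hom_closed[OF a] T.hom_closed[OF bc] by simp
    then show ?thesis by (simp add: \<theta>_def b_def)
  qed
  have \<theta>_carrier: "\<theta> m \<in> carrier Y" if m: "m \<in> carrier C" for m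
  proof -
    obtain a where a: "a \<in> carrier ?F" "m = \<Gamma>.comb a" using pre[OF m] by (elim exE conjE)
    show ?thesis unfolding a(2) \<theta>[OF a(1)] by (rule T.hom_closed[OF a(1)])
  qed
  have \<theta>_add: "\<theta> (m \<oplus>\<^bsub>C\<^esub> m') = \<theta> m \<oplus>\<^bsub>Y\<^esub> \<theta> m'" if m: "m \<in> carrier C" "m' \<in> carrier C" for m m'
  proof -
    obtain a where a0: "a \<in> carrier ?F" "m = \<Gamma>.comb a" using pre[OF m(1)] by (elim exE conjE)
    obtain a' where a'0: "a' \<in> carrier ?F" "m' = \<Gamma>.comb a'" using pre[OF m(2)] by (elim exE conjE)
    note a = a0 a'0
    show ?thesis
      unfolding a(2,4) G.hom_add[OF a(1,3), symmetric] \<theta>[OF G.G.a_closed[OF a(1,3)]] \<theta>[OF a(1)] \<theta>[OF a(3)]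
      by (rule T.hom_add[OF a(1,3)])
  qed
  have \<theta>_smult: "\<theta> (r \<odot>\<^bsub>C\<^esub> m) = \<sigma> r \<odot>\<^bsub>Y\<^esub> \<theta> m" if m: "m \<in> carrier C" and r: "r \<in> mpolys V" for r m
  proof -
    obtain a where a: "a \<in> carrier ?F" "m = \<Gamma>.comb a" using pre[OF m] by (elim exE conjE)
    show ?thesis
      unfolding a(2) \<Gamma>.comb_smult[OF a(1) r, symmetric] \<theta>[OF \<Gamma>.F_smult_closed[OF a(1) r]] \<theta>[OF a(1)]
      by (rule \<Theta>.comb_smult[OF a(1) r])
  qed
  have "\<exists>f. abelian_group_hom X Y f \<and> (\<forall>m\<in>carrier C. \<forall>t\<in>mpolys W. f (pure m t) = t \<odot>\<^bsub>Y\<^esub> \<theta> m)"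
  proof (rule tensor_universal[OF Y.M.abelian_group_axioms])
    show "t \<odot>\<^bsub>Y\<^esub> \<theta> m \<in> carrier Y" if "m \<in> carrier C" "t \<in> mpolys W" for m t
      using that \<theta>_carrier by simp
    show "t \<odot>\<^bsub>Y\<^esub> \<theta> (m \<oplus>\<^bsub>C\<^esub> m') = t \<odot>\<^bsub>Y\<^esub> \<theta> m \<oplus>\<^bsub>Y\<^esub> t \<odot>\<^bsub>Y\<^esub> \<theta> m'"
      if "m \<in> carrier C" "m' \<in> carrier C" "t \<in> mpolys W" for m m' t
      using that \<theta>_carrier Y.smult_r_distr by (simp add: \<theta>_add)
    show "(t + t') \<odot>\<^bsub>Y\<^esub> \<theta> m = t \<odot>\<^bsub>Y\<^esub> \<theta> m \<oplus>\<^bsub>Y\<^esub> t' \<odot>\<^bsub>Y\<^esub> \<theta> m"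
      if "m \<in> carrier C" "t \<in> mpolys W" "t' \<in> mpolys W" for m t t'
      using that \<theta>_carrier[OF that(1)] Y.smult_l_distr[of t t' "\<theta> m"] by simp
    show "t \<odot>\<^bsub>Y\<^esub> \<theta> (r \<odot>\<^bsub>C\<^esub> m) = (\<sigma> r * t) \<odot>\<^bsub>Y\<^esub> \<theta> m"
      if "r \<in> mpolys V" "m \<in> carrier C" "t \<in> mpolys W" for r m t
      using that \<theta>_carrier[OF that(2)] Y.smult_assoc1[of t "\<sigma> r" "\<theta> m"]
      by (simp add: \<theta>_smult subst_vars_mpolys mult.commute)
  qed
  then obtain f where f: "abelian_group_hom X Y f"
    and f_pure: "\<And>m t. m \<in> carrier C \<Longrightarrow> t \<in> mpolys W \<Longrightarrow> f (pure m t) = t \<odot>\<^bsub>Y\<^esub> \<theta> m" by blast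
  have "f \<in> mod_homs S X Y"
  proof (rule mod_homsI[OF f])
    fix s x assume s: "s \<in> carrier S" and x: "x \<in> carrier X"
    have hX: "abelian_group_hom X X (\<lambda>x. s \<odot>\<^bsub>X\<^esub> x)"
      using XM.smult_r_distr XM.smult_closed s by (intro abelian_group_homI' tensor_group) auto
    have hY: "abelian_group_hom Y Y (\<lambda>x. s \<odot>\<^bsub>Y\<^esub> x)"
      using Y.smult_r_distr Y.smult_closed s by (intro abelian_group_homI' Y.M.abelian_group_axioms) auto
    have "carrier X \<subseteq> {x \<in> carrier X. f (s \<odot>\<^bsub>X\<^esub> x) = s \<odot>\<^bsub>Y\<^esub> f x}"
    proof (rule tensor_span[OF additive_subgroup_equalizer[OF abelian_group_hom_comp[OF hX f] abelian_group_hom_comp[OF f hY]]])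
      fix m and t :: "('v, 'k) mpoly" assume mt: "m \<in> carrier C" "t \<in> mpolys W"
      have "f (s \<odot>\<^bsub>X\<^esub> pure m t) = (s * t) \<odot>\<^bsub>Y\<^esub> \<theta> m" using mt s by (simp add: smult_pure f_pure)
      also have "\<dots> = s \<odot>\<^bsub>Y\<^esub> f (pure m t)"
        using mt s \<theta>_carrier Y.smult_assoc1[of s t "\<theta> m"] by (simp add: f_pure)
      finally show "pure m t \<in> {x \<in> carrier X. f (s \<odot>\<^bsub>X\<^esub> x) = s \<odot>\<^bsub>Y\<^esub> f x}" using mt by simp
    qed
    then show "f (s \<odot>\<^bsub>X\<^esub> x) = s \<odot>\<^bsub>Y\<^esub> f x" using x by blast
  qed
  moreover have "f (pure (g i) 1) = q i" if "i \<in> I" for i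
  proof -
    have "f (pure (g i) 1) = 1 \<odot>\<^bsub>Y\<^esub> \<theta> (g i)" using g[OF that] by (simp add: f_pure)
    also have "\<theta> (g i) = q i" using \<theta>[OF unit[OF that]] unitG[OF that] unitT[OF that] by simp
    finally show ?thesis using q[OF that] Y.smult_one[of "q i"] by simp
  qed
  ultimately show ?thesis by blast
qed

section \<open>Twists and kernels\<close>

lemma twist_simps [simp]:
  "carrier (twist i M) = carrier M" "x \<oplus>\<^bsub>twist i M\<^esub> y = x \<oplus>\<^bsub>M\<^esub> y" "\<zero>\<^bsub>twist i M\<^esub> = \<zero>\<^bsub>M\<^esub>"
  "r \<odot>\<^bsub>twist i M\<^esub> x = r \<odot>\<^bsub>M\<^esub> x" "grade (twist i M) k = grade M (i + k)"
  by (simp_all add: twist_def)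

lemma twist_group:
  assumes "abelian_group M" shows "abelian_group (twist i M)"
proof -
  have "add_monoid (twist i M) = add_monoid M" by (simp add: twist_def)
  then show ?thesis using assms
    unfolding abelian_group_def abelian_monoid_def abelian_group_axioms_def by simp
qed

lemma graded_module_twist:
  assumes M: "graded_module R M"
  shows "graded_module R (twist i M)"
proof -
  interpret M: module R M using graded_module_D(1)[OF M] .
  interpret MG: graded_grp M using graded_module_D(2)[OF M] .
  have grp: "abelian_group (twist i M)" by (rule twist_group[OF M.M.abelian_group_axioms])
  have add_eq: "add_monoid (twist i M) = add_monoid M" by (simp add: twist_def)
  have sub: "additive_subgroup H (twist i M) \<longleftrightarrow> additive_subgroup H M" for H
    unfolding additive_subgroup_def add_eq ..
  have "graded_group (twist i M)"
  proof (rule graded_groupI[where p = "\<lambda>k x. hcomp M x (i + k)"])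
    show "abelian_group_hom (twist i M) (twist i M) (\<lambda>x. hcomp M x (i + k))" for k
      by (intro abelian_group_homI' grp) (auto simp: MG.hcomp_add)
    show "hcomp M x (i + k) = (if k = j then x else \<zero>\<^bsub>twist i M\<^esub>)" if "x \<in> grade (twist i M) j" for j k x
      using that by (simp add: MG.hcomp_homogeneous)
    show "carrier (twist i M) \<subseteq> H" if "additive_subgroup H (twist i M)" "\<And>k. grade (twist i M) k \<subseteq> H" for H
    proof -
      have "grade M k \<subseteq> H" for k using that(2)[of "k - i"] by simp
      then show ?thesis using MG.grade_span[of H] that(1) by (simp add: sub)
    qed
  qed (auto simp: grp sub MG.grade_subgroup MG.hcomp_props(1))
  moreover have "module R (twist i M)"
    by (rule moduleI) (use grp M.R.cring_axioms M.smult_l_distr M.smult_r_distr M.smult_assoc1 in auto)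
  moreover have "r \<odot>\<^bsub>twist i M\<^esub> x \<in> grade (twist i M) (j + k)"
    if "r \<in> grade R j" "x \<in> grade (twist i M) k" for r x j k
    using graded_module_D(4)[OF M that(1), of x "i + k"] that(2) by (simp add: add.left_commute)
  ultimately show ?thesis by (simp add: graded_module_iff)
qed

lemma submodule_quotient:
  assumes M: "module R M" and N: "submodule N R M"
  shows "module R (quot_gmod M N)" "(\<lambda>x. N +>\<^bsub>M\<^esub> x) \<in> mod_homs R M (quot_gmod M N)"
    "quotient_group M N"
proof -
  interpret M: module R M by (rule M)
  interpret N: submodule N R M by (rule N)
  show Q: "quotient_group M N"
    by (intro quotient_group.intro quotient_group_axioms.intro M.M.abelian_group_axioms
        submodule_additive_subgroup[OF N])
  interpret Q: quotient_group M N by (rule Q)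
  show "module R (quot_gmod M N)"
    by (rule Q.quot_module) (use M.R.cring_axioms M.smult_l_distr M.smult_r_distr M.smult_assoc1 in auto)
  show "(\<lambda>x. N +>\<^bsub>M\<^esub> x) \<in> mod_homs R M (quot_gmod M N)"
    by (rule mod_homsI[OF Q.quot_hom]) (use Q.quot_smult M.smult_r_distr in auto)
qed

lemma kernel_submodule:
  assumes M: "module R M" and N: "module R N" and f: "f \<in> mod_homs R M N"
  shows "submodule (a_kernel M N f) R M"
proof -
  interpret M: module R M by (rule M)
  interpret N: module R N by (rule N)
  have "(\<lambda>_. \<zero>\<^bsub>N\<^esub>) \<in> mod_homs R M N" by (simp add: mod_homs_def)
  from equalizer_submodule[OF M N f this] show ?thesis by (simp add: a_kernel_def')
qed

lemma hcomp_graded_hom: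
  assumes M: "graded_grp M" and N: "graded_grp N" and f: "abelian_group_hom M N f"
    and gr: "\<And>x k. x \<in> grade M k \<Longrightarrow> f x \<in> grade N (k + s)" and x: "x \<in> carrier M"
  shows "hcomp N (f x) (k + s) = f (hcomp M x k)"
proof -
  interpret M: graded_grp M by (rule M)
  interpret N: graded_grp N by (rule N)
  interpret f: abelian_group_hom M N f by (rule f)
  show ?thesis
  proof (rule M.hom_eq_on_grades[OF abelian_group_hom_comp[OF f N.hcomp_hom] abelian_group_hom_comp[OF M.hcomp_hom f] _ x])
    fix j x assume "x \<in> grade M j"
    then show "hcomp N (f x) (k + s) = f (hcomp M x k)"
      using N.hcomp_homogeneous[OF gr] by (simp add: M.hcomp_homogeneous)
  qed
qed

text \<open>A map of degree s commutes with taking components up to the shift, so its kernel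
  contains the components of its elements and the projections descend to the quotient. The shift is
  present because \<open>\<psi>\<^sub>1\<close> has degree m_e - 1 before any twist.\<close>

lemma graded_module_kernel_quotient:
  assumes R: "graded_group R" and M: "graded_module R M" and N: "graded_module R N"
    and f: "f \<in> mod_homs R M N" and gr: "\<And>x k. x \<in> grade M k \<Longrightarrow> f x \<in> grade N (k + s)"
  shows "graded_module R (quot_gmod M (a_kernel M N f))"
proof -
  interpret M: module R M using graded_module_D(1)[OF M] .
  interpret N: module R N using graded_module_D(1)[OF N] .
  interpret MG: graded_grp M using graded_module_D(2)[OF M] .
  interpret NG: graded_grp N using graded_module_D(2)[OF N] .
  let ?K = "a_kernel M N f"
  let ?Q = "quot_gmod M ?K"
  have K: "submodule ?K R M" by (rule kernel_submodule[OF M.module_axioms N.module_axioms f])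
  have mem: "x \<in> ?K \<longleftrightarrow> x \<in> carrier M \<and> f x = \<zero>\<^bsub>N\<^esub>" for x by (simp only: a_kernel_def' mem_Collect_eq)
  note quot = submodule_quotient[OF M.module_axioms K]
  interpret Q: quotient_group M ?K by (rule quot(3))
  have fhom: "abelian_group_hom M N f"
    by (rule mod_homs_hom[OF f M.M.abelian_group_axioms N.M.abelian_group_axioms])
  have comp_kernel: "hcomp M x k \<in> ?K" if "x \<in> ?K" for x k
  proof -
    have x: "x \<in> carrier M" "f x = \<zero>\<^bsub>N\<^esub>" using that mem by blast+
    have "f (hcomp M x k) = hcomp N (f x) (k + s)"
      using hcomp_graded_hom[OF MG.graded_grp_axioms NG.graded_grp_axioms fhom gr x(1)] by simp
    then show ?thesis using x NG.hcomp_homogeneous[OF NG.grade_zero, of "k + s"] unfolding mem by simp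
  qed
  define p where "p k = induced_map (\<lambda>x. ?K +>\<^bsub>M\<^esub> hcomp M x k)" for k
  have p: "abelian_group_hom ?Q ?Q (p k)"
    and p_coset: "\<And>x. x \<in> carrier M \<Longrightarrow> p k (?K +>\<^bsub>M\<^esub> x) = ?K +>\<^bsub>M\<^esub> hcomp M x k" for k
  proof -
    have z: "?K +>\<^bsub>M\<^esub> hcomp M x k = \<zero>\<^bsub>?Q\<^esub>" if "x \<in> ?K" for x
      using comp_kernel[OF that, of k] Q.N.a_rcos_const by simp
    note ind = Q.induced_map[OF abelian_group_hom_comp[OF MG.hcomp_hom Q.quot_hom]]
    show "abelian_group_hom ?Q ?Q (p k)" unfolding p_def by (rule ind(1)[OF z])
    show "p k (?K +>\<^bsub>M\<^esub> x) = ?K +>\<^bsub>M\<^esub> hcomp M x k" if "x \<in> carrier M" for x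
      unfolding p_def by (rule ind(2)[OF z that])
  qed
  have "graded_group ?Q"
  proof (rule graded_groupI[where p = p])
    show "additive_subgroup (grade ?Q k) ?Q" for k
      unfolding quot_gmod_simps(2) by (rule additive_subgroup_image[OF Q.quot_hom MG.grade_subgroup])
    show "p k x \<in> grade ?Q k" if "x \<in> carrier ?Q" for k x
    proof -
      obtain y where y: "y \<in> carrier M" "x = ?K +>\<^bsub>M\<^esub> y" using \<open>x \<in> carrier ?Q\<close> unfolding Q.quot_carrier by blast
      show ?thesis unfolding y(2) p_coset[OF y(1)] quot_gmod_simps(2) by (rule imageI[OF MG.hcomp_props(1)[OF y(1)]])
    qed
    show "p k x = (if k = j then x else \<zero>\<^bsub>?Q\<^esub>)" if "x \<in> grade ?Q j" for j k x
    proof -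
      obtain y where y: "y \<in> grade M j" "x = ?K +>\<^bsub>M\<^esub> y" using \<open>x \<in> grade ?Q j\<close> unfolding quot_gmod_simps(2) by blast
      show ?thesis
        unfolding y(2) p_coset[OF MG.grade_carrier[OF y(1)]] MG.hcomp_homogeneous[OF y(1)] quot_gmod_simps(1)
        using Q.quot_zero by (cases "k = j") simp_all
    qed
    fix H assume H: "additive_subgroup H ?Q" and sub: "\<And>k. grade ?Q k \<subseteq> H"
    have "carrier M \<subseteq> {x \<in> carrier M. ?K +>\<^bsub>M\<^esub> x \<in> H}"
      by (rule MG.grade_span[OF additive_subgroup_vimage[OF Q.quot_hom H]])
         (use sub[unfolded quot_gmod_simps(2)] MG.grade_carrier in blast)
    then show "carrier ?Q \<subseteq> H" unfolding Q.quot_carrier by blast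
  qed (rule Q.quot_group p)+
  moreover have "r \<odot>\<^bsub>?Q\<^esub> x \<in> grade ?Q (i + j)" if "r \<in> grade R i" "x \<in> grade ?Q j" for r x i j
  proof -
    have "r \<in> carrier R" using graded_grp.grade_carrier[OF graded_grpI[OF R] that(1)] .
    obtain y where y: "y \<in> grade M j" "x = ?K +>\<^bsub>M\<^esub> y" using \<open>x \<in> grade ?Q j\<close> unfolding quot_gmod_simps(2) by blast
    have "r \<odot>\<^bsub>?Q\<^esub> x = ?K +>\<^bsub>M\<^esub> (r \<odot>\<^bsub>M\<^esub> y)"
      unfolding y(2) by (rule mod_homs_smult[OF quot(2) \<open>r \<in> carrier R\<close> MG.grade_carrier[OF y(1)], symmetric])
    then show ?thesis
      unfolding quot_gmod_simps(2) by (rule image_eqI[OF _ graded_module_D(4)[OF M \<open>r \<in> grade R i\<close> y(1)]])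
  qed
  ultimately show ?thesis using quot(1) by (simp add: graded_module_iff)
qed

section \<open>The deletion-contraction sequence\<close>

lemma finite_acyclic_orientations:
  assumes "multigraph H" shows "finite (acyclic_orientations H)"
proof -
  have "finite (\<Pi>\<^sub>E f\<in>nonloop_edges H. ends H f)"
    by (intro finite_PiE finite_nonloop[OF assms]) (auto simp: nonloop_edges_def intro: card_ge_0_finite)
  then show ?thesis by (rule finite_subset[rotated]) (auto simp: acyclic_orientations_def)
qed

lemma finite_orientation_classes: "multigraph H \<Longrightarrow> finite (orientation_classes H)"
  by (simp add: orientation_classes_def finite_acyclic_orientations)

lemma orientation_class_in [simp]: "A \<in> acyclic_orientations H \<Longrightarrow> orientation_class H A \<in> orientation_classes H"
  by (simp add: orientation_classes_def)

lemma edges_between_verts: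
  assumes "multigraph H" "edges_between H u w \<noteq> {}"
  shows "u \<in> verts H" "w \<in> verts H"
  using assms by (auto simp: multigraph_def edges_between_def)

abbreviation graph_degree :: "('v, 'e) mgraph \<Rightarrow> int" where
  "graph_degree H \<equiv> int (card (verts H)) - int (card (edges H))"

abbreviation class_gmod :: "('v, 'e) mgraph \<Rightarrow> (('v, 'k::field) mpoly, ('e \<Rightarrow> 'v) set \<Rightarrow> ('v, 'k) mpoly) gmodule" where
  "class_gmod H \<equiv> free_gmod (polyring (verts H)) (orientation_classes H) (\<lambda>_. graph_degree H)"

lemma standard_generators_D:
  assumes "standard_generators H C g"
  shows "\<And>K. K \<in> orientation_classes H \<Longrightarrow> g K \<in> grade C (graph_degree H)"
    "generates (polyring (verts H)) C (g ` orientation_classes H)"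
    "{a \<in> carrier (class_gmod H). (\<Oplus>\<^bsub>C\<^esub>K\<in>orientation_classes H. a K \<odot>\<^bsub>C\<^esub> g K) = \<zero>\<^bsub>C\<^esub>} =
       submodule_generated (polyring (verts H)) (class_gmod H) (orientation_relations H)"
  using assms generatesI[of "polyring (verts H)" C "g ` orientation_classes H"]
  unfolding standard_generators_def Let_def by auto

text \<open>Puts the relations in terms of opposite pairs, the form that lifts from G - e to
  G.\<close>

lemma orientation_relations_cases:
  assumes H: "multigraph H" and a: "a \<in> orientation_relations H"
  obtains u w A A' where "u \<noteq> w" "edges_between H u w \<noteq> {}" "opposite_pair H u w A A'"
    "a = (\<lambda>K. (if K = orientation_class H A then var u ^ card (edges_between H u w) else 0) +
             (if K = orientation_class H A' then var w ^ card (edges_between H u w) else 0))"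
proof -
  obtain u w B where uw: "u \<noteq> w" "edges_between H u w \<noteq> {}"
    and B: "B \<in> acyclic_orientations (contract_pair H u w)" and a: "a = orientation_relation H u w B"
    using a by (auto simp: orientation_relations_def)
  show thesis
    by (rule that[OF uw extend_orientation_pair[OF H uw(1) B]]) (simp add: a orientation_relation_def fun_eq_iff)
qed

text \<open>Through \<open>opposite_pair_contract\<close> the relation becomes available for any
  opposite pair, wherever the pair was found.\<close>

lemma orientation_relation_holds:
  fixes C :: "(('v, 'k::field) mpoly, 'c) gmodule"
  assumes H: "multigraph H" and C: "module (polyring (verts H)) C" and g: "standard_generators H C g"
    and gC: "\<And>K. K \<in> orientation_classes H \<Longrightarrow> g K \<in> carrier C"
    and uw: "u \<noteq> w" "edges_between H u w \<noteq> {}" and op: "opposite_pair H u w A A'"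
  shows "var u ^ card (edges_between H u w) \<odot>\<^bsub>C\<^esub> g (orientation_class H A) \<oplus>\<^bsub>C\<^esub>
    var w ^ card (edges_between H u w) \<odot>\<^bsub>C\<^esub> g (orientation_class H A') = \<zero>\<^bsub>C\<^esub>"
proof -
  let ?n = "card (edges_between H u w)" and ?I = "orientation_classes H"
  interpret C: module "polyring (verts H)" C by (rule C)
  interpret L: lin_comb "verts H" "verts H" "\<lambda>p. p" C ?I g "\<lambda>_. graph_degree H"
    by unfold_locales (use finite_orientation_classes[OF H] gC in auto)
  have A: "A \<in> acyclic_orientations H" "A' \<in> acyclic_orientations H" using op by (auto simp: opposite_pair_def)
  obtain B where B: "B \<in> acyclic_orientations (contract_pair H u w)"
    "extend_orientation H u w B u = A" "extend_orientation H u w B w = A'"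
    using opposite_pair_contract[OF H uw op] by blast
  let ?a = "\<lambda>K. (if K = orientation_class H A then var u ^ ?n else 0 :: ('v, 'k) mpoly) + (if K = orientation_class H A' then var w ^ ?n else 0)"
  have "?a = orientation_relation H u w B" by (simp add: orientation_relation_def B(2,3) fun_eq_iff)
  then have "?a \<in> orientation_relations H" using uw B(1) by (auto simp: orientation_relations_def)
  then have "?a \<in> submodule_generated (polyring (verts H)) (class_gmod H) (orientation_relations H)"
    unfolding submodule_generated_def by blast
  then have "(\<Oplus>\<^bsub>C\<^esub>K\<in>?I. ?a K \<odot>\<^bsub>C\<^esub> g K) = \<zero>\<^bsub>C\<^esub>"
    unfolding standard_generators_D(3)[OF g, symmetric] by simp
  then have "L.comb ?a = \<zero>\<^bsub>C\<^esub>" by (simp add: L.comb_def)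
  then show ?thesis
    using L.two_terms[of "orientation_class H A" "orientation_class H A'" "var u ^ ?n" "var w ^ ?n"] A
      edges_between_verts[OF H uw(2)] by simp
qed

lemma (in merged_tensor) relation_tensor:
  assumes rel: "p \<odot>\<^bsub>C\<^esub> m \<oplus>\<^bsub>C\<^esub> r \<odot>\<^bsub>C\<^esub> m' = \<zero>\<^bsub>C\<^esub>"
    and c: "p \<in> mpolys V" "r \<in> mpolys V" "m \<in> carrier C" "m' \<in> carrier C"
  shows "\<sigma> p \<odot>\<^bsub>X\<^esub> pure m 1 \<oplus>\<^bsub>X\<^esub> \<sigma> r \<odot>\<^bsub>X\<^esub> pure m' 1 = \<zero>\<^bsub>X\<^esub>"
proof -
  have s: "\<sigma> q \<odot>\<^bsub>X\<^esub> pure x 1 = pure (q \<odot>\<^bsub>C\<^esub> x) 1" if "q \<in> mpolys V" "x \<in> carrier C" for q x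
    using that by (simp add: smult_pure pure_balanced subst_vars_mpolys)
  have "pure \<zero>\<^bsub>C\<^esub> 1 \<oplus>\<^bsub>X\<^esub> pure \<zero>\<^bsub>C\<^esub> 1 = pure \<zero>\<^bsub>C\<^esub> 1"
    using pure_add_left[of "\<zero>\<^bsub>C\<^esub>" "\<zero>\<^bsub>C\<^esub>" 1] by simp
  then have z: "pure \<zero>\<^bsub>C\<^esub> 1 = \<zero>\<^bsub>X\<^esub>"
    using XG.add.l_cancel_one[of "pure \<zero>\<^bsub>C\<^esub> 1" "pure \<zero>\<^bsub>C\<^esub> 1"] by simp
  show ?thesis
    using c pure_add_left[of "p \<odot>\<^bsub>C\<^esub> m" "r \<odot>\<^bsub>C\<^esub> m'" 1] rel by (simp add: s z)
qed

lemma char2_module: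
  fixes M :: "(('v, 'k::field) mpoly, 'c) gmodule"
  assumes char2: "CHAR('k) = 2" and M: "module (polyring U) M" and x: "x \<in> carrier M"
  shows "x \<oplus>\<^bsub>M\<^esub> x = \<zero>\<^bsub>M\<^esub>" "\<ominus>\<^bsub>M\<^esub> x = x"
proof -
  interpret M: module "polyring U" M by (rule M)
  have "(1 + 1 :: 'k) = 0" using of_nat_CHAR[where 'a = 'k] by (simp add: char2)
  then have "(1 + 1 :: ('v, 'k) mpoly) = 0" by (metis single_add single_one single_zero)
  then have "\<zero>\<^bsub>M\<^esub> = (1 + 1) \<odot>\<^bsub>M\<^esub> x" using M.smult_l_null[OF x] by simp
  also have "\<dots> = x \<oplus>\<^bsub>M\<^esub> x" using M.smult_l_distr[of 1 1 x] M.smult_one[OF x] x by simp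
  finally show "x \<oplus>\<^bsub>M\<^esub> x = \<zero>\<^bsub>M\<^esub>" ..
  then show "\<ominus>\<^bsub>M\<^esub> x = x" using M.M.minus_equality[OF _ x x] by simp
qed

section \<open>The two maps and their composite\<close>

locale deletion_contraction =
  fixes G :: "('v, 'e) mgraph" and e :: 'e and v1 v2 :: 'v
    and CG :: "(('v, 'k::field) mpoly, 'a) gmodule"
    and CC :: "(('v, 'k) mpoly, 'b) gmodule"
    and CD :: "(('v, 'k) mpoly, 'c) gmodule"
    and gG gC gD \<psi> \<phi>
  assumes char2: "CHAR('k) = 2"
    and G: "multigraph G"
    and e: "e \<in> edges G" "ends G e = {v1, v2}" "v1 \<noteq> v2"
    and CG: "graded_module (polyring (verts G)) CG" "standard_generators G CG gG"
    and CC: "graded_module (polyring (verts (contract_edge G e v1 v2))) CC"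
      "standard_generators (contract_edge G e v1 v2) CC gC"
    and CD: "graded_module (polyring (verts (delete_edge G e))) CD"
      "standard_generators (delete_edge G e) CD gD"
    and psi: "is_psi1 G e v1 v2 CC gC CG gG \<psi>"
    and phi: "is_phi1 G e v1 v2 CG gG CD gD \<phi>"
begin

abbreviation "V \<equiv> verts G"
abbreviation "Gd \<equiv> delete_edge G e"
abbreviation "Ge \<equiv> contract_edge G e v1 v2"
abbreviation "n\<^sub>e \<equiv> card (edges_between G v1 v2)"

sublocale TG: graded_merged_tensor v1 v2 V CG
  by (intro graded_merged_tensor.intro graded_merged_tensor_axioms.intro merged_tensor.intro
      graded_module_D(1)[OF CG(1)] CG(1))

sublocale TD: graded_merged_tensor v1 v2 V CD
  using CD(1) graded_module_D(1)[OF CD(1)]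
  by (intro graded_merged_tensor.intro graded_merged_tensor_axioms.intro merged_tensor.intro) simp_all

abbreviation "S \<equiv> polyring (merge v1 v2 ` V) :: (('v, 'k) mpoly, ('v, 'k) mpoly) gmodule"
abbreviation "x\<^sub>e \<equiv> var v1 ^ (n\<^sub>e - 1) :: ('v, 'k) mpoly"
abbreviation "genG A \<equiv> TG.pure (gG (orientation_class G A)) 1"
abbreviation "genD B \<equiv> TD.pure (gD (orientation_class Gd B)) 1"

lemma verts_contract: "verts Ge = merge v1 v2 ` V"
  by (simp add: contract_edge_def)

lemma ctopp_simps:
  "ctopp_tensor G v1 v2 CG = TG.X" "ctopp_tensor Gd v1 v2 CD = TD.X"
  "gen_tensor G v1 v2 CG gG A = genG A" "gen_tensor Gd v1 v2 CD gD B = genD B"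
  by (simp_all add: ctopp_tensor_def gen_tensor_def)

lemma eN: "e \<in> nonloop_edges G"
  using e by (simp add: nonloop_edges_def)

lemma e_between: "e \<in> edges_between G v1 v2"
  using e by (simp add: edges_between_def)

lemma Gd: "multigraph Gd" by (rule multigraph_delete[OF G])

lemma finite_between: "finite (edges_between G v1 v2)"
  using G by (simp add: multigraph_def edges_between_def)

lemma n_pos: "n\<^sub>e \<ge> 1"
  using e_between finite_between by (metis One_nat_def Suc_leI card_gt_0_iff empty_iff)

lemma card_between_delete: "card (edges_between Gd v1 v2) = n\<^sub>e - 1"
  using e_between finite_between by (simp add: edges_between_delete)

lemma v_verts: "v1 \<in> V" "v2 \<in> V"
  using edges_between_verts[OF G, of v1 v2] e_between by auto

lemma merge_simps: "merge v1 v2 v1 = v1" "merge v1 v2 v2 = v1"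
  by (simp_all add: merge_def)

lemma v1_W: "v1 \<in> merge v1 v2 ` V"
  using v_verts(1) merge_simps(1) by (metis imageI)

lemma x_W: "x\<^sub>e \<in> mpolys (merge v1 v2 ` V)"
  using v1_W by simp

lemma gG_carrier: "K \<in> orientation_classes G \<Longrightarrow> gG K \<in> carrier CG"
  using standard_generators_D(1)[OF CG(2)] TG.CG.grade_carrier by blast

lemma gD_carrier: "K \<in> orientation_classes Gd \<Longrightarrow> gD K \<in> carrier CD"
  using standard_generators_D(1)[OF CD(2)] TD.CG.grade_carrier by blast

lemma genG_carrier: "A \<in> acyclic_orientations G \<Longrightarrow> genG A \<in> carrier TG.X"
  by (simp add: gG_carrier)

lemma genD_carrier: "B \<in> acyclic_orientations Gd \<Longrightarrow> genD B \<in> carrier TD.X"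
  by (simp add: gD_carrier)

sublocale XG: module S TG.X by (rule TG.tensor_module)
sublocale XD: module S TD.X by (rule TD.tensor_module)
sublocale MC: module S CC using graded_module_D(1)[OF CC(1)] by (simp add: verts_contract)

lemma psi_hom: "\<psi> \<in> mod_homs S CC TG.X"
  using psi by (simp add: is_psi1_def Let_def ctopp_simps verts_contract)

lemma phi_hom: "\<phi> \<in> mod_homs S TG.X TD.X"
  using phi by (simp add: is_phi1_def Let_def ctopp_simps verts_contract)

lemma phi_gen: "A \<in> acyclic_orientations G \<Longrightarrow> \<phi> (genG A) = genD (delete_orientation G e A)"
  using phi by (simp add: is_phi1_def Let_def ctopp_simps)

sublocale psi: abelian_group_hom CC TG.X \<psi>
  by (rule mod_homs_hom[OF psi_hom MC.M.abelian_group_axioms TG.tensor_group])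

sublocale phi: abelian_group_hom TG.X TD.X \<phi>
  by (rule mod_homs_hom[OF phi_hom TG.tensor_group TD.tensor_group])

lemma generates_G: "generates S TG.X (genG ` acyclic_orientations G)"
proof -
  have "generates S TG.X ((\<lambda>m. TG.pure m 1) ` gG ` orientation_classes G)"
    using gG_carrier by (intro TG.tensor_generated standard_generators_D(2)[OF CG(2)]) auto
  then show ?thesis by (simp add: image_image orientation_classes_def)
qed

lemma generates_D: "generates S TD.X (genD ` acyclic_orientations Gd)"
proof -
  have "generates (polyring V) CD (gD ` orientation_classes Gd)"
    using standard_generators_D(2)[OF CD(2)] by simp
  then have "generates S TD.X ((\<lambda>m. TD.pure m 1) ` gD ` orientation_classes Gd)"
    using gD_carrier by (intro TD.tensor_generated) auto
  then show ?thesis by (simp add: image_image orientation_classes_def)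
qed

text \<open>Together with \<open>psi_generator\<close> this identifies the images of the generators
  under \<psi> with the combinations attached to opposite pairs at v1 and v2.\<close>

lemma psi_opposite_pair:
  assumes op: "opposite_pair G v1 v2 A A'"
  shows "\<exists>B\<in>acyclic_orientations Ge. \<psi> (gC (orientation_class Ge B)) = x\<^sub>e \<odot>\<^bsub>TG.X\<^esub> genG A \<oplus>\<^bsub>TG.X\<^esub> x\<^sub>e \<odot>\<^bsub>TG.X\<^esub> genG A'"
proof -
  obtain B where B: "B \<in> acyclic_orientations Ge" "extend_orientation G v1 v2 B v1 = A" "extend_orientation G v1 v2 B v2 = A'"
    using opposite_pair_contract[OF G e(3) _ op] e_between acyclic_orientations_contract_edge[OF G e(3,2)] by auto
  then show ?thesis using psi by (auto simp: is_psi1_def Let_def ctopp_simps)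
qed

lemma psi_generator:
  assumes B: "B \<in> acyclic_orientations Ge"
  shows "\<exists>A A'. opposite_pair G v1 v2 A A' \<and>
    \<psi> (gC (orientation_class Ge B)) = x\<^sub>e \<odot>\<^bsub>TG.X\<^esub> genG A \<oplus>\<^bsub>TG.X\<^esub> x\<^sub>e \<odot>\<^bsub>TG.X\<^esub> genG A'"
proof -
  have "opposite_pair G v1 v2 (extend_orientation G v1 v2 B v1) (extend_orientation G v1 v2 B v2)"
    using B acyclic_orientations_contract_edge[OF G e(3,2)] by (intro extend_orientation_pair[OF G e(3)]) simp
  then show ?thesis using psi B by (auto simp: is_psi1_def Let_def ctopp_simps)
qed

lemma gC_carrier: "K \<in> orientation_classes Ge \<Longrightarrow> gC K \<in> carrier CC"
  using standard_generators_D(1)[OF CC(2)] graded_grp.grade_carrier[OF graded_module_D(2)[OF CC(1)]] by blast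

lemma phi_psi_zero:
  assumes y: "y \<in> carrier CC"
  shows "\<phi> (\<psi> y) = \<zero>\<^bsub>TD.X\<^esub>"
proof (rule mod_homs_eq_on_generators[where f = "\<lambda>y. \<phi> (\<psi> y)" and g = "\<lambda>_. \<zero>\<^bsub>TD.X\<^esub>" and R = S and M = CC and N = TD.X])
  show "(\<lambda>y. \<phi> (\<psi> y)) \<in> mod_homs S CC TD.X"
    by (rule mod_homsI[OF abelian_group_hom_comp[OF psi.abelian_group_hom_axioms phi.abelian_group_hom_axioms]])
       (simp add: mod_homs_smult[OF psi_hom] mod_homs_smult[OF phi_hom])
  show "generates S CC (gC ` orientation_classes Ge)"
    using standard_generators_D(2)[OF CC(2)] by (simp add: verts_contract)
  fix y assume "y \<in> gC ` orientation_classes Ge"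
  then obtain B where B: "B \<in> acyclic_orientations Ge" "y = gC (orientation_class Ge B)"
    by (auto simp: orientation_classes_def)
  obtain A A' where op: "opposite_pair G v1 v2 A A'"
      and psiB: "\<psi> y = x\<^sub>e \<odot>\<^bsub>TG.X\<^esub> genG A \<oplus>\<^bsub>TG.X\<^esub> x\<^sub>e \<odot>\<^bsub>TG.X\<^esub> genG A'"
    using psi_generator[OF B(1)] B(2) by blast
  let ?B = "delete_orientation G e A" and ?B' = "delete_orientation G e A'"
  have A: "A \<in> acyclic_orientations G" "A' \<in> acyclic_orientations G" using op by (auto simp: opposite_pair_def)
  have dA: "genD ?B \<in> carrier TD.X" "genD ?B' \<in> carrier TD.X"
    by (intro genD_carrier delete_orientation_acyclic A)+
  have "\<phi> (\<psi> y) = \<phi> (x\<^sub>e \<odot>\<^bsub>TG.X\<^esub> genG A) \<oplus>\<^bsub>TD.X\<^esub> \<phi> (x\<^sub>e \<odot>\<^bsub>TG.X\<^esub> genG A')"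
    unfolding psiB using A x_W genG_carrier by (intro phi.hom_add XG.smult_closed) simp_all
  also have "\<dots> = x\<^sub>e \<odot>\<^bsub>TD.X\<^esub> genD ?B \<oplus>\<^bsub>TD.X\<^esub> x\<^sub>e \<odot>\<^bsub>TD.X\<^esub> genD ?B'"
    using A x_W mod_homs_smult[OF phi_hom _ genG_carrier] by (simp add: phi_gen)
  also have "\<dots> = \<zero>\<^bsub>TD.X\<^esub>"
  \<comment> \<open>If e is alone, both orientations restrict to the same one and the sum doubles a
    single term, which vanishes in characteristic two. Otherwise the sum is a relation of G - e at
    v1 and v2, whose exponent is the number m_e - 1 of remaining edges.\<close>
  proof (cases "edges_between G v1 v2 = {e}")
    case True
    then have "?B = ?B'" by (rule opposite_pair_delete_eq[OF op _ e(3)])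
    moreover have "x\<^sub>e \<odot>\<^bsub>TD.X\<^esub> genD ?B' \<in> carrier TD.X" using x_W dA by (intro XD.smult_closed) simp_all
    ultimately show ?thesis using char2_module(1)[OF char2 XD.module_axioms] by simp
  next
    case False
    then have adj: "edges_between Gd v1 v2 \<noteq> {}" using e_between by (auto simp: edges_between_delete)
    have "module (polyring (verts Gd)) CD" using TD.C by simp
    from orientation_relation_holds[OF Gd this CD(2) gD_carrier e(3) adj opposite_pair_delete[OF op]]
    have "var v1 ^ (n\<^sub>e - 1) \<odot>\<^bsub>CD\<^esub> gD (orientation_class Gd ?B) \<oplus>\<^bsub>CD\<^esub>
      var v2 ^ (n\<^sub>e - 1) \<odot>\<^bsub>CD\<^esub> gD (orientation_class Gd ?B') = \<zero>\<^bsub>CD\<^esub>"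
      by (simp add: card_between_delete)
    moreover have "gD (orientation_class Gd ?B) \<in> carrier CD" "gD (orientation_class Gd ?B') \<in> carrier CD"
      by (intro gD_carrier orientation_class_in delete_orientation_acyclic A)+
    ultimately show ?thesis
      using TD.relation_tensor[of "var v1 ^ (n\<^sub>e - 1)" _ "var v2 ^ (n\<^sub>e - 1)"] v_verts
      by (simp add: subst_vars_power subst_vars_var merge_simps)
  qed
  finally show "y \<in> carrier CC \<and> \<phi> (\<psi> y) = \<zero>\<^bsub>TD.X\<^esub>" using B by (simp add: gC_carrier)
qed (use y XD.module_axioms MC.module_axioms in \<open>auto simp: mod_homs_def\<close>)

section \<open>The cokernel of \<psi> and the map back from the deletion\<close>

abbreviation "Im \<equiv> \<psi> ` carrier CC"
abbreviation "Y \<equiv> quot_gmod TG.X Im"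
abbreviation "\<pi> x \<equiv> Im +>\<^bsub>TG.X\<^esub> x"

lemma Im_submodule: "submodule Im S TG.X"
  by (rule image_submodule[OF MC.module_axioms XG.module_axioms psi_hom])

lemma Y_module: "module S Y" and \<pi>_hom: "(\<lambda>x. \<pi> x) \<in> mod_homs S TG.X Y" and Y_quot: "quotient_group TG.X Im"
  using submodule_quotient[OF XG.module_axioms Im_submodule] by auto

lemma \<pi>_group_hom: "abelian_group_hom TG.X Y (\<lambda>x. \<pi> x)"
  by (rule quotient_group.quot_hom[OF Y_quot])

lemma \<pi>_zero_iff: "x \<in> carrier TG.X \<Longrightarrow> \<pi> x = \<zero>\<^bsub>Y\<^esub> \<longleftrightarrow> x \<in> Im"
  unfolding quot_gmod_simps(1) by (rule quotient_group.quot_eq_zero_iff[OF Y_quot])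

lemma \<pi>_opposite_pair:
  assumes op: "opposite_pair G v1 v2 A A'"
  shows "x\<^sub>e \<odot>\<^bsub>Y\<^esub> \<pi> (genG A) \<oplus>\<^bsub>Y\<^esub> x\<^sub>e \<odot>\<^bsub>Y\<^esub> \<pi> (genG A') = \<zero>\<^bsub>Y\<^esub>"
proof -
  have A: "genG A \<in> carrier TG.X" "genG A' \<in> carrier TG.X"
    using op by (auto simp: opposite_pair_def intro: genG_carrier)
  have xS: "x\<^sub>e \<in> carrier S" using x_W by simp
  obtain B where "B \<in> acyclic_orientations Ge"
      "\<psi> (gC (orientation_class Ge B)) = x\<^sub>e \<odot>\<^bsub>TG.X\<^esub> genG A \<oplus>\<^bsub>TG.X\<^esub> x\<^sub>e \<odot>\<^bsub>TG.X\<^esub> genG A'"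
    using psi_opposite_pair[OF op] by blast
  then have "x\<^sub>e \<odot>\<^bsub>TG.X\<^esub> genG A \<oplus>\<^bsub>TG.X\<^esub> x\<^sub>e \<odot>\<^bsub>TG.X\<^esub> genG A' \<in> Im"
    using gC_carrier[OF orientation_class_in] by (metis imageI)
  moreover have c: "x\<^sub>e \<odot>\<^bsub>TG.X\<^esub> genG A \<in> carrier TG.X" "x\<^sub>e \<odot>\<^bsub>TG.X\<^esub> genG A' \<in> carrier TG.X"
    using XG.smult_closed[OF xS] A by blast+
  ultimately have "\<pi> (x\<^sub>e \<odot>\<^bsub>TG.X\<^esub> genG A \<oplus>\<^bsub>TG.X\<^esub> x\<^sub>e \<odot>\<^bsub>TG.X\<^esub> genG A') = \<zero>\<^bsub>Y\<^esub>"
    using \<pi>_zero_iff[OF TG.XG.a_closed[OF c]] by blast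
  then show ?thesis
    by (simp only: abelian_group_hom.hom_add[OF \<pi>_group_hom c] mod_homs_smult[OF \<pi>_hom xS A(1)] mod_homs_smult[OF \<pi>_hom xS A(2)])
qed

text \<open>An instance of \<open>lift_invariant\<close>, with h A the class of
  \<open>genG A\<close> modulo the image of \<psi>.\<close>

lemma \<pi>_gen_cong:
  assumes A: "A \<in> acyclic_orientations G" "A' \<in> acyclic_orientations G"
    and eqv: "lin_equiv Gd (delete_orientation G e A) (delete_orientation G e A')"
  shows "\<pi> (genG A) = \<pi> (genG A')"
proof (rule lift_invariant[OF G eN _ _ A eqv])
  fix A A' assume A: "A \<in> acyclic_orientations G" "A' \<in> acyclic_orientations G"
  show "\<pi> (genG A) = \<pi> (genG A')" if "lin_equiv G A A'"
    using that orientation_class_eq_iff[OF A(2), of A] by simp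
  have YC: "\<pi> (genG A) \<in> carrier Y" "\<pi> (genG A') \<in> carrier Y"
    using abelian_group_hom.hom_closed[OF \<pi>_group_hom genG_carrier] A by auto
  interpret Y: module S Y by (rule Y_module)
  have swap: "\<pi> (genG A) = \<pi> (genG A')"
    if op: "opposite_pair G v1 v2 A A' \<or> opposite_pair G v1 v2 A' A" and single: "edges_between G v1 v2 = {e}"
  proof -
    \<comment> \<open>With e alone the exponent m_e - 1 is 0, so the coefficient
      \<open>x\<^sub>e\<close> is 1.\<close>
    have one: "x\<^sub>e \<odot>\<^bsub>Y\<^esub> y = y" if "y \<in> carrier Y" for y using Y.smult_one[OF that] by (simp only: single) simp
    have "\<pi> (genG A) \<oplus>\<^bsub>Y\<^esub> \<pi> (genG A') = \<zero>\<^bsub>Y\<^esub>"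
      using op \<pi>_opposite_pair[of A A'] \<pi>_opposite_pair[of A' A] Y.M.a_comm[OF YC]
      unfolding one[OF YC(1)] one[OF YC(2)] by metis
    \<comment> \<open>In characteristic two a vanishing sum of two elements means that they are
      equal.\<close>
    then have "\<pi> (genG A) = \<ominus>\<^bsub>Y\<^esub> \<pi> (genG A')" using Y.M.minus_equality[OF _ YC(2,1)] by metis
    then show ?thesis using char2_module(2)[OF char2 Y_module YC(2)] by metis
  qed
  show "\<pi> (genG A) = \<pi> (genG A')" if "delete_orientation G e A = delete_orientation G e A'"
    using acyclic_lifts_eq_or_opposite[OF e A that] swap by blast
qed

text \<open>The inverse of the map \<open>TG.X / Im \<rightarrow> TD.X\<close> induced by \<open>\<phi>\<close>.\<close>

lemma section_exists: "\<exists>\<chi>\<in>mod_homs S TD.X Y. \<forall>A\<in>acyclic_orientations G. \<chi> (genD (delete_orientation G e A)) = \<pi> (genG A)"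
proof -
  interpret Y: module S Y by (rule Y_module)
  \<comment> \<open>Any acyclic lift of any representative of K will do, by
    \<open>\<pi>_gen_cong\<close>.\<close>
  define lift where "lift K = (SOME A. A \<in> acyclic_orientations G \<and> orientation_class Gd (delete_orientation G e A) = K)" for K
  define q where "q K = \<pi> (genG (lift K))" for K
  have q: "q (orientation_class Gd (delete_orientation G e A)) = \<pi> (genG A)" if A: "A \<in> acyclic_orientations G" for A
  proof -
    let ?K = "orientation_class Gd (delete_orientation G e A)"
    have L: "lift ?K \<in> acyclic_orientations G \<and> orientation_class Gd (delete_orientation G e (lift ?K)) = ?K"
      unfolding lift_def by (rule someI[of _ A]) (simp add: A)
    then have "lin_equiv Gd (delete_orientation G e (lift ?K)) (delete_orientation G e A)"
      using orientation_class_eq_iff[OF delete_orientation_acyclic[OF A]] by blast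
    then show ?thesis unfolding q_def using L A by (intro \<pi>_gen_cong) auto
  qed
  have \<pi>_carrier: "\<pi> (genG A) \<in> carrier Y" if "A \<in> acyclic_orientations G" for A
    using abelian_group_hom.hom_closed[OF \<pi>_group_hom genG_carrier[OF that]] .
  have q_carrier: "q K \<in> carrier Y" if K: "K \<in> orientation_classes Gd" for K
  proof -
    obtain B where B: "B \<in> acyclic_orientations Gd" "K = orientation_class Gd B" using K by (auto simp: orientation_classes_def)
    obtain A where A: "A \<in> acyclic_orientations G" "delete_orientation G e A = B"
      using acyclic_lift_exists[OF B(1) eN] by blast
    show ?thesis using q[OF A(1)] \<pi>_carrier[OF A(1)] A(2) B(2) by simp
  qed
  interpret L: lin_comb V "merge v1 v2 ` V" "subst_vars (merge v1 v2)" Y "orientation_classes Gd" q "\<lambda>_. graph_degree Gd"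
    by (intro lin_comb.intro Y_module finite_orientation_classes[OF Gd] q_carrier)
       (auto simp: subst_vars_mpolys subst_vars_add subst_vars_mult)
  have rel: "a \<in> carrier (class_gmod Gd) \<and> L.comb a = \<zero>\<^bsub>Y\<^esub>" if a: "a \<in> orientation_relations Gd" for a
  proof -
    obtain u w B B' where uw: "u \<noteq> w" and adj: "edges_between Gd u w \<noteq> {}" and op: "opposite_pair Gd u w B B'"
      and a: "a = (\<lambda>K. (if K = orientation_class Gd B then var u ^ card (edges_between Gd u w) else 0) +
             (if K = orientation_class Gd B' then var w ^ card (edges_between Gd u w) else 0))"
      using orientation_relations_cases[OF Gd a] .
    obtain A A' where opA: "opposite_pair G u w A A'" and AB: "delete_orientation G e A = B" "delete_orientation G e A' = B'"
      using opposite_pair_lift[OF G eN uw adj op] by blast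
    have A: "A \<in> acyclic_orientations G" "A' \<in> acyclic_orientations G" using opA by (auto simp: opposite_pair_def)
    have B: "B \<in> acyclic_orientations Gd" "B' \<in> acyclic_orientations Gd" using op by (auto simp: opposite_pair_def)
    have uwV: "u \<in> V" "w \<in> V" using edges_between_verts[OF Gd adj] by simp_all
    let ?n = "card (edges_between Gd u w)"
    have aF: "a \<in> carrier (class_gmod Gd)" using uwV B by (auto simp: a)
    have "L.comb a = var (merge v1 v2 u) ^ ?n \<odot>\<^bsub>Y\<^esub> \<pi> (genG A) \<oplus>\<^bsub>Y\<^esub> var (merge v1 v2 w) ^ ?n \<odot>\<^bsub>Y\<^esub> \<pi> (genG A')"
      unfolding a using L.two_terms[OF orientation_class_in[OF B(1)] orientation_class_in[OF B(2)], of "var u ^ ?n" "var w ^ ?n"]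
        uwV q[OF A(1)] q[OF A(2)] by (simp add: AB subst_vars_power subst_vars_var)
    also have "\<dots> = \<zero>\<^bsub>Y\<^esub>"
    \<comment> \<open>Between v1 and v2 the relation of G - e has exponent m_e - 1 while that of G
      has m_e, so the latter is of no help; both variables become that of v1, and the lifted element
      is killed because it lies in the image of \<psi>. At any other pair the exponents agree and
      the relation of G applies.\<close>
    proof (cases "{u, w} = {v1, v2}")
      case True
      then have n: "?n = n\<^sub>e - 1" using card_between_delete by (simp add: edges_between_def)
      have m: "merge v1 v2 u = v1" "merge v1 v2 w = v1" using True by (auto simp: merge_def doubleton_eq_iff)
      have c: "x\<^sub>e \<odot>\<^bsub>Y\<^esub> \<pi> (genG A) \<in> carrier Y" "x\<^sub>e \<odot>\<^bsub>Y\<^esub> \<pi> (genG A') \<in> carrier Y"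
        using x_W \<pi>_carrier A by (auto intro: Y.smult_closed)
      have "opposite_pair G v1 v2 A A' \<or> opposite_pair G v1 v2 A' A"
        using True opA opposite_pair_commute[OF opA] by (auto simp: doubleton_eq_iff)
      then show ?thesis
        unfolding n m using \<pi>_opposite_pair[of A A'] \<pi>_opposite_pair[of A' A] Y.M.a_comm[OF c] by metis
    next
      case False
      then have eq: "edges_between G u w = edges_between Gd u w"
        using e by (auto simp: edges_between_def)
      have p: "var u ^ ?n \<in> mpolys V" "var w ^ ?n \<in> mpolys V" using uwV by simp_all
      have gA: "gG (orientation_class G A) \<in> carrier CG" "gG (orientation_class G A') \<in> carrier CG"
        using A by (auto intro: gG_carrier)
      have "edges_between G u w \<noteq> {}" using adj eq by simp
      from orientation_relation_holds[OF G TG.C CG(2) gG_carrier uw this opA]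
      have "var u ^ ?n \<odot>\<^bsub>CG\<^esub> gG (orientation_class G A) \<oplus>\<^bsub>CG\<^esub> var w ^ ?n \<odot>\<^bsub>CG\<^esub> gG (orientation_class G A') = \<zero>\<^bsub>CG\<^esub>"
        by (simp add: eq)
      from TG.relation_tensor[OF this p gA]
      have z: "var (merge v1 v2 u) ^ ?n \<odot>\<^bsub>TG.X\<^esub> genG A \<oplus>\<^bsub>TG.X\<^esub> var (merge v1 v2 w) ^ ?n \<odot>\<^bsub>TG.X\<^esub> genG A' = \<zero>\<^bsub>TG.X\<^esub>"
        by (simp add: subst_vars_power subst_vars_var)
      have s: "var (merge v1 v2 u) ^ ?n \<in> carrier S" "var (merge v1 v2 w) ^ ?n \<in> carrier S" using uwV by simp_all
      note c = XG.smult_closed[OF s(1) genG_carrier[OF A(1)]] XG.smult_closed[OF s(2) genG_carrier[OF A(2)]]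
      show ?thesis
        unfolding mod_homs_smult[OF \<pi>_hom s(1) genG_carrier[OF A(1)], symmetric]
          mod_homs_smult[OF \<pi>_hom s(2) genG_carrier[OF A(2)], symmetric]
          abelian_group_hom.hom_add[OF \<pi>_group_hom c, symmetric] z
        by (rule abelian_group_hom.hom_zero[OF \<pi>_group_hom])
    qed
    finally show ?thesis using aF by blast
  qed
  have "\<exists>\<chi>\<in>mod_homs S TD.X Y. \<forall>K\<in>orientation_classes Gd. \<chi> (TD.pure (gD K) 1) = q K"
  proof (rule TD.tensor_lift[OF finite_orientation_classes[OF Gd] gD_carrier _ _ Y_module q_carrier])
    show "generates (polyring V) CD (gD ` orientation_classes Gd)"
      using standard_generators_D(2)[OF CD(2)] by simp
    show "{a \<in> carrier (free_gmod (polyring V) (orientation_classes Gd) (\<lambda>_. graph_degree Gd)).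
         (\<Oplus>\<^bsub>CD\<^esub>i\<in>orientation_classes Gd. a i \<odot>\<^bsub>CD\<^esub> gD i) = \<zero>\<^bsub>CD\<^esub>} =
      submodule_generated (polyring V) (free_gmod (polyring V) (orientation_classes Gd) (\<lambda>_. graph_degree Gd)) (orientation_relations Gd)"
      using standard_generators_D(3)[OF CD(2)] by (simp only: delete_edge_simps)
    show "a \<in> carrier (free_gmod (polyring V) (orientation_classes Gd) (\<lambda>_. graph_degree Gd)) \<and>
        (\<Oplus>\<^bsub>Y\<^esub>i\<in>orientation_classes Gd. TD.\<sigma> (a i) \<odot>\<^bsub>Y\<^esub> q i) = \<zero>\<^bsub>Y\<^esub>" if "a \<in> orientation_relations Gd" for a
      using rel[OF that] unfolding L.comb_def by (simp only: delete_edge_simps)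
  qed
  then obtain \<chi> where "\<chi> \<in> mod_homs S TD.X Y" "\<And>K. K \<in> orientation_classes Gd \<Longrightarrow> \<chi> (TD.pure (gD K) 1) = q K"
    by blast
  moreover from this have "\<chi> (genD (delete_orientation G e A)) = \<pi> (genG A)" if "A \<in> acyclic_orientations G" for A
    using q[OF that] orientation_class_in[OF delete_orientation_acyclic[OF that]] by metis
  ultimately show ?thesis by blast
qed

lemma kernel_phi: "a_kernel TG.X TD.X \<phi> = Im"
proof
  show "Im \<subseteq> a_kernel TG.X TD.X \<phi>"
    using phi_psi_zero psi.hom_closed unfolding a_kernel_def' by blast
  obtain \<chi> where \<chi>: "\<chi> \<in> mod_homs S TD.X Y"
      "\<And>A. A \<in> acyclic_orientations G \<Longrightarrow> \<chi> (genD (delete_orientation G e A)) = \<pi> (genG A)"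
    using section_exists by blast
  interpret Y: module S Y by (rule Y_module)
  interpret \<chi>: abelian_group_hom TD.X Y \<chi>
    by (rule mod_homs_hom[OF \<chi>(1) TD.tensor_group Y.M.abelian_group_axioms])
  have comp: "(\<lambda>x. \<chi> (\<phi> x)) \<in> mod_homs S TG.X Y"
    by (rule mod_homsI[OF abelian_group_hom_comp[OF phi.abelian_group_hom_axioms \<chi>.abelian_group_hom_axioms]])
       (simp only: mod_homs_smult[OF \<chi>(1)] mod_homs_smult[OF phi_hom] phi.hom_closed)
  have "\<chi> (\<phi> x) = \<pi> x" if "x \<in> carrier TG.X" for x
  proof (rule mod_homs_eq_on_generators[OF XG.module_axioms Y_module comp \<pi>_hom generates_G _ that])
    fix x assume "x \<in> genG ` acyclic_orientations G"
    then show "x \<in> carrier TG.X \<and> \<chi> (\<phi> x) = \<pi> x" using genG_carrier phi_gen \<chi>(2) by auto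
  qed
  note \<chi>\<phi> = this
  show "a_kernel TG.X TD.X \<phi> \<subseteq> Im"
  proof
    fix x assume "x \<in> a_kernel TG.X TD.X \<phi>"
    then have x: "x \<in> carrier TG.X" "\<phi> x = \<zero>\<^bsub>TD.X\<^esub>" by (simp_all only: a_kernel_def' mem_Collect_eq)
    have "\<pi> x = \<zero>\<^bsub>Y\<^esub>" using \<chi>\<phi>[OF x(1)] unfolding x(2) \<chi>.hom_zero by (rule sym)
    then show "x \<in> Im" using \<pi>_zero_iff[OF x(1)] by blast
  qed
qed

text \<open>The image is a submodule, and it contains every generator because acyclic orientations
  extend over e.\<close>

lemma phi_surj: "\<phi> ` carrier TG.X = carrier TD.X"
proof
  show "\<phi> ` carrier TG.X \<subseteq> carrier TD.X" using phi.hom_closed by blast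
  have "genD ` acyclic_orientations Gd \<subseteq> \<phi> ` carrier TG.X"
  proof
    fix y assume "y \<in> genD ` acyclic_orientations Gd"
    then obtain B where B: "B \<in> acyclic_orientations Gd" "y = genD B" by blast
    obtain A where A: "A \<in> acyclic_orientations G" "delete_orientation G e A = B"
      using acyclic_lift_exists[OF B(1) eN] by blast
    show "y \<in> \<phi> ` carrier TG.X" using phi_gen[OF A(1)] genG_carrier[OF A(1)] A(2) B(2) by (metis imageI)
  qed
  then show "carrier TD.X \<subseteq> \<phi> ` carrier TG.X"
    by (rule generatesD[OF generates_D image_submodule[OF XG.module_axioms XD.module_axioms phi_hom]])
qed

section \<open>Degrees and exactness\<close>

lemma degrees: "graph_degree Ge = graph_degree G" "graph_degree Gd = graph_degree G + 1"
proof -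
  have fin: "finite V" "finite (edges G)" using G by (auto simp: multigraph_def)
  have "merge v1 v2 ` V = V - {v2}" using v_verts e(3) by (auto simp: merge_def image_iff)
  then have "card (verts Ge) = card V - 1" using v_verts(2) fin(1) by (simp add: verts_contract)
  \<comment> \<open>The edges parallel to e stay as loops and are still counted, so the loss of one
    edge offsets the loss of one vertex.\<close>
  moreover have "edges Ge = edges G - {e}" by (simp add: contract_edge_def)
  moreover have "card V \<ge> 1" "card (edges G) \<ge> 1"
    using fin v_verts(2) e(1) by (auto simp: Suc_le_eq card_gt_0_iff)
  ultimately show "graph_degree Ge = graph_degree G" "graph_degree Gd = graph_degree G + 1"
    using fin e(1) by (simp_all add: of_nat_diff)
qed

lemma genG_grade: "A \<in> acyclic_orientations G \<Longrightarrow> genG A \<in> grade TG.X (graph_degree G)"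
  using TG.pure_grade[OF standard_generators_D(1)[OF CG(2) orientation_class_in] polyring_grade_1] by simp

lemma genD_grade: "B \<in> acyclic_orientations Gd \<Longrightarrow> genD B \<in> grade TD.X (graph_degree G + 1)"
proof -
  assume "B \<in> acyclic_orientations Gd"
  from TD.pure_grade[OF standard_generators_D(1)[OF CD(2) orientation_class_in[OF this]] polyring_grade_1]
  show ?thesis unfolding degrees(2) by (simp only: add_0_right)
qed

lemma CC_graded: "graded_module S CC"
  using CC(1) by (simp add: verts_contract)

text \<open>The generators of source and target have the same degree, so the shift is the degree of
  the coefficient \<open>x\<^sub>e\<close>.\<close>

lemma psi_grade:
  assumes "y \<in> grade CC k"
  shows "\<psi> y \<in> grade TG.X (k + (int n\<^sub>e - 1))"
proof (rule graded_hom_from_generators[OF graded_group_polyring CC_graded TG.tensor_graded psi_hom _ _ assms])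
  show "generates S CC (gC ` orientation_classes Ge)"
    using standard_generators_D(2)[OF CC(2)] by (simp add: verts_contract)
  fix y assume "y \<in> gC ` orientation_classes Ge"
  then obtain B where B: "B \<in> acyclic_orientations Ge" "y = gC (orientation_class Ge B)"
    by (auto simp: orientation_classes_def)
  obtain A A' where op: "opposite_pair G v1 v2 A A'"
      and psiB: "\<psi> y = x\<^sub>e \<odot>\<^bsub>TG.X\<^esub> genG A \<oplus>\<^bsub>TG.X\<^esub> x\<^sub>e \<odot>\<^bsub>TG.X\<^esub> genG A'"
    using psi_generator[OF B(1)] B(2) by blast
  have A: "A \<in> acyclic_orientations G" "A' \<in> acyclic_orientations G" using op by (auto simp: opposite_pair_def)
  have x: "x\<^sub>e \<in> grade S (int n\<^sub>e - 1)"
    using polyring_grade_var_power[OF v1_W, of "n\<^sub>e - 1"] n_pos by (simp add: of_nat_diff)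
  have "x\<^sub>e \<odot>\<^bsub>TG.X\<^esub> genG A \<in> grade TG.X (int n\<^sub>e - 1 + graph_degree G)"
    "x\<^sub>e \<odot>\<^bsub>TG.X\<^esub> genG A' \<in> grade TG.X (int n\<^sub>e - 1 + graph_degree G)"
    using graded_module_D(4)[OF TG.tensor_graded x genG_grade] A by auto
  then have "\<psi> y \<in> grade TG.X (int n\<^sub>e - 1 + graph_degree G)"
    unfolding psiB by (rule additive_subgroup.a_closed[OF TG.tensor_grade_subgroup])
  moreover have "y \<in> grade CC (graph_degree G)"
    using standard_generators_D(1)[OF CC(2) orientation_class_in[OF B(1)]] B(2) degrees(1) by simp
  ultimately show "y \<in> grade CC (graph_degree G) \<and> \<psi> y \<in> grade TG.X (graph_degree G + (int n\<^sub>e - 1))"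
    by (simp add: add.commute)
qed

text \<open>Generators go to generators with coefficient 1; the shift is the one edge that the
  deletion loses.\<close>

lemma phi_grade:
  assumes "x \<in> grade TG.X k"
  shows "\<phi> x \<in> grade TD.X (k + 1)"
proof (rule graded_hom_from_generators[OF graded_group_polyring TG.tensor_graded TD.tensor_graded phi_hom generates_G _ assms])
  fix x assume "x \<in> genG ` acyclic_orientations G"
  then obtain A where A: "A \<in> acyclic_orientations G" "x = genG A" by blast
  show "x \<in> grade TG.X (graph_degree G) \<and> \<phi> x \<in> grade TD.X (graph_degree G + 1)"
    unfolding A(2) phi_gen[OF A(1)]
    by (intro conjI genG_grade[OF A(1)] genD_grade delete_orientation_acyclic[OF A(1)])
qed

lemma exactness:
  "short_exact_graded S (twist (- (int n\<^sub>e - 1)) (quot_gmod CC (a_kernel CC TG.X \<psi>))) (induced_map \<psi>) TG.X \<phi> (twist 1 TD.X)"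
proof -
  let ?K = "a_kernel CC TG.X \<psi>"
  let ?Q = "quot_gmod CC ?K"
  have mem: "y \<in> ?K \<longleftrightarrow> y \<in> carrier CC \<and> \<psi> y = \<zero>\<^bsub>TG.X\<^esub>" for y by (simp only: a_kernel_def' mem_Collect_eq)
  have K: "submodule ?K S CC" by (rule kernel_submodule[OF MC.module_axioms XG.module_axioms psi_hom])
  note quot = submodule_quotient[OF MC.module_axioms K]
  have coset: "induced_map \<psi> (?K +>\<^bsub>CC\<^esub> y) = \<psi> y" if "y \<in> carrier CC" for y
    by (rule quotient_group.induced_map(2)[OF quot(3) psi.abelian_group_hom_axioms _ that]) (simp add: mem)
  have hom: "abelian_group_hom ?Q TG.X (induced_map \<psi>)"
    by (rule quotient_group.induced_map(1)[OF quot(3) psi.abelian_group_hom_axioms]) (simp add: mem)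
  have Qc: "carrier ?Q = (\<lambda>y. ?K +>\<^bsub>CC\<^esub> y) ` carrier CC" by (rule quotient_group.quot_carrier[OF quot(3)])
  have lin: "induced_map \<psi> \<in> mod_homs S ?Q TG.X"
  proof (rule mod_homsI[OF hom])
    fix r z assume r: "r \<in> carrier S" and "z \<in> carrier ?Q"
    then obtain y where y: "y \<in> carrier CC" "z = ?K +>\<^bsub>CC\<^esub> y" unfolding Qc by blast
    show "induced_map \<psi> (r \<odot>\<^bsub>?Q\<^esub> z) = r \<odot>\<^bsub>TG.X\<^esub> induced_map \<psi> z"
      unfolding y(2) mod_homs_smult[OF quot(2) r y(1), symmetric] coset[OF y(1)] coset[OF MC.smult_closed[OF r y(1)]]
      by (rule mod_homs_smult[OF psi_hom r y(1)])
  qed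
  have gr: "induced_map \<psi> z \<in> grade TG.X (k + (int n\<^sub>e - 1))" if "z \<in> grade ?Q k" for z k
  proof -
    obtain y where y: "y \<in> grade CC k" "z = ?K +>\<^bsub>CC\<^esub> y" using \<open>z \<in> grade ?Q k\<close> unfolding quot_gmod_simps(2) by blast
    show ?thesis
      unfolding y(2) coset[OF graded_grp.grade_carrier[OF graded_module_D(2)[OF CC_graded] y(1)]]
      by (rule psi_grade[OF y(1)])
  qed
  have Q_graded: "graded_module S ?Q"
    by (rule graded_module_kernel_quotient[OF graded_group_polyring CC_graded TG.tensor_graded psi_hom psi_grade])
  have inj: "inj_on (induced_map \<psi>) (carrier ?Q)"
  proof (rule inj_onI)
    fix z z' assume "z \<in> carrier ?Q" "z' \<in> carrier ?Q" and eq: "induced_map \<psi> z = induced_map \<psi> z'"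
    then obtain y y' where y: "y \<in> carrier CC" "z = ?K +>\<^bsub>CC\<^esub> y" "y' \<in> carrier CC" "z' = ?K +>\<^bsub>CC\<^esub> y'"
      unfolding Qc by blast
    then have "\<psi> y = \<psi> y'" using eq coset by simp
    then have "\<psi> (y \<ominus>\<^bsub>CC\<^esub> y') = \<zero>\<^bsub>TG.X\<^esub>"
      using psi.hom_add[OF y(1) MC.M.a_inv_closed[OF y(3)]] psi.hom_a_inv[OF y(3)] TG.XG.r_neg[OF psi.hom_closed[OF y(3)]]
      by (simp add: a_minus_def)
    then have "y \<ominus>\<^bsub>CC\<^esub> y' \<in> ?K" using y by (simp add: mem)
    then show "z = z'" using quotient_group.quot_eq_iff[OF quot(3) y(1,3)] y(2,4) by simp
  qed
  have im: "induced_map \<psi> ` carrier ?Q = Im"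
    unfolding Qc image_image using coset by (rule image_cong[OF refl])
  show ?thesis
    unfolding short_exact_graded_def
  proof (intro conjI)
    show "graded_module S (twist (- (int n\<^sub>e - 1)) ?Q)" by (rule graded_module_twist[OF Q_graded])
    show "graded_module S TG.X" by (rule TG.tensor_graded)
    show "graded_module S (twist 1 TD.X)" by (rule graded_module_twist[OF TD.tensor_graded])
    have "induced_map \<psi> ` grade (twist (- (int n\<^sub>e - 1)) ?Q) k \<subseteq> grade TG.X k" for k
    proof
      fix y assume "y \<in> induced_map \<psi> ` grade (twist (- (int n\<^sub>e - 1)) ?Q) k"
      then obtain z where z: "z \<in> grade ?Q (- (int n\<^sub>e - 1) + k)" "y = induced_map \<psi> z"
        unfolding twist_simps(5) by blast
      \<comment> \<open>Degree k of the twisted quotient is degree k - (m_e - 1) of the quotient,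
        which the map raises back to k.\<close>
      have "- (int n\<^sub>e - 1) + k + (int n\<^sub>e - 1) = k" by simp
      with gr[OF z(1)] show "y \<in> grade TG.X k" unfolding z(2) by (simp only:)
    qed
    then show "induced_map \<psi> \<in> graded_homs S (twist (- (int n\<^sub>e - 1)) ?Q) TG.X"
      using lin unfolding graded_homs_def mod_homs_def twist_simps(1-4) by blast
    have "\<phi> ` grade TG.X k \<subseteq> grade (twist 1 TD.X) k" for k
      using phi_grade[of _ k] unfolding twist_simps(5) by (auto simp: add.commute)
    then show "\<phi> \<in> graded_homs S TG.X (twist 1 TD.X)"
      using phi_hom unfolding graded_homs_def mod_homs_def twist_simps(1-4) by blast
    show "inj_on (induced_map \<psi>) (carrier (twist (- (int n\<^sub>e - 1)) ?Q))" using inj by (simp only: twist_simps(1))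
    have "a_kernel TG.X (twist 1 TD.X) \<phi> = a_kernel TG.X TD.X \<phi>" by (simp only: a_kernel_def' twist_simps(3))
    then show "induced_map \<psi> ` carrier (twist (- (int n\<^sub>e - 1)) ?Q) = a_kernel TG.X (twist 1 TD.X) \<phi>"
      using im kernel_phi by (simp only: twist_simps(1))
    show "\<phi> ` carrier TG.X = carrier (twist 1 TD.X)" using phi_surj by (simp only: twist_simps(1))
  qed
qed

end

theorem theorem1p2:
  fixes G :: "('v, 'e) mgraph" and e :: 'e and v1 v2 :: 'v
    and CG :: "(('v, 'k::field) mpoly, 'a) gmodule"
    and CC :: "(('v, 'k) mpoly, 'b) gmodule"
    and CD :: "(('v, 'k) mpoly, 'c) gmodule"
  assumes char2: "CHAR('k) = 2"
    and G: "multigraph G" "connected_mgraph G" "card (verts G) \<ge> 3"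
    and e: "e \<in> edges G" "ends G e = {v1, v2}" "v1 \<noteq> v2" "\<not> bridge G e"
    and CTopp_G: "toppling_critical_module G CG" "standard_generators G CG gG"
    and CTopp_contract: "toppling_critical_module (contract_edge G e v1 v2) CC"
      "standard_generators (contract_edge G e v1 v2) CC gC"
    and CTopp_delete: "toppling_critical_module (delete_edge G e) CD"
      "standard_generators (delete_edge G e) CD gD"
    and psi1: "is_psi1 G e v1 v2 CC gC CG gG \<psi>\<^sub>1"
    and phi1: "is_phi1 G e v1 v2 CG gG CD gD \<phi>\<^sub>1"
  shows "short_exact_graded (polyring (verts (contract_edge G e v1 v2)))
    (twist (- (int (card (edges_between G v1 v2)) - 1))
      (quot_gmod CC (a_kernel CC (ctopp_tensor G v1 v2 CG) \<psi>\<^sub>1)))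
    (induced_map \<psi>\<^sub>1)
    (ctopp_tensor G v1 v2 CG)
    \<phi>\<^sub>1
    (twist 1 (ctopp_tensor (delete_edge G e) v1 v2 CD))"
proof -
  have "graded_module (polyring (verts G)) CG"
    "graded_module (polyring (verts (contract_edge G e v1 v2))) CC"
    "graded_module (polyring (verts (delete_edge G e))) CD"
    using CTopp_G(1) CTopp_contract(1) CTopp_delete(1)
    unfolding toppling_critical_module_def Let_def by blast+
  then interpret deletion_contraction G e v1 v2 CG CC CD gG gC gD \<psi>\<^sub>1 \<phi>\<^sub>1
    using assms by (intro deletion_contraction.intro)
  show ?thesis using exactness by (simp only: ctopp_simps verts_contract)
qed

end
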